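(* Every finite vertex-transitive digraph of out-valency at most three admits a nontrivial semiregular automorphism.
   Context: A digraph consists of a finite non-empty set of vertices together with an irreflexive, not necessarily symmetric, binary relation (the set of arcs) on it. The out-valency of a vertex $v$ is the number of vertices $w$ with $(v,w)$ an arc; a digraph has out-valency $d$ if every vertex has out-valency $d$. Automorphisms are vertex permutations preserving arcs; a digraph is vertex-transitive if its automorphism group is transitive on vertices. A permutation is semiregular if all its cycles (including those of length one) have the same length.
   Formalization: The digraph is assumed to have at least two vertices, because the one-vertex digraph is vertex-transitive of out-valency 0 and its only automorphism is the identity. *)

theory Defs
  imports
    "Graph_Theory.Pair_Digraph"
    "HOL-Combinatorics.Permutations"
    "HOL-Combinatorics.Orbits"
begin

(* The locale pair_digraph supplies finiteness, arcs between vertices and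
   irreflexivity, but it does not exclude an empty vertex set. *)

definition automorphisms :: "'a pair_pre_digraph \<Rightarrow> ('a \<Rightarrow> 'a) set" where
  "automorphisms G =
     {g. g permutes pverts G \<and>
         (\<forall>u\<in>pverts G. \<forall>v\<in>pverts G. (u, v) \<in> parcs G \<longleftrightarrow> (g u, g v) \<in> parcs G)}"

definition vertex_transitive :: "'a pair_pre_digraph \<Rightarrow> bool" where
  "vertex_transitive G \<longleftrightarrow>
     (\<forall>u\<in>pverts G. \<forall>v\<in>pverts G. \<exists>g\<in>automorphisms G. g u = v)"

definition has_out_valency :: "'a pair_pre_digraph \<Rightarrow> nat \<Rightarrow> bool" where
  "has_out_valency G d \<longleftrightarrow> (\<forall>v\<in>pverts G. out_degree (with_proj G) v = d)"

(* The cycle of the permutation g through x is orbit g x (for a fixed point,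
   {x}).  Only the points of V count, since g is the identity outside V. *)
definition semiregular_on :: "'a set \<Rightarrow> ('a \<Rightarrow> 'a) \<Rightarrow> bool" where
  "semiregular_on V g \<longleftrightarrow>
     g permutes V \<and> (\<forall>x\<in>V. \<forall>y\<in>V. card (orbit g x) = card (orbit g y))"

(* Only the identity permutes a single vertex, so a claim that some nontrivial
   automorphism exists has to assume at least two vertices. *)
lemma automorphisms_single_vertex:
  assumes "card (pverts G) = 1" and "g \<in> automorphisms G"
  shows "g = id"
  using assms by (auto simp: automorphisms_def card_1_singleton_iff)

end

theory Submission
  imports
    Defs
    "Jordan_Normal_Form.Schur_Decomposition"
    "HOL-Algebra.Solvable_Groups"
    "HOL-Algebra.Sylow"
    "HOL-Algebra.Group_Action"
    "HOL-Algebra.Weak_Morphisms"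
    "HOL-Algebra.Multiplicative_Group"
begin

text \<open>
  Let \<open>A\<close> be the automorphism group of a finite vertex-transitive digraph of out-valency
  \<open>d \<le> 3\<close>. Transitivity makes reachability symmetric, so the components are strongly connected and
  isomorphic to each other, and a semiregular automorphism of one of them can be copied to all the
  others (\<open>free_aut_from_component\<close>). For \<open>d = 0\<close> a cycle through all the vertices will do.
  So let the digraph be connected. Then an automorphism is trivial as soon as it fixes a vertex and
  fixes all out-neighbours of every vertex that it fixes (\<open>fixed_points_propagate\<close>).

  An automorphism of prime period \<open>p\<close> that fixes \<open>v\<close> and moves an out-neighbour of \<open>v\<close> moves \<open>p\<close>
  out-neighbours of \<open>v\<close> in a cycle. For odd \<open>p\<close> this leaves only \<open>p = d = 3\<close>, and then the stabilizer
  of \<open>v\<close> is transitive on the out-neighbours. Hence, unless \<open>d = 3\<close> and the digraph is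
  arc-transitive, either some odd prime divides the order of \<open>A\<close> and every automorphism of that order
  is semiregular, or \<open>A\<close> is a 2-group and every nontrivial central element is semiregular
  (\<open>free_aut_if_not_arc_transitive\<close>).

  Let now \<open>d = 3\<close> and let the digraph be arc-transitive. By the same argument one is done if a prime
  above 3 divides the order of \<open>A\<close>. Otherwise \<open>A\<close> is solvable by Burnside's theorem on groups of order
  \<open>2\<^sup>a r\<^sup>b\<close> and has a nontrivial abelian normal subgroup \<open>D\<close>. The stabilizer of \<open>v\<close> in
  \<open>D\<close> is normal in that of \<open>v\<close> in \<open>A\<close>, so on the three out-neighbours (and on the three in-neighbours)
  it is either trivial or transitive. If it is trivial, \<open>D\<close> acts freely and consists of semiregular
  elements. If it is transitive on both sides, commutativity of \<open>D\<close> forces any two vertices with a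
  common out-neighbour to have the same out-neighbourhood
  (\<open>free_aut_or_equal_out_neighbourhoods\<close>). This says that the digraph is the line digraph of a
  multidigraph: its vertices are the classes of vertices with equal out-neighbourhoods, and every
  original vertex is an arc. By transitivity either all arcs come in bundles of three parallel ones,
  which can be rotated simultaneously, or there are no parallel arcs; then the quotient is a smaller
  vertex-transitive digraph of out-valency 3, and a semiregular automorphism of it, which exists by
  induction, acts semiregularly on its arcs.

  The part of Burnside's theorem that needs representation theory is the statement that a group with
  an involution \<open>z\<close> whose conjugacy class \<open>K\<close> has prime power size \<open>q = p\<^sup>k > 1\<close> is not
  simple (\<open>involution_class_prime_power_ex_normal\<close>). For involutions it has a proof without
  characters. The sum \<open>M\<close> of the left translations by \<open>K\<close> is a symmetric integer matrix; let \<open>E\<close> be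
  the projection to its eigenspace for \<open>w\<close>. Put \<open>m = tr E\<close>, \<open>t = tr (L\<^sub>z E)\<close> and
  \<open>u = tr (L\<^sub>z R\<^sub>z E)\<close>, where \<open>L\<close> and \<open>R\<close> are left and right translations. These are
  integers, because \<open>L\<^sub>z\<close> and \<open>L\<^sub>z R\<^sub>z\<close> are involutions that commute with the idempotent \<open>E\<close>. Since
  all elements of \<open>K\<close> contribute equally to a trace, \<open>w m = q t\<close> and \<open>w\<^sup>2 m = q\<^sup>2 u\<close>, hence
  \<open>w t = q u\<close>. So \<open>w\<close> is a rational algebraic integer, that is, an integer, and if \<open>\<bar>w\<bar> < q\<close> then \<open>p\<close>
  divides \<open>t\<close>. If \<open>w = \<plusminus>q\<close>, then \<open>K\<close> acts on the eigenspace by the sign of \<open>w\<close>; in a simple group this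
  excludes \<open>-q\<close>, and for \<open>q\<close> it leaves only the constant functions, with \<open>t = 1\<close>. The sum of all \<open>t\<close>
  is the trace of \<open>L\<^sub>z\<close>, which is 0, but it is congruent to 1 modulo \<open>p\<close>.
\<close>

hide_const (open) Polynomial.order Orbits.orbit
hide_fact (open) Polynomial.order_def Orbits.orbit_def

section \<open>Traces and spectral idempotents of complex matrices\<close>

definition mat_trace :: "'a::comm_monoid_add mat \<Rightarrow> 'a" where
  "mat_trace A = (\<Sum>i<dim_row A. A $$ (i,i))"

lemma mat_trace_add:
  assumes "A \<in> carrier_mat n n" "B \<in> carrier_mat n n"
  shows "mat_trace (A + B) = mat_trace A + mat_trace B"
  using assms by (auto simp: mat_trace_def sum.distrib)

lemma mat_trace_smult:
  fixes A :: "'a::comm_ring_1 mat"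
  assumes "A \<in> carrier_mat n n"
  shows "mat_trace (c \<cdot>\<^sub>m A) = c * mat_trace A"
  using assms by (auto simp: mat_trace_def sum_distrib_left)

lemma index_mult_mat_sum:
  assumes "A \<in> carrier_mat n m" "B \<in> carrier_mat m k" "i < n" "j < k"
  shows "(A * B) $$ (i,j) = (\<Sum>l<m. A $$ (i,l) * B $$ (l,j))"
  using assms by (auto simp: scalar_prod_def intro!: sum.cong)

lemma mat_trace_comm:
  fixes A :: "'a::comm_ring_1 mat"
  assumes A: "A \<in> carrier_mat n n" and B: "B \<in> carrier_mat n n"
  shows "mat_trace (A * B) = mat_trace (B * A)"
proof -
  have "mat_trace (A * B) = (\<Sum>i<n. \<Sum>l<n. A $$ (i,l) * B $$ (l,i))"
    using A B by (auto simp: mat_trace_def index_mult_mat_sum[OF A B] simp del: index_mult_mat(1))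
  also have "\<dots> = (\<Sum>l<n. \<Sum>i<n. B $$ (l,i) * A $$ (i,l))"
    by (subst sum.swap) (simp add: mult.commute)
  also have "\<dots> = mat_trace (B * A)"
    using A B by (auto simp: mat_trace_def index_mult_mat_sum[OF B A] simp del: index_mult_mat(1))
  finally show ?thesis .
qed

lemma mat_trace_similar:
  fixes A :: "'a::comm_ring_1 mat"
  assumes A: "A \<in> carrier_mat n n" and P: "P \<in> carrier_mat n n" and Q: "Q \<in> carrier_mat n n"
    and "Q * P = 1\<^sub>m n"
  shows "mat_trace (P * A * Q) = mat_trace A"
proof -
  have "mat_trace (P * A * Q) = mat_trace (Q * (P * A))"
    by (rule mat_trace_comm) (use A P Q in auto)
  also have "Q * (P * A) = (Q * P) * A"
    by (rule assoc_mult_mat[symmetric, OF Q P A])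
  finally show ?thesis using assms(4) A by simp
qed

text \<open>
  Horner's scheme. Polynomials in a fixed matrix are needed because they commute with everything
  that commutes with the matrix, which a projection defined through eigenvectors does not show.
\<close>

definition mat_poly :: "nat \<Rightarrow> 'a::comm_ring_1 mat \<Rightarrow> 'a poly \<Rightarrow> 'a mat" where
  "mat_poly n M f = fold_coeffs (\<lambda>a X. a \<cdot>\<^sub>m 1\<^sub>m n + M * X) f (0\<^sub>m n n)"

lemma mat_poly_0 [simp]: "mat_poly n M 0 = 0\<^sub>m n n"
  by (simp add: mat_poly_def)

lemma mat_poly_pCons:
  assumes "M \<in> carrier_mat n n"
  shows "mat_poly n M (pCons a f) = a \<cdot>\<^sub>m 1\<^sub>m n + M * mat_poly n M f"
proof (cases "a = 0 \<and> f = 0")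
  case True
  then show ?thesis using assms by auto
next
  case False
  then show ?thesis by (auto simp: mat_poly_def)
qed

lemma mat_poly_carrier:
  assumes "M \<in> carrier_mat n n"
  shows "mat_poly n M f \<in> carrier_mat n n"
  by (induction f) (use assms in \<open>auto simp: mat_poly_pCons\<close>)

lemma mat_poly_dim [simp]:
  assumes "M \<in> carrier_mat n n"
  shows "dim_row (mat_poly n M f) = n" "dim_col (mat_poly n M f) = n"
  using mat_poly_carrier[OF assms, of f] by auto

lemma mat_poly_add:
  assumes M: "M \<in> carrier_mat n n"
  shows "mat_poly n M (f + g) = mat_poly n M f + mat_poly n M g"
proof (induction f g rule: poly_induct2)
  case 0
  show ?case by auto
next
  case (pCons a f b g)
  show ?case
    using M mat_poly_carrier[OF M, of f] mat_poly_carrier[OF M, of g]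
    by (auto simp: mat_poly_pCons pCons.IH mult_add_distrib_mat[OF M, of _ n] algebra_simps
          simp del: index_mult_mat(1))
qed

lemma mat_poly_smult:
  assumes M: "M \<in> carrier_mat n n"
  shows "mat_poly n M (Polynomial.smult c f) = c \<cdot>\<^sub>m mat_poly n M f"
proof (induction f)
  case 0
  show ?case by auto
next
  case (pCons a f)
  show ?case
    using M mat_poly_carrier[OF M, of f]
    by (auto simp: mat_poly_pCons pCons.IH mult_smult_distrib[OF M, of _ n] algebra_simps
          simp del: index_mult_mat(1))
qed

lemma mat_poly_1 [simp]: "M \<in> carrier_mat n n \<Longrightarrow> mat_poly n M 1 = 1\<^sub>m n"
  by (auto simp: one_pCons mat_poly_pCons)

lemma mat_poly_X: "M \<in> carrier_mat n n \<Longrightarrow> mat_poly n M [:0,1:] = M"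
  by (auto simp: mat_poly_pCons)

lemma mat_poly_mult:
  assumes M: "M \<in> carrier_mat n n"
  shows "mat_poly n M (f * g) = mat_poly n M f * mat_poly n M g"
proof (induction f)
  case 0
  show ?case using M by auto
next
  case (pCons a f)
  note c = mat_poly_carrier[OF M]
  have "mat_poly n M (pCons a f * g) = a \<cdot>\<^sub>m mat_poly n M g + M * (mat_poly n M f * mat_poly n M g)"
    using M c[of "f*g"] c[of g] by (auto simp: mat_poly_add mat_poly_smult mat_poly_pCons pCons.IH mult_pCons_left)
  also have "\<dots> = (a \<cdot>\<^sub>m 1\<^sub>m n) * mat_poly n M g + (M * mat_poly n M f) * mat_poly n M g"
    using mult_smult_assoc_mat[OF one_carrier_mat c[of g], of a] assoc_mult_mat[OF M c c, of f g] c[of g]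
    by simp
  also have "\<dots> = (a \<cdot>\<^sub>m 1\<^sub>m n + M * mat_poly n M f) * mat_poly n M g"
    by (rule add_mult_distrib_mat[symmetric, of _ n n]) (use M c in auto)
  finally show ?case by (simp add: mat_poly_pCons M)
qed

lemma mat_poly_commute:
  assumes M: "M \<in> carrier_mat n n" and X: "X \<in> carrier_mat n n" and XM: "X * M = M * X"
  shows "X * mat_poly n M f = mat_poly n M f * X"
proof (induction f)
  case 0
  show ?case using X by auto
next
  case (pCons a f)
  note c = mat_poly_carrier[OF M, of f]
  have "X * (M * mat_poly n M f) = (M * mat_poly n M f) * X"
    using assoc_mult_mat[OF X M c] assoc_mult_mat[OF M X c] assoc_mult_mat[OF M c X] pCons.IH XM
    by simp
  then show ?case
    using X M c
    by (simp add: mat_poly_pCons mult_add_distrib_mat[of _ n n _ n] add_mult_distrib_mat[of _ n n _ _ n]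
        mult_smult_distrib[of _ n n _ n] mult_smult_assoc_mat[of _ n n _ n])
qed

lemma mat_poly_similar:
  assumes B: "B \<in> carrier_mat n n" and P: "P \<in> carrier_mat n n" and Q: "Q \<in> carrier_mat n n"
    and PQ: "P * Q = 1\<^sub>m n" and QP: "Q * P = 1\<^sub>m n"
  shows "mat_poly n (P * B * Q) f = P * mat_poly n B f * Q"
proof (induction f)
  case 0
  show ?case using P Q by auto
next
  case (pCons a f)
  note c = mat_poly_carrier[OF B, of f]
  have "(P * B * Q) * (P * mat_poly n B f * Q) = P * (B * mat_poly n B f) * Q"
  proof -
    have "(P * B * Q) * (P * mat_poly n B f * Q) = P * (B * (Q * (P * (mat_poly n B f * Q))))"
      using B P Q c by (simp add: assoc_mult_mat[of _ n n _ n _ n])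
    also have "Q * (P * (mat_poly n B f * Q)) = mat_poly n B f * Q"
      using assoc_mult_mat[OF Q P, of "mat_poly n B f * Q" n] Q c by (simp add: QP)
    finally show ?thesis
      using B P Q c by (simp add: assoc_mult_mat[of _ n n _ n _ n])
  qed
  moreover have "P * (a \<cdot>\<^sub>m 1\<^sub>m n) * Q = a \<cdot>\<^sub>m 1\<^sub>m n"
    using P Q PQ by (simp add: mult_smult_distrib[of _ n n _ n] mult_smult_assoc_mat[of _ n n _ n])
  moreover have "P * (a \<cdot>\<^sub>m 1\<^sub>m n + B * mat_poly n B f) * Q
      = P * (a \<cdot>\<^sub>m 1\<^sub>m n) * Q + P * (B * mat_poly n B f) * Q"
    using B P Q c by (simp add: mult_add_distrib_mat[of _ n n _ n] add_mult_distrib_mat[of _ n n _ _ n])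
  ultimately show ?case
    using B P Q c pCons.IH by (simp add: mat_poly_pCons)
qed

lemma upper_triangular_mult:
  fixes A :: "'a::comm_ring_1 mat"
  assumes A: "A \<in> carrier_mat n n" and B: "B \<in> carrier_mat n n"
    and uA: "upper_triangular A" and uB: "upper_triangular B"
  shows "upper_triangular (A * B)"
    and "i < n \<Longrightarrow> (A * B) $$ (i,i) = A $$ (i,i) * B $$ (i,i)"
proof -
  have zero: "A $$ (i,l) * B $$ (l,j) = 0" if "i < n" "l < n" "j \<le> i" "l \<noteq> i \<or> j < i" for i j l
  proof (cases "l < i")
    case True
    then show ?thesis using upper_triangularD[OF uA, of l i] that A by auto
  next
    case False
    then have "j < l" using that by linarith
    then show ?thesis using upper_triangularD[OF uB, of j l] that B by auto
  qed
  show "upper_triangular (A * B)"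
  proof
    fix i j assume "j < i" "i < dim_row (A * B)"
    then have i: "i < n" and ji: "j < i" using A by auto
    have "(A * B) $$ (i,j) = (\<Sum>l<n. A $$ (i,l) * B $$ (l,j))"
      using i ji by (intro index_mult_mat_sum[OF A B]) auto
    also have "\<dots> = 0" using zero i ji by (intro sum.neutral) auto
    finally show "(A * B) $$ (i,j) = 0" .
  qed
  show "(A * B) $$ (i,i) = A $$ (i,i) * B $$ (i,i)" if i: "i < n"
  proof -
    have "(A * B) $$ (i,i) = (\<Sum>l<n. A $$ (i,l) * B $$ (l,i))"
      using i by (intro index_mult_mat_sum[OF A B]) auto
    also have "\<dots> = (\<Sum>l\<in>{i}. A $$ (i,l) * B $$ (l,i))"
      by (rule sum.mono_neutral_right) (use zero i in auto)
    finally show ?thesis by simp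
  qed
qed

lemma mat_poly_upper_triangular:
  assumes B: "B \<in> carrier_mat n n" and u: "upper_triangular B"
  shows "upper_triangular (mat_poly n B f) \<and>
    (\<forall>i<n. mat_poly n B f $$ (i,i) = poly f (B $$ (i,i)))"
proof (induction f)
  case 0
  show ?case by auto
next
  case (pCons a f)
  note c = mat_poly_carrier[OF B, of f]
  note m = upper_triangular_mult[OF B c u]
  have u2: "upper_triangular (B * mat_poly n B f)" using m(1) pCons.IH by blast
  have "upper_triangular (a \<cdot>\<^sub>m 1\<^sub>m n + B * mat_poly n B f)"
  proof
    fix i j assume "j < i" "i < dim_row (a \<cdot>\<^sub>m 1\<^sub>m n + B * mat_poly n B f)"
    then show "(a \<cdot>\<^sub>m 1\<^sub>m n + B * mat_poly n B f) $$ (i,j) = 0"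
      using upper_triangularD[OF u2, of j i] B c by (auto simp del: index_mult_mat(1))
  qed
  then show ?case
    using m(2) pCons.IH B c by (auto simp: mat_poly_pCons simp del: index_mult_mat(1))
qed

lemma complex_mat_triangular:
  fixes A :: "complex mat"
  assumes A: "A \<in> carrier_mat n n"
  obtains B P Q where "B \<in> carrier_mat n n" "P \<in> carrier_mat n n" "Q \<in> carrier_mat n n"
    "P * Q = 1\<^sub>m n" "Q * P = 1\<^sub>m n" "A = P * B * Q" "upper_triangular B"
    "\<And>i. i < n \<Longrightarrow> poly (char_poly A) (B $$ (i,i)) = 0"
proof -
  obtain es where es: "char_poly A = (\<Prod>e\<leftarrow>es. [:- e, 1:])"
    using char_poly_factorized[OF A] by blast
  obtain B P Q where "schur_decomposition A es = (B,P,Q)"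
    by (cases "schur_decomposition A es") auto
  from schur_decomposition[OF A es this]
  have s: "similar_mat_wit A B P Q" and u: "upper_triangular B" and d: "diag_mat B = es"
    by auto
  note w = similar_mat_witD2[OF A s]
  have "poly (char_poly A) (B $$ (i,i)) = 0" if "i < n" for i
  proof -
    have "B $$ (i,i) \<in> set es" using d w that by (auto simp: diag_mat_def)
    then show ?thesis unfolding es by (induction es) auto
  qed
  then show ?thesis using that w u by blast
qed

text \<open>A triangular matrix similar to the idempotent one has only 0 and 1 on its diagonal.\<close>

lemma mat_trace_idempotent:
  fixes A :: "complex mat"
  assumes A: "A \<in> carrier_mat n n" and AA: "A * A = A"
  shows "\<exists>k::nat. mat_trace A = of_nat k"
proof -
  obtain B P Q where B: "B \<in> carrier_mat n n" and P: "P \<in> carrier_mat n n" and Q: "Q \<in> carrier_mat n n"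
    and PQ: "P * Q = 1\<^sub>m n" and QP: "Q * P = 1\<^sub>m n" and AB: "A = P * B * Q" and u: "upper_triangular B"
    using complex_mat_triangular[OF A] by metis
  have "P * (B * B) * Q = P * B * Q"
  proof -
    have "A * A = P * (B * (Q * (P * (B * Q))))"
      unfolding AB using B P Q by (simp add: assoc_mult_mat[of _ n n _ n _ n])
    also have "Q * (P * (B * Q)) = B * Q"
      using assoc_mult_mat[OF Q P, of "B * Q" n] B Q by (simp add: QP)
    finally show ?thesis using AA B P Q by (simp add: AB assoc_mult_mat[of _ n n _ n _ n])
  qed
  then have "Q * (P * (B * B) * Q) * P = Q * (P * B * Q) * P" by simp
  moreover have "Q * (P * C * Q) * P = C" if C: "C \<in> carrier_mat n n" for C
  proof -
    have "Q * (P * C * Q) * P = Q * (P * (C * (Q * P)))"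
      using P Q C by (simp add: assoc_mult_mat[of _ n n _ n _ n])
    also have "\<dots> = (Q * P) * C"
      using assoc_mult_mat[OF Q P C] C by (simp add: QP)
    finally show ?thesis using C by (simp add: QP)
  qed
  ultimately have BB: "B * B = B" using B by (metis mult_carrier_mat)
  have "B $$ (i,i) = (if B $$ (i,i) = 1 then 1 else 0)" if "i < n" for i
    using upper_triangular_mult(2)[OF B B u u that] BB by auto
  then have "mat_trace B = (\<Sum>i<n. if B $$ (i,i) = 1 then 1 else 0)"
    using B by (auto simp: mat_trace_def intro!: sum.cong)
  also have "\<dots> = of_nat (\<Sum>i<n. if B $$ (i,i) = 1 then 1 else 0)"
    by (subst of_nat_sum, rule sum.cong) auto
  finally show ?thesis using mat_trace_similar[OF B P Q QP] AB by metis
qed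

text \<open>
  On the range of the idempotent \<open>A\<close>, the matrix \<open>X\<close> is an involution, and \<open>(A + X) / 2\<close> is the projection to its
  \<open>+1\<close>-eigenspace. So \<open>X\<close> is twice one idempotent minus another one, and idempotents have integer
  traces.
\<close>

lemma mat_trace_involution:
  fixes A X :: "complex mat"
  assumes A: "A \<in> carrier_mat n n" and X: "X \<in> carrier_mat n n"
    and AA: "A * A = A" and XX: "X * X = A" and AX: "A * X = X" and XA: "X * A = X"
  shows "mat_trace X \<in> \<int>"
proof -
  let ?Y = "(1/2) \<cdot>\<^sub>m (A + X)"
  have c: "A + X \<in> carrier_mat n n" "?Y \<in> carrier_mat n n" using A X by auto
  have "(A + X) * (A + X) = A * A + X * A + (A * X + X * X)"
    using A X by (simp add: mult_add_distrib_mat[of _ n n _ n] add_mult_distrib_mat[of _ n n _ _ n])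
  also have "\<dots> = 2 \<cdot>\<^sub>m (A + X)"
    using A X AA XX AX XA by (auto simp del: index_mult_mat(1) intro!: eq_matI)
  finally have sq: "(A + X) * (A + X) = 2 \<cdot>\<^sub>m (A + X)" .
  have "?Y * ?Y = (1/2) \<cdot>\<^sub>m ((1/2) \<cdot>\<^sub>m ((A + X) * (A + X)))"
    using mult_smult_assoc_mat[OF c(1) c(2)] mult_smult_distrib[OF c(1) c(1)] by simp
  also have "\<dots> = ?Y" unfolding sq using A X by (auto intro!: eq_matI)
  finally obtain k :: nat where k: "mat_trace ?Y = of_nat k"
    using mat_trace_idempotent[OF c(2)] by blast
  obtain l :: nat where l: "mat_trace A = of_nat l" using mat_trace_idempotent[OF A AA] by blast
  have "mat_trace ?Y = (mat_trace A + mat_trace X) / 2"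
    using mat_trace_smult[OF c(1)] mat_trace_add[OF A X] by simp
  then have "mat_trace X = of_int (2 * int k - int l)" using k l by (simp add: field_simps)
  then show ?thesis by (metis Ints_of_int)
qed

definition mat_conj_transpose :: "complex mat \<Rightarrow> complex mat" where
  "mat_conj_transpose A = mat (dim_col A) (dim_row A) (\<lambda>(i,j). cnj (A $$ (j,i)))"

lemma mat_conj_transpose_carrier [simp]:
  "A \<in> carrier_mat n m \<Longrightarrow> mat_conj_transpose A \<in> carrier_mat m n"
  by (auto simp: mat_conj_transpose_def)

lemma mat_conj_transpose_mult:
  assumes A: "A \<in> carrier_mat n n" and B: "B \<in> carrier_mat n n"
  shows "mat_conj_transpose (A * B) = mat_conj_transpose B * mat_conj_transpose A"
proof (rule eq_matI)
  note cA = mat_conj_transpose_carrier[OF A] and cB = mat_conj_transpose_carrier[OF B]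
  fix i j assume "i < dim_row (mat_conj_transpose B * mat_conj_transpose A)"
    "j < dim_col (mat_conj_transpose B * mat_conj_transpose A)"
  then have ij: "i < n" "j < n" using cA cB by auto
  have "mat_conj_transpose (A * B) $$ (i,j) = cnj (\<Sum>l<n. A $$ (j,l) * B $$ (l,i))"
    using ij A B by (simp add: mat_conj_transpose_def index_mult_mat_sum[OF A B] del: index_mult_mat(1))
  also have "\<dots> = (\<Sum>l<n. mat_conj_transpose B $$ (i,l) * mat_conj_transpose A $$ (l,j))"
    using ij A B by (auto simp: mat_conj_transpose_def mult.commute intro!: sum.cong)
  also have "\<dots> = (mat_conj_transpose B * mat_conj_transpose A) $$ (i,j)"
    by (rule index_mult_mat_sum[OF cB cA, symmetric]) (use ij in auto)
  finally show "mat_conj_transpose (A * B) $$ (i,j) = (mat_conj_transpose B * mat_conj_transpose A) $$ (i,j)" .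
qed (use A B in \<open>auto simp: mat_conj_transpose_def\<close>)

lemma mat_conj_transpose_add:
  assumes "A \<in> carrier_mat n n" "B \<in> carrier_mat n n"
  shows "mat_conj_transpose (A + B) = mat_conj_transpose A + mat_conj_transpose B"
  using assms by (auto simp: mat_conj_transpose_def intro!: eq_matI)

lemma mat_trace_conj_transpose_mult:
  assumes A: "A \<in> carrier_mat n n"
  shows "mat_trace (mat_conj_transpose A * A) = of_real (\<Sum>i<n. \<Sum>j<n. (cmod (A $$ (j,i)))\<^sup>2)"
proof -
  note cA = mat_conj_transpose_carrier[OF A]
  have "mat_trace (mat_conj_transpose A * A) = (\<Sum>i<n. \<Sum>j<n. mat_conj_transpose A $$ (i,j) * A $$ (j,i))"
    unfolding mat_trace_def
    by (rule sum.cong) (use A carrier_matD[OF cA] in \<open>auto simp: index_mult_mat_sum[OF cA A] simp del: index_mult_mat(1)\<close>)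
  also have "\<dots> = (\<Sum>i<n. \<Sum>j<n. of_real ((cmod (A $$ (j,i)))\<^sup>2))"
    using A by (intro sum.cong refl) (auto simp: mat_conj_transpose_def complex_norm_square mult.commute simp flip: of_real_power)
  finally show ?thesis by simp
qed

lemma mat_trace_conj_transpose_eq_0:
  assumes A: "A \<in> carrier_mat n n" and "mat_trace (mat_conj_transpose A * A) = 0"
  shows "A = 0\<^sub>m n n"
proof -
  have "(\<Sum>i<n. \<Sum>j<n. (cmod (A $$ (j,i)))\<^sup>2) = 0"
    using assms mat_trace_conj_transpose_mult[OF A] by (metis of_real_eq_0_iff)
  then have "\<forall>i<n. \<forall>j<n. A $$ (j,i) = 0"
    by (subst (asm) sum_nonneg_eq_0_iff; (auto intro!: sum_nonneg)?)
       (subst (asm) sum_nonneg_eq_0_iff; auto)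
  then show ?thesis using A by (auto intro!: eq_matI)
qed



lemma mat_conj_transpose_mat_poly:
  assumes M: "M \<in> carrier_mat n n" and sym: "mat_conj_transpose M = M"
  shows "mat_conj_transpose (mat_poly n M f) = mat_poly n M (map_poly cnj f)"
proof (induction f)
  case 0
  show ?case by (auto simp: mat_conj_transpose_def)
next
  case (pCons a f)
  note c = mat_poly_carrier[OF M]
  have [simp]: "mat_conj_transpose (a \<cdot>\<^sub>m 1\<^sub>m n) = cnj a \<cdot>\<^sub>m 1\<^sub>m n"
    by (auto simp: mat_conj_transpose_def)
  have "mat_conj_transpose (mat_poly n M (pCons a f))
      = cnj a \<cdot>\<^sub>m 1\<^sub>m n + mat_poly n M (map_poly cnj f) * M"
    using M c[of f] pCons.IH
    by (simp add: mat_poly_pCons mat_conj_transpose_add[of _ n] mat_conj_transpose_mult[of _ n] sym)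
  also have "mat_poly n M (map_poly cnj f) * M = M * mat_poly n M (map_poly cnj f)"
    by (rule mat_poly_commute[OF M M refl, symmetric])
  finally show ?case
    using M by (cases "a = 0 \<and> f = 0") (auto simp: mat_poly_pCons map_poly_pCons)
qed

text \<open>
  The spectral theorem in the form of idempotents that are polynomials in \<open>M\<close>. With \<open>f\<close> the Lagrange
  polynomial of an eigenvalue, \<open>f(M)\<close> is the projection to the eigenspace. Diagonalizability enters
  through the trace: \<open>tr (f(M)\<^sup>* f(M))\<close> is the sum of the values of \<open>cnj f * f\<close> at the eigenvalues, so
  \<open>f(M) = 0\<close> if \<open>f\<close> vanishes there.
\<close>

lemma hermitian_spectral_resolution:
  fixes M :: "complex mat"
  assumes M: "M \<in> carrier_mat n n" and sym: "mat_conj_transpose M = M"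
  obtains S :: "complex set" and E :: "complex \<Rightarrow> complex mat"
  where "finite S" "\<And>w. w \<in> S \<Longrightarrow> poly (char_poly M) w = 0"
    "\<And>w. E w \<in> carrier_mat n n"
    "\<And>w. w \<in> S \<Longrightarrow> E w * E w = E w"
    "\<And>w. w \<in> S \<Longrightarrow> M * E w = w \<cdot>\<^sub>m E w"
    "\<And>w. w \<in> S \<Longrightarrow> mat_trace (E w) \<noteq> 0"
    "\<And>w X. X \<in> carrier_mat n n \<Longrightarrow> X * M = M * X \<Longrightarrow> X * E w = E w * X"
    "\<And>X. X \<in> carrier_mat n n \<Longrightarrow> mat_trace X = (\<Sum>w\<in>S. mat_trace (X * E w))"
proof -
  obtain B P Q where B: "B \<in> carrier_mat n n" and P: "P \<in> carrier_mat n n" and Q: "Q \<in> carrier_mat n n"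
    and PQ: "P * Q = 1\<^sub>m n" and QP: "Q * P = 1\<^sub>m n" and MB: "M = P * B * Q" and u: "upper_triangular B"
    and root: "\<And>i. i < n \<Longrightarrow> poly (char_poly M) (B $$ (i,i)) = 0"
    using complex_mat_triangular[OF M] by metis
  note c = mat_poly_carrier[OF M]
  define S where "S = (\<lambda>i. B $$ (i,i)) ` {..<n}"
  have fin: "finite S" by (simp add: S_def)
  have tr: "mat_trace (mat_poly n M f) = (\<Sum>i<n. poly f (B $$ (i,i)))" for f
  proof -
    have "mat_trace (mat_poly n M f) = mat_trace (mat_poly n B f)"
      unfolding MB mat_poly_similar[OF B P Q PQ QP]
      by (rule mat_trace_similar[OF mat_poly_carrier[OF B] P Q QP])
    then show ?thesis
      using mat_poly_upper_triangular[OF B u, of f] B by (simp add: mat_trace_def)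
  qed
  \<comment> \<open>A polynomial in \<open>M\<close> is determined by its values on the spectrum.\<close>
  have vanish: "mat_poly n M f = 0\<^sub>m n n" if f: "\<And>w. w \<in> S \<Longrightarrow> poly f w = 0" for f
  proof (rule mat_trace_conj_transpose_eq_0[OF c])
    have "mat_conj_transpose (mat_poly n M f) * mat_poly n M f = mat_poly n M (map_poly cnj f * f)"
      by (simp add: mat_conj_transpose_mat_poly[OF M sym] mat_poly_mult[OF M])
    then show "mat_trace (mat_conj_transpose (mat_poly n M f) * mat_poly n M f) = 0"
      using f by (simp add: tr S_def)
  qed
  have eq: "mat_poly n M f = mat_poly n M g" if "\<And>w. w \<in> S \<Longrightarrow> poly f w = poly g w" for f g
  proof -
    have "mat_poly n M f = mat_poly n M (f - g) + mat_poly n M g"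
      using mat_poly_add[OF M, of "f - g" g] by simp
    then show ?thesis using vanish[of "f - g"] that c[of g] by simp
  qed
  define f where "f = (\<lambda>w. \<Prod>v\<in>S - {w}. Polynomial.smult (1 / (w - v)) [:- v, 1:])"
  have f: "poly (f w) v = (if v = w then 1 else 0)" if "w \<in> S" "v \<in> S" for w v
  proof (cases "v = w")
    case True
    have "poly (f w) w = (\<Prod>v\<in>S - {w}. 1)"
      unfolding f_def poly_prod by (rule prod.cong) (auto simp flip: diff_divide_distrib)
    then show ?thesis using True by simp
  next
    case False
    then have "v \<in> S - {w}" using that by auto
    then have "poly (f w) v = 0"
      unfolding f_def poly_prod using fin by (intro prod_zero) (auto intro!: bexI[of _ v])
    then show ?thesis using False by simp
  qed
  define E where "E = (\<lambda>w. mat_poly n M (f w))"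
  show thesis
  proof
    show "finite S" by fact
    show "poly (char_poly M) w = 0" if "w \<in> S" for w using that root by (auto simp: S_def)
    show "E w \<in> carrier_mat n n" for w by (simp add: E_def c)
    show "E w * E w = E w" if "w \<in> S" for w
      unfolding E_def mat_poly_mult[OF M, symmetric] using f that by (intro eq) auto
    show "M * E w = w \<cdot>\<^sub>m E w" if "w \<in> S" for w
    proof -
      have "M * E w = mat_poly n M ([:0,1:] * f w)"
        unfolding E_def by (simp only: mat_poly_mult[OF M] mat_poly_X[OF M])
      also have "\<dots> = mat_poly n M (Polynomial.smult w (f w))"
        using f that by (intro eq) auto
      finally show ?thesis by (simp add: E_def mat_poly_smult[OF M])
    qed
    show "mat_trace (E w) \<noteq> 0" if w: "w \<in> S" for w
    proof -
      obtain j where j: "j < n" "w = B $$ (j,j)" using w by (auto simp: S_def)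
      have "mat_trace (E w) = (\<Sum>i<n. if B $$ (i,i) = w then 1 else 0)"
        unfolding E_def tr using f[OF w] by (intro sum.cong) (auto simp: S_def)
      also have "\<dots> = of_nat (card {i. i < n \<and> B $$ (i,i) = w})"
        by (simp add: sum.If_cases Int_def)
      finally show ?thesis using j by auto
    qed
    show "X * E w = E w * X" if "X \<in> carrier_mat n n" "X * M = M * X" for w X
      unfolding E_def by (rule mat_poly_commute[OF M that])
    show "mat_trace X = (\<Sum>w\<in>S. mat_trace (X * E w))" if X: "X \<in> carrier_mat n n" for X
    proof -
      have "mat_trace (X * mat_poly n M (\<Sum>w\<in>T. f w)) = (\<Sum>w\<in>T. mat_trace (X * E w))"
        if "finite T" for T
        using that
      proof (induction T)
        case empty
        then show ?case using X by (simp add: mat_trace_def)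
      next
        case (insert w T)
        have "X * mat_poly n M (\<Sum>w\<in>insert w T. f w) = X * E w + X * mat_poly n M (\<Sum>w\<in>T. f w)"
          using insert.hyps mult_add_distrib_mat[OF X c c] by (simp add: mat_poly_add[OF M] E_def)
        then show ?case
          using insert mat_trace_add[of "X * E w" n "X * mat_poly n M (\<Sum>w\<in>T. f w)"] X c
          by (simp add: E_def)
      qed
      from this[OF fin] have "(\<Sum>w\<in>S. mat_trace (X * E w)) = mat_trace (X * mat_poly n M (\<Sum>w\<in>S. f w))"
        by simp
      also have "mat_poly n M (\<Sum>w\<in>S. f w) = mat_poly n M 1"
        using f fin by (intro eq) (simp add: poly_sum)
      finally show ?thesis using X M by simp
    qed
  qed
qed

lemma integer_mat_eigenvalue_algebraic_int:
  fixes M :: "complex mat"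
  assumes M: "M \<in> carrier_mat n n" and int: "\<And>i j. i < n \<Longrightarrow> j < n \<Longrightarrow> M $$ (i,j) \<in> \<int>"
    and w: "poly (char_poly M) w = 0"
  shows "algebraic_int w"
proof -
  define N :: "int mat" where "N = mat n n (\<lambda>(i,j). SOME k. M $$ (i,j) = of_int k)"
  have "\<exists>k. M $$ (i,j) = of_int k" if "i < n" "j < n" for i j
    using int[OF that] by (auto elim: Ints_cases)
  then have MN: "M = map_mat of_int N"
    using M by (auto simp: N_def intro!: eq_matI someI_ex[of "\<lambda>k. M $$ (_,_) = of_int k"])
  have N: "N \<in> carrier_mat n n" by (simp add: N_def)
  have "char_poly M = map_poly of_int (char_poly N)"
    unfolding MN by (rule of_int_hom.char_poly_hom[OF N])
  then show ?thesis
    using w degree_monic_char_poly[OF N] unfolding algebraic_int_altdef_ipoly by auto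
qed

lemma mat_assoc4:
  fixes A :: "'a::semiring_1 mat"
  assumes "A \<in> carrier_mat n n" "B \<in> carrier_mat n n" "C \<in> carrier_mat n n" "D \<in> carrier_mat n n"
  shows "A * B * C * D = A * (B * (C * D))" "A * (B * C) * D = A * (B * (C * D))"
  using assms by (simp_all add: assoc_mult_mat[of _ n n _ n _ n])

lemma mat_trace_mult_sum:
  fixes M :: "'a::comm_ring_1 mat"
  assumes M: "M \<in> carrier_mat n n" and X: "X \<in> carrier_mat n n"
    and A: "\<And>k. k \<in> K \<Longrightarrow> A k \<in> carrier_mat n n"
    and sum: "\<And>i j. i < n \<Longrightarrow> j < n \<Longrightarrow> M $$ (i,j) = (\<Sum>k\<in>K. A k $$ (i,j))"
  shows "mat_trace (M * X) = (\<Sum>k\<in>K. mat_trace (A k * X))"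
proof -
  have "mat_trace (M * X) = (\<Sum>i<n. \<Sum>l<n. M $$ (i,l) * X $$ (l,i))"
    using M X by (auto simp: mat_trace_def index_mult_mat_sum[OF M X] simp del: index_mult_mat(1))
  also have "\<dots> = (\<Sum>i<n. \<Sum>l<n. \<Sum>k\<in>K. A k $$ (i,l) * X $$ (l,i))"
    by (intro sum.cong refl) (auto simp: sum sum_distrib_right)
  also have "\<dots> = (\<Sum>i<n. \<Sum>k\<in>K. \<Sum>l<n. A k $$ (i,l) * X $$ (l,i))"
    by (intro sum.cong refl sum.swap)
  also have "\<dots> = (\<Sum>k\<in>K. \<Sum>i<n. \<Sum>l<n. A k $$ (i,l) * X $$ (l,i))"
    by (rule sum.swap)
  also have "\<dots> = (\<Sum>k\<in>K. mat_trace (A k * X))"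
  proof (rule sum.cong[OF refl])
    fix k assume "k \<in> K"
    then have Ak: "A k \<in> carrier_mat n n" by (rule A)
    show "(\<Sum>i<n. \<Sum>l<n. A k $$ (i,l) * X $$ (l,i)) = mat_trace (A k * X)"
      using Ak X by (auto simp: mat_trace_def index_mult_mat_sum[OF Ak X] simp del: index_mult_mat(1))
  qed
  finally show ?thesis .
qed

lemma mat_trace_involution_mult:
  fixes E U :: "complex mat"
  assumes E: "E \<in> carrier_mat n n" and U: "U \<in> carrier_mat n n"
    and EE: "E * E = E" and UU: "U * U = 1\<^sub>m n" and UE: "U * E = E * U"
  shows "mat_trace (U * E) \<in> \<int>"
proof (rule mat_trace_involution[OF E])
  show c: "U * E \<in> carrier_mat n n" using U E by simp
  show "(U * E) * E = U * E" using assoc_mult_mat[OF U E E] EE by simp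
  show "E * (U * E) = U * E" using assoc_mult_mat[OF E U E] assoc_mult_mat[OF U E E] EE UE by simp
  show "U * E * (U * E) = E"
  proof -
    have "U * E * (U * E) = U * (E * (U * E))" by (rule assoc_mult_mat[OF U E c])
    also have "\<dots> = U * (U * E)" by (simp add: \<open>E * (U * E) = U * E\<close>)
    also have "\<dots> = E" using assoc_mult_mat[OF U U E] UU E by simp
    finally show ?thesis .
  qed
qed (rule EE)



section \<open>Translation matrices of a finite group\<close>

text \<open>The matrices are indexed by natural numbers, so the elements of the group have to be numbered.\<close>

locale enumerated_group = group G for G (structure) +
  fixes n :: nat and e :: "nat \<Rightarrow> 'a"
  assumes e: "bij_betw e {..<n} (carrier G)"
begin

definition left_mat :: "'a \<Rightarrow> complex mat" where
  "left_mat g = mat n n (\<lambda>(i,j). of_bool (e i = g \<otimes> e j))"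

definition right_mat :: "'a \<Rightarrow> complex mat" where
  "right_mat g = mat n n (\<lambda>(i,j). of_bool (e i = e j \<otimes> g))"

lemma e_closed: "i < n \<Longrightarrow> e i \<in> carrier G"
  using e by (auto simp: bij_betw_def)

lemma e_eq_iff: "i < n \<Longrightarrow> j < n \<Longrightarrow> e i = e j \<longleftrightarrow> i = j"
  using e by (auto simp: bij_betw_def inj_on_def)

lemma e_surj: "x \<in> carrier G \<Longrightarrow> \<exists>i<n. e i = x"
  using bij_betw_imp_surj_on[OF e] by (metis imageE lessThan_iff)

lemma left_mat_carrier [simp]: "left_mat g \<in> carrier_mat n n"
  and right_mat_carrier [simp]: "right_mat g \<in> carrier_mat n n"
  by (simp_all add: left_mat_def right_mat_def)

lemma sum_of_bool_e:
  assumes "x \<in> carrier G"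
  shows "(\<Sum>l<n. of_bool (P (e l)) * of_bool (e l = x)) = (of_bool (P x) :: complex)"
proof -
  obtain m where m: "m < n" "e m = x" using e_surj[OF assms] by auto
  have "(\<Sum>l<n. of_bool (P (e l)) * of_bool (e l = x)) = (\<Sum>l<n. if l = m then of_bool (P x) else (0::complex))"
    using m e_eq_iff by (intro sum.cong) auto
  then show ?thesis using m by simp
qed

lemma left_mat_mult:
  assumes "g \<in> carrier G" "h \<in> carrier G"
  shows "left_mat g * left_mat h = left_mat (g \<otimes> h)"
proof (rule eq_matI)
  fix i j assume "i < dim_row (left_mat (g \<otimes> h))" "j < dim_col (left_mat (g \<otimes> h))"
  then have ij: "i < n" "j < n" by (auto simp: left_mat_def)
  have "(left_mat g * left_mat h) $$ (i,j)
      = (\<Sum>l<n. of_bool (e i = g \<otimes> e l) * of_bool (e l = h \<otimes> e j))"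
    using ij by (subst index_mult_mat_sum[of _ n n _ n]) (auto simp: left_mat_def)
  also have "\<dots> = of_bool (e i = g \<otimes> (h \<otimes> e j))"
    by (rule sum_of_bool_e) (use ij assms e_closed in auto)
  finally show "(left_mat g * left_mat h) $$ (i,j) = left_mat (g \<otimes> h) $$ (i,j)"
    using ij assms e_closed by (simp add: left_mat_def m_assoc)
qed (auto simp: left_mat_def)

lemma right_mat_mult:
  assumes "g \<in> carrier G" "h \<in> carrier G"
  shows "right_mat g * right_mat h = right_mat (h \<otimes> g)"
proof (rule eq_matI)
  fix i j assume "i < dim_row (right_mat (h \<otimes> g))" "j < dim_col (right_mat (h \<otimes> g))"
  then have ij: "i < n" "j < n" by (auto simp: right_mat_def)
  have "(right_mat g * right_mat h) $$ (i,j)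
      = (\<Sum>l<n. of_bool (e i = e l \<otimes> g) * of_bool (e l = e j \<otimes> h))"
    using ij by (subst index_mult_mat_sum[of _ n n _ n]) (auto simp: right_mat_def)
  also have "\<dots> = of_bool (e i = (e j \<otimes> h) \<otimes> g)"
    by (rule sum_of_bool_e) (use ij assms e_closed in auto)
  finally show "(right_mat g * right_mat h) $$ (i,j) = right_mat (h \<otimes> g) $$ (i,j)"
    using ij assms e_closed by (simp add: right_mat_def m_assoc)
qed (auto simp: right_mat_def)

lemma left_right_mat_commute:
  assumes "g \<in> carrier G" "h \<in> carrier G"
  shows "left_mat g * right_mat h = right_mat h * left_mat g"
proof (rule eq_matI)
  fix i j assume "i < dim_row (right_mat h * left_mat g)" "j < dim_col (right_mat h * left_mat g)"
  then have ij: "i < n" "j < n" by (auto simp: left_mat_def right_mat_def)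
  have "(left_mat g * right_mat h) $$ (i,j)
      = (\<Sum>l<n. of_bool (e i = g \<otimes> e l) * of_bool (e l = e j \<otimes> h))"
    using ij by (subst index_mult_mat_sum[of _ n n _ n]) (auto simp: left_mat_def right_mat_def)
  also have "\<dots> = of_bool (e i = g \<otimes> (e j \<otimes> h))"
    by (rule sum_of_bool_e) (use ij assms e_closed in auto)
  also have "\<dots> = of_bool (e i = (g \<otimes> e j) \<otimes> h)"
    using ij assms e_closed by (simp add: m_assoc)
  also have "\<dots> = (\<Sum>l<n. of_bool (e i = e l \<otimes> h) * of_bool (e l = g \<otimes> e j))"
    by (rule sum_of_bool_e[symmetric]) (use ij assms e_closed in auto)
  also have "\<dots> = (right_mat h * left_mat g) $$ (i,j)"
    using ij by (subst index_mult_mat_sum[of _ n n _ n]) (auto simp: left_mat_def right_mat_def)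
  finally show "(left_mat g * right_mat h) $$ (i,j) = (right_mat h * left_mat g) $$ (i,j)" .
qed (auto simp: left_mat_def right_mat_def)

lemma left_mat_one: "left_mat \<one> = 1\<^sub>m n"
  and right_mat_one: "right_mat \<one> = 1\<^sub>m n"
  using e_closed e_eq_iff by (auto simp: left_mat_def right_mat_def intro!: eq_matI)

lemma left_mat_inv:
  assumes "g \<in> carrier G"
  shows "left_mat g * left_mat (inv g) = 1\<^sub>m n" "left_mat (inv g) * left_mat g = 1\<^sub>m n"
  using assms by (simp_all add: left_mat_mult left_mat_one)

lemma right_mat_inv:
  assumes "g \<in> carrier G"
  shows "right_mat g * right_mat (inv g) = 1\<^sub>m n" "right_mat (inv g) * right_mat g = 1\<^sub>m n"
  using assms by (simp_all add: right_mat_mult right_mat_one)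

lemma mat_trace_left_mat:
  assumes "g \<in> carrier G" "g \<noteq> \<one>"
  shows "mat_trace (left_mat g) = 0"
proof -
  have "e i \<noteq> g \<otimes> e i" if "i < n" for i
    using assms e_closed[OF that] by (metis r_cancel_one)
  then show ?thesis by (simp add: mat_trace_def left_mat_def)
qed

lemma mat_conj_transpose_left_mat:
  assumes "g \<in> carrier G"
  shows "mat_conj_transpose (left_mat g) = left_mat (inv g)"
proof -
  have "e j = g \<otimes> e i \<longleftrightarrow> e i = inv g \<otimes> e j" if "i < n" "j < n" for i j
    using assms e_closed that by (metis inv_solve_left)
  then show ?thesis
    by (auto simp: mat_conj_transpose_def left_mat_def intro!: eq_matI)
qed

definition class_mat :: "'a set \<Rightarrow> complex mat" where
  "class_mat K = mat n n (\<lambda>(i,j). of_bool (e i \<otimes> inv (e j) \<in> K))"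

lemma class_mat_carrier [simp]: "class_mat K \<in> carrier_mat n n"
  by (simp add: class_mat_def)

text \<open>
  The class sum of a conjugation invariant set is central in the group algebra, so it is the same
  sum of left and of right translations. That \<open>class_mat K\<close> is both is what relates its square to the
  mixed traces \<open>tr (R\<^sub>z L\<^sub>z E)\<close>.
\<close>

lemma class_mat_eq_sum_left:
  assumes "K \<subseteq> carrier G" "finite K" "i < n" "j < n"
  shows "class_mat K $$ (i,j) = (\<Sum>k\<in>K. left_mat k $$ (i,j))"
proof -
  have "e i = k \<otimes> e j \<longleftrightarrow> k = e i \<otimes> inv (e j)" if "k \<in> K" for k
    using assms(1) that e_closed[OF assms(3)] e_closed[OF assms(4)] by (metis inv_solve_right subsetD)
  then have "(\<Sum>k\<in>K. left_mat k $$ (i,j)) = (\<Sum>k\<in>K. if k = e i \<otimes> inv (e j) then 1 else 0)"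
    using assms(3,4) by (intro sum.cong) (auto simp: left_mat_def)
  then show ?thesis using assms by (simp add: class_mat_def)
qed

lemma class_mat_eq_sum_right:
  assumes "K \<subseteq> carrier G" "finite K" "i < n" "j < n"
    and conj: "\<And>x k. x \<in> carrier G \<Longrightarrow> k \<in> K \<Longrightarrow> x \<otimes> k \<otimes> inv x \<in> K"
  shows "class_mat K $$ (i,j) = (\<Sum>k\<in>K. right_mat k $$ (i,j))"
proof -
  note c = e_closed[OF assms(3)] e_closed[OF assms(4)]
  have "e i = e j \<otimes> k \<longleftrightarrow> k = inv (e j) \<otimes> e i" if "k \<in> K" for k
    using assms(1) that c by (metis inv_solve_left subsetD)
  then have "(\<Sum>k\<in>K. right_mat k $$ (i,j)) = (\<Sum>k\<in>K. if k = inv (e j) \<otimes> e i then 1 else 0)"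
    using assms(3,4) by (intro sum.cong) (auto simp: right_mat_def)
  also have "\<dots> = of_bool (inv (e j) \<otimes> e i \<in> K)" using assms(2) by simp
  also have "inv (e j) \<otimes> e i \<in> K \<longleftrightarrow> e i \<otimes> inv (e j) \<in> K"
  proof
    assume "inv (e j) \<otimes> e i \<in> K"
    from conj[OF c(2) this] show "e i \<otimes> inv (e j) \<in> K"
      using c by (metis inv_closed l_one m_assoc m_closed r_inv)
  next
    assume "e i \<otimes> inv (e j) \<in> K"
    from conj[OF inv_closed[OF c(2)] this] show "inv (e j) \<otimes> e i \<in> K"
      using c by (simp add: m_assoc)
  qed
  finally show ?thesis using assms by (simp add: class_mat_def)
qed

text \<open>
  On an eigenspace of the class sum for the eigenvalue \<open>w\<close>, the squared norms of \<open>L\<^sub>k E + c E\<close> with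
  \<open>c = \<plusminus>1\<close> add up to a nonnegative multiple of \<open>\<bar>K\<bar> + c w\<close>. This bounds \<open>w\<close> by \<open>\<bar>K\<bar>\<close> and shows that in the
  case of equality every element of \<open>K\<close> acts as the scalar \<open>-c\<close>.
\<close>

lemma sum_norm_class:
  fixes E :: "complex mat" and c :: real
  assumes K: "K \<subseteq> carrier G" "finite K" and sq: "\<And>k. k \<in> K \<Longrightarrow> k \<otimes> k = \<one>"
    and E: "E \<in> carrier_mat n n" and w: "class_mat K * E = w \<cdot>\<^sub>m E" and c: "c\<^sup>2 = 1"
  shows "(\<Sum>k\<in>K. mat_trace (mat_conj_transpose (left_mat k * E + of_real c \<cdot>\<^sub>m E) *
              (left_mat k * E + of_real c \<cdot>\<^sub>m E)))
    = 2 * (of_nat (card K) + of_real c * w) * mat_trace (mat_conj_transpose E * E)"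
proof -
  define F where "F = mat_conj_transpose E"
  have F: "F \<in> carrier_mat n n" using E by (simp add: F_def)
  have EF: "E * F \<in> carrier_mat n n" using E F by simp
  have "mat_trace (mat_conj_transpose (left_mat k * E + of_real c \<cdot>\<^sub>m E) *
              (left_mat k * E + of_real c \<cdot>\<^sub>m E))
      = 2 * mat_trace (E * F) + 2 * of_real c * mat_trace (left_mat k * (E * F))" if k: "k \<in> K" for k
  proof -
    define L where "L = left_mat k"
    have L: "L \<in> carrier_mat n n" by (simp add: L_def)
    have kG: "k \<in> carrier G" using k K by auto
    have "inv k = k" using kG sq[OF k] inv_equality by blast
    then have Lh: "mat_conj_transpose L = L" using mat_conj_transpose_left_mat[OF kG] by (simp add: L_def)
    have LL: "L * L = 1\<^sub>m n" using left_mat_mult[OF kG kG] sq[OF k] by (simp add: L_def left_mat_one)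
    define V where "V = L + of_real c \<cdot>\<^sub>m 1\<^sub>m n"
    have V: "V \<in> carrier_mat n n" using L by (simp add: V_def)
    have Vh: "mat_conj_transpose V = V"
    proof -
      have "mat_conj_transpose (of_real c \<cdot>\<^sub>m 1\<^sub>m n) = of_real c \<cdot>\<^sub>m 1\<^sub>m n"
        by (auto simp: mat_conj_transpose_def)
      then show ?thesis using L Lh by (simp add: V_def mat_conj_transpose_add[of _ n])
    qed
    have VE: "left_mat k * E + of_real c \<cdot>\<^sub>m E = V * E"
      using L E by (simp add: V_def L_def add_mult_distrib_mat[of _ n n _ _ n] mult_smult_assoc_mat[of _ n n _ n])
    have VV: "V * V = 2 \<cdot>\<^sub>m 1\<^sub>m n + (2 * of_real c) \<cdot>\<^sub>m L"
    proof -
      have "V * V = L * L + of_real c \<cdot>\<^sub>m L + (of_real c \<cdot>\<^sub>m L + of_real c \<cdot>\<^sub>m (of_real c \<cdot>\<^sub>m 1\<^sub>m n))"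
        using L by (simp add: V_def add_mult_distrib_mat[of _ n n _ _ n] mult_add_distrib_mat[of _ n n _ n]
            mult_smult_assoc_mat[of _ n n _ n] mult_smult_distrib[of _ n n _ n]
            add_smult_distrib_left_mat[of _ n n])
      also have "\<dots> = 2 \<cdot>\<^sub>m 1\<^sub>m n + (2 * of_real c) \<cdot>\<^sub>m L"
      proof -
        have "complex_of_real c * complex_of_real c = 1" using c by (simp add: power2_eq_square flip: of_real_mult)
        then show ?thesis using L unfolding LL by (auto simp flip: mult.assoc)
      qed
      finally show ?thesis .
    qed
    have "mat_trace (mat_conj_transpose (V * E) * (V * E)) = mat_trace ((F * V) * (V * E))"
      using V E Vh by (simp add: mat_conj_transpose_mult[of _ n] F_def)
    also have "\<dots> = mat_trace ((V * E) * (F * V))" by (rule mat_trace_comm) (use V E F in auto)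
    also have "(V * E) * (F * V) = (V * (E * F)) * V"
      using V E F by (simp add: assoc_mult_mat[of _ n n _ n _ n])
    also have "mat_trace \<dots> = mat_trace (V * (V * (E * F)))" by (rule mat_trace_comm) (use V E F in auto)
    also have "V * (V * (E * F)) = (V * V) * (E * F)" by (rule assoc_mult_mat[OF V V EF, symmetric])
    also have "\<dots> = 2 \<cdot>\<^sub>m (E * F) + (2 * of_real c) \<cdot>\<^sub>m (L * (E * F))"
      unfolding VV using L EF left_mult_one_mat[OF EF] by (simp add: add_mult_distrib_mat[of _ n n _ _ n] mult_smult_assoc_mat[of _ n n _ n])
    also have "mat_trace \<dots> = 2 * mat_trace (E * F) + 2 * of_real c * mat_trace (L * (E * F))"
      using L EF by (simp add: mat_trace_add[of _ n] mat_trace_smult[of _ n])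
    finally show ?thesis unfolding VE L_def .
  qed
  then have "(\<Sum>k\<in>K. mat_trace (mat_conj_transpose (left_mat k * E + of_real c \<cdot>\<^sub>m E) *
              (left_mat k * E + of_real c \<cdot>\<^sub>m E)))
    = (\<Sum>k\<in>K. 2 * mat_trace (E * F) + 2 * of_real c * mat_trace (left_mat k * (E * F)))"
    by (intro sum.cong) auto
  also have "\<dots> = 2 * of_nat (card K) * mat_trace (E * F)
      + 2 * of_real c * (\<Sum>k\<in>K. mat_trace (left_mat k * (E * F)))"
    by (simp add: sum.distrib sum_distrib_left)
  also have "(\<Sum>k\<in>K. mat_trace (left_mat k * (E * F))) = mat_trace (class_mat K * (E * F))"
    by (rule mat_trace_mult_sum[OF _ EF, symmetric]) (use K in \<open>auto simp: class_mat_eq_sum_left\<close>)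
  also have "class_mat K * (E * F) = (class_mat K * E) * F"
    by (rule assoc_mult_mat[OF class_mat_carrier E F, symmetric])
  also have "\<dots> = w \<cdot>\<^sub>m (E * F)" unfolding w using E F by (simp add: mult_smult_assoc_mat[of _ n n _ n])
  also have "mat_trace \<dots> = w * mat_trace (E * F)" by (rule mat_trace_smult[OF EF])
  also have "mat_trace (E * F) = mat_trace (F * E)" by (rule mat_trace_comm[OF E F])
  finally show ?thesis by (simp add: F_def algebra_simps)
qed

lemma class_mat_hermitian:
  assumes K: "K \<subseteq> carrier G" and inv: "\<And>k. k \<in> K \<Longrightarrow> inv k \<in> K"
  shows "mat_conj_transpose (class_mat K) = class_mat K"
proof -
  have "e j \<otimes> inv (e i) \<in> K \<longleftrightarrow> e i \<otimes> inv (e j) \<in> K" if "i < n" "j < n" for i j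
    using inv[of "e j \<otimes> inv (e i)"] inv[of "e i \<otimes> inv (e j)"] e_closed that by (auto simp: inv_mult_group)
  then show ?thesis by (auto simp: mat_conj_transpose_def class_mat_def)
qed

lemma left_mat_class_mat_commute:
  assumes K: "K \<subseteq> carrier G" and conj: "\<And>x k. x \<in> carrier G \<Longrightarrow> k \<in> K \<Longrightarrow> x \<otimes> k \<otimes> inv x \<in> K"
    and g: "g \<in> carrier G"
  shows "left_mat g * class_mat K = class_mat K * left_mat g"
proof (rule eq_matI)
  fix i j assume "i < dim_row (class_mat K * left_mat g)" "j < dim_col (class_mat K * left_mat g)"
  then have ij: "i < n" "j < n" by (auto simp: class_mat_def left_mat_def)
  note c = e_closed[OF ij(1)] e_closed[OF ij(2)] g
  have sw: "e i = g \<otimes> e l \<longleftrightarrow> e l = inv g \<otimes> e i" if "l < n" for l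
    using c e_closed[OF that] by (metis inv_solve_left)
  have "(left_mat g * class_mat K) $$ (i,j)
      = (\<Sum>l<n. of_bool (e l \<otimes> inv (e j) \<in> K) * of_bool (e l = inv g \<otimes> e i))"
    using ij by (subst index_mult_mat_sum[of _ n n _ n], simp, simp, simp, simp)
      (rule sum.cong[OF refl], simp add: left_mat_def class_mat_def sw)
  also have "\<dots> = of_bool ((inv g \<otimes> e i) \<otimes> inv (e j) \<in> K)"
    by (rule sum_of_bool_e) (use c in auto)
  also have "(inv g \<otimes> e i) \<otimes> inv (e j) \<in> K \<longleftrightarrow> e i \<otimes> inv (g \<otimes> e j) \<in> K"
  proof
    assume "(inv g \<otimes> e i) \<otimes> inv (e j) \<in> K"
    from conj[OF g this] show "e i \<otimes> inv (g \<otimes> e j) \<in> K"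
      using c by (simp add: inv_mult_group) (metis inv_closed l_one m_assoc m_closed r_inv)
  next
    assume "e i \<otimes> inv (g \<otimes> e j) \<in> K"
    from conj[OF inv_closed[OF g] this] show "(inv g \<otimes> e i) \<otimes> inv (e j) \<in> K"
      using c by (simp add: inv_mult_group m_assoc)
  qed
  also have "(of_bool (e i \<otimes> inv (g \<otimes> e j) \<in> K) :: complex)
      = (\<Sum>l<n. of_bool (e i \<otimes> inv (e l) \<in> K) * of_bool (e l = g \<otimes> e j))"
    by (rule sum_of_bool_e[where P = "\<lambda>x. e i \<otimes> inv x \<in> K", symmetric]) (use c in auto)
  also have "\<dots> = (class_mat K * left_mat g) $$ (i,j)"
    using ij by (subst index_mult_mat_sum[of _ n n _ n]) (auto simp: left_mat_def class_mat_def)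
  finally show "(left_mat g * class_mat K) $$ (i,j) = (class_mat K * left_mat g) $$ (i,j)" .
qed (auto simp: class_mat_def left_mat_def)

lemma right_mat_class_mat_commute:
  assumes K: "K \<subseteq> carrier G" and g: "g \<in> carrier G"
  shows "right_mat g * class_mat K = class_mat K * right_mat g"
proof (rule eq_matI)
  fix i j assume "i < dim_row (class_mat K * right_mat g)" "j < dim_col (class_mat K * right_mat g)"
  then have ij: "i < n" "j < n" by (auto simp: class_mat_def right_mat_def)
  note c = e_closed[OF ij(1)] e_closed[OF ij(2)] g
  have sw: "e i = e l \<otimes> g \<longleftrightarrow> e l = e i \<otimes> inv g" if "l < n" for l
    using c e_closed[OF that] by (metis inv_solve_right)
  have "(right_mat g * class_mat K) $$ (i,j)
      = (\<Sum>l<n. of_bool (e l \<otimes> inv (e j) \<in> K) * of_bool (e l = e i \<otimes> inv g))"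
    using ij by (subst index_mult_mat_sum[of _ n n _ n], simp, simp, simp, simp)
      (rule sum.cong[OF refl], simp add: right_mat_def class_mat_def sw)
  also have "\<dots> = of_bool ((e i \<otimes> inv g) \<otimes> inv (e j) \<in> K)"
    by (rule sum_of_bool_e) (use c in auto)
  also have "(e i \<otimes> inv g) \<otimes> inv (e j) = e i \<otimes> inv (e j \<otimes> g)"
    using c by (simp add: inv_mult_group m_assoc)
  also have "(of_bool (e i \<otimes> inv (e j \<otimes> g) \<in> K) :: complex)
      = (\<Sum>l<n. of_bool (e i \<otimes> inv (e l) \<in> K) * of_bool (e l = e j \<otimes> g))"
    by (rule sum_of_bool_e[where P = "\<lambda>x. e i \<otimes> inv x \<in> K", symmetric]) (use c in auto)
  also have "\<dots> = (class_mat K * right_mat g) $$ (i,j)"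
    using ij by (subst index_mult_mat_sum[of _ n n _ n]) (auto simp: right_mat_def class_mat_def)
  finally show "(right_mat g * class_mat K) $$ (i,j) = (class_mat K * right_mat g) $$ (i,j)" .
qed (auto simp: class_mat_def right_mat_def)

definition left_stabilizer :: "complex mat \<Rightarrow> 'a set" where
  "left_stabilizer E = {g \<in> carrier G. left_mat g * E = E}"

lemma left_stabilizer_normal:
  assumes E: "E \<in> carrier_mat n n" and comm: "\<And>g. g \<in> carrier G \<Longrightarrow> left_mat g * E = E * left_mat g"
  shows "left_stabilizer E \<lhd> G"
proof -
  have mult3: "left_mat (g \<otimes> h) * X = left_mat g * (left_mat h * X)"
    if "g \<in> carrier G" "h \<in> carrier G" "X \<in> carrier_mat n n" for g h X
    using assoc_mult_mat[OF left_mat_carrier left_mat_carrier that(3), of g h] left_mat_mult[OF that(1,2)] by simp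
  note mult = mult3[OF _ _ E]
  have "subgroup (left_stabilizer E) G"
  proof (rule subgroupI)
    show "left_stabilizer E \<subseteq> carrier G" by (auto simp: left_stabilizer_def)
    show "left_stabilizer E \<noteq> {}" using E by (auto simp: left_stabilizer_def left_mat_one intro: exI[of _ \<one>])
  next
    fix g assume g: "g \<in> left_stabilizer E"
    then have "left_mat (inv g) * E = left_mat (inv g \<otimes> g) * E"
      by (subst mult) (auto simp: left_stabilizer_def)
    then show "inv g \<in> left_stabilizer E" using g E by (auto simp: left_stabilizer_def left_mat_one)
  next
    fix g h assume "g \<in> left_stabilizer E" "h \<in> left_stabilizer E"
    then show "g \<otimes> h \<in> left_stabilizer E" by (auto simp: left_stabilizer_def mult)
  qed
  moreover have "x \<otimes> h \<otimes> inv x \<in> left_stabilizer E" if x: "x \<in> carrier G" and h: "h \<in> left_stabilizer E" for x h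
  proof -
    have hG: "h \<in> carrier G" "left_mat h * E = E" using h by (auto simp: left_stabilizer_def)
    have "left_mat (x \<otimes> h \<otimes> inv x) * E = left_mat x * (left_mat h * (left_mat (inv x) * E))"
      using x hG mult3[OF x hG(1) mult_carrier_mat[OF left_mat_carrier E]] by (simp add: mult)
    also have "left_mat (inv x) * E = E * left_mat (inv x)" using comm x by simp
    also have "left_mat h * (E * left_mat (inv x)) = E * left_mat (inv x)"
      using assoc_mult_mat[OF left_mat_carrier E left_mat_carrier, of h "inv x"] hG by simp
    also have "\<dots> = left_mat (inv x) * E" using comm x by simp
    also have "left_mat x * (left_mat (inv x) * E) = E"
      using mult[of x "inv x"] x E by (simp add: left_mat_one)
    finally show ?thesis using x hG by (simp add: left_stabilizer_def)
  qed
  ultimately show ?thesis unfolding normal_inv_iff by auto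
qed


lemma left_mat_conj_trace:
  assumes x: "x \<in> carrier G" and z: "z \<in> carrier G" and X: "X \<in> carrier_mat n n"
    and comm: "left_mat (inv x) * X = X * left_mat (inv x)"
  shows "mat_trace (left_mat (x \<otimes> z \<otimes> inv x) * X) = mat_trace (left_mat z * X)"
proof -
  have "left_mat (x \<otimes> z \<otimes> inv x) * X = left_mat x * left_mat z * left_mat (inv x) * X"
    using x z by (simp add: left_mat_mult)
  also have "\<dots> = left_mat x * (left_mat z * (left_mat (inv x) * X))"
    by (rule mat_assoc4) (use X in auto)
  also have "\<dots> = left_mat x * (left_mat z * X) * left_mat (inv x)"
    unfolding comm by (rule mat_assoc4(2)[symmetric]) (use X in auto)
  also have "mat_trace \<dots> = mat_trace (left_mat z * X)"
    by (rule mat_trace_similar[OF mult_carrier_mat[OF left_mat_carrier X] left_mat_carrier left_mat_carrier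
          left_mat_inv(2)[OF x]])
  finally show ?thesis .
qed

lemma right_mat_conj_trace:
  assumes x: "x \<in> carrier G" and z: "z \<in> carrier G" and X: "X \<in> carrier_mat n n"
    and comm: "right_mat x * X = X * right_mat x"
  shows "mat_trace (right_mat (x \<otimes> z \<otimes> inv x) * X) = mat_trace (right_mat z * X)"
proof -
  have "right_mat (x \<otimes> z \<otimes> inv x) * X = right_mat (inv x) * right_mat z * right_mat x * X"
    using x z by (simp add: right_mat_mult m_assoc)
  also have "\<dots> = right_mat (inv x) * (right_mat z * (right_mat x * X))"
    by (rule mat_assoc4) (use X in auto)
  also have "\<dots> = right_mat (inv x) * (right_mat z * X) * right_mat x"
    unfolding comm by (rule mat_assoc4(2)[symmetric]) (use X in auto)
  also have "mat_trace \<dots> = mat_trace (right_mat z * X)"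
    by (rule mat_trace_similar[OF mult_carrier_mat[OF right_mat_carrier X] right_mat_carrier right_mat_carrier
          right_mat_inv(1)[OF x]])
  finally show ?thesis .
qed

lemma class_mat_carrier_left_mat:
  assumes g: "g \<in> carrier G"
  shows "class_mat (carrier G) * left_mat g = class_mat (carrier G)"
proof (rule eq_matI)
  fix i j assume "i < dim_row (class_mat (carrier G))" "j < dim_col (class_mat (carrier G))"
  then have ij: "i < n" "j < n" by (auto simp: class_mat_def)
  have "(class_mat (carrier G) * left_mat g) $$ (i,j)
      = (\<Sum>l<n. of_bool True * of_bool (e l = g \<otimes> e j))"
    using ij e_closed by (subst index_mult_mat_sum[of _ n n _ n], simp, simp, simp, simp)
      (rule sum.cong[OF refl], simp add: left_mat_def class_mat_def)
  also have "\<dots> = of_bool True"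
    by (rule sum_of_bool_e[where P = "\<lambda>_. True"]) (use g ij e_closed in auto)
  finally show "(class_mat (carrier G) * left_mat g) $$ (i,j) = class_mat (carrier G) $$ (i,j)"
    using ij e_closed by (simp add: class_mat_def)
qed (auto simp: class_mat_def left_mat_def)

text \<open>
  Burnside's lemma on conjugacy classes of prime power size, for involutions. The restriction to
  involutions makes all the traces rational integers, so that neither characters nor Galois
  conjugates are needed.
\<close>

theorem involution_class_prime_power_ex_normal:
  assumes z: "z \<in> carrier G" and z1: "z \<noteq> \<one>" and zz: "z \<otimes> z = \<one>"
    and p: "prime (p::nat)" and k: "k > 0"
    and card: "card ((\<lambda>x. x \<otimes> z \<otimes> inv x) ` carrier G) = p ^ k"
  shows "\<exists>N. N \<lhd> G \<and> N \<noteq> {\<one>} \<and> N \<noteq> carrier G"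
proof (rule ccontr)
  assume "\<not> ?thesis"
  then have simple: "N = carrier G" if "N \<lhd> G" "x \<in> N" "x \<noteq> \<one>" for N x using that by blast
  define K where "K = (\<lambda>x. x \<otimes> z \<otimes> inv x) ` carrier G"
  define q where "q = p ^ k"
  define M where "M = class_mat K"
  have finG: "finite (carrier G)" using bij_betw_finite[OF e] by simp
  have KG: "K \<subseteq> carrier G" "finite K" using z finG by (auto simp: K_def)
  have zK: "z \<in> K" using z by (auto simp: K_def intro!: image_eqI[of _ _ \<one>])
  have cardK: "card K = q" using card by (simp add: K_def q_def)
  have q: "q > 1" using p k by (simp add: q_def prime_gt_1_nat del: One_nat_def)
  have KE: "\<exists>x. x \<in> carrier G \<and> y = x \<otimes> z \<otimes> inv x" if "y \<in> K" for y
    using that by (simp add: K_def image_iff Bex_def)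
  have sq: "y \<otimes> y = \<one>" if y: "y \<in> K" for y
  proof -
    obtain x where x: "x \<in> carrier G" "y = x \<otimes> z \<otimes> inv x" using KE[OF y] by auto
    have "y \<otimes> y = x \<otimes> (z \<otimes> (inv x \<otimes> x) \<otimes> z) \<otimes> inv x"
      using x(1) z unfolding x(2) by (simp only: m_assoc m_closed inv_closed)
    then show ?thesis using x(1) z zz by simp
  qed
  have conj: "x \<otimes> y \<otimes> inv x \<in> K" if x: "x \<in> carrier G" and "y \<in> K" for x y
  proof -
    obtain u where u: "u \<in> carrier G" "y = u \<otimes> z \<otimes> inv u"
      using KE[OF \<open>y \<in> K\<close>] by auto
    have "x \<otimes> y \<otimes> inv x = (x \<otimes> u) \<otimes> z \<otimes> inv (x \<otimes> u)"
      using x u(1) z unfolding u(2) by (simp add: inv_mult_group m_assoc)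
    then show ?thesis using x u(1) by (auto simp: K_def)
  qed
  have Kinv: "inv y \<in> K" if "y \<in> K" for y
    using that sq[OF that] KG inv_equality[of y y] by auto
  have M: "M \<in> carrier_mat n n" by (simp add: M_def)
  have Mh: "mat_conj_transpose M = M" unfolding M_def by (rule class_mat_hermitian[OF KG(1) Kinv])
  obtain S :: "complex set" and E :: "complex \<Rightarrow> complex mat"
    where S: "finite S" "\<And>w. w \<in> S \<Longrightarrow> poly (char_poly M) w = 0"
    and E: "\<And>w. E w \<in> carrier_mat n n"
    and EE: "\<And>w. w \<in> S \<Longrightarrow> E w * E w = E w"
    and ME: "\<And>w. w \<in> S \<Longrightarrow> M * E w = w \<cdot>\<^sub>m E w"
    and trE: "\<And>w. w \<in> S \<Longrightarrow> mat_trace (E w) \<noteq> 0"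
    and EX: "\<And>w X. X \<in> carrier_mat n n \<Longrightarrow> X * M = M * X \<Longrightarrow> X * E w = E w * X"
    and res: "\<And>X. X \<in> carrier_mat n n \<Longrightarrow> mat_trace X = (\<Sum>w\<in>S. mat_trace (X * E w))"
    by (rule hermitian_spectral_resolution[OF M Mh], rule that)
  have LE: "left_mat g * E w = E w * left_mat g" if "g \<in> carrier G" for g w
    by (rule EX) (use left_mat_class_mat_commute[OF KG(1) conj that] in \<open>auto simp: M_def\<close>)
  have RE: "right_mat g * E w = E w * right_mat g" if "g \<in> carrier G" for g w
    by (rule EX) (use right_mat_class_mat_commute[OF KG(1) that] in \<open>auto simp: M_def\<close>)
  have trM: "mat_trace (M * X) = (\<Sum>y\<in>K. mat_trace (left_mat y * X))" if "X \<in> carrier_mat n n" for X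
    by (rule mat_trace_mult_sum[OF M that])
       (use class_mat_eq_sum_left[OF KG] in \<open>auto simp: M_def\<close>)
  have trM': "mat_trace (M * X) = (\<Sum>y\<in>K. mat_trace (right_mat y * X))" if "X \<in> carrier_mat n n" for X
    by (rule mat_trace_mult_sum[OF M that])
       (use class_mat_eq_sum_right[OF KG _ _ conj] in \<open>auto simp: M_def\<close>)
  have RM: "right_mat g * M = M * right_mat g" if "g \<in> carrier G" for g
    using right_mat_class_mat_commute[OF KG(1) that] by (simp add: M_def)
  have LR: "left_mat g * (right_mat h * X) = right_mat h * (left_mat g * X)"
    if "g \<in> carrier G" "h \<in> carrier G" "X \<in> carrier_mat n n" for g h X
    using assoc_mult_mat[OF left_mat_carrier right_mat_carrier that(3), of g h]
      assoc_mult_mat[OF right_mat_carrier left_mat_carrier that(3), of h g]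
      left_right_mat_commute[OF that(1,2)] by simp
  \<comment> \<open>All elements of the class contribute the same trace, because \<open>E w\<close> commutes with translations.\<close>
  have one: "w * mat_trace (E w) = of_nat q * mat_trace (left_mat z * E w)" if w: "w \<in> S" for w
  proof -
    have "w * mat_trace (E w) = mat_trace (M * E w)" by (simp add: ME[OF w] mat_trace_smult[OF E])
    also have "\<dots> = (\<Sum>y\<in>K. mat_trace (left_mat z * E w))"
      unfolding trM[OF E]
    proof (rule sum.cong[OF refl])
      fix y assume y: "y \<in> K"
      obtain x where x: "x \<in> carrier G" "y = x \<otimes> z \<otimes> inv x" using KE[OF y] by auto
      show "mat_trace (left_mat y * E w) = mat_trace (left_mat z * E w)"
        unfolding x(2) by (rule left_mat_conj_trace[OF x(1) z E]) (use LE x in auto)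
    qed
    finally show ?thesis by (simp add: cardK)
  qed
  \<comment> \<open>One factor \<open>M\<close> is expanded into right translations and the other one into left translations,
    so that again all \<open>q * q\<close> summands are equal.\<close>
  have two: "w * (w * mat_trace (E w)) = of_nat q * (of_nat q * mat_trace (right_mat z * (left_mat z * E w)))"
    if w: "w \<in> S" for w
  proof -
    have c: "left_mat g * E w \<in> carrier_mat n n" "right_mat g * E w \<in> carrier_mat n n" for g
      using mult_carrier_mat[OF left_mat_carrier E] mult_carrier_mat[OF right_mat_carrier E] by auto
    have "w * (w * mat_trace (E w)) = mat_trace (M * (M * E w))"
      using M E[of w] mult_smult_distrib[OF M E, of w w] by (simp add: ME[OF w] mat_trace_smult[of _ n])
    also have "\<dots> = (\<Sum>y\<in>K. mat_trace (right_mat y * (M * E w)))"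
      by (rule trM') (use M E in auto)
    also have "\<dots> = (\<Sum>y\<in>K. \<Sum>y'\<in>K. mat_trace (right_mat z * (left_mat z * E w)))"
    proof (rule sum.cong[OF refl])
      fix y assume y: "y \<in> K"
      then have yG: "y \<in> carrier G" using KG by auto
      obtain x where x: "x \<in> carrier G" "y = x \<otimes> z \<otimes> inv x" using KE[OF y] by auto
      have "right_mat y * (M * E w) = M * (right_mat y * E w)"
        using assoc_mult_mat[OF right_mat_carrier M E, of y w] assoc_mult_mat[OF M right_mat_carrier E, of y w]
          RM[OF yG] by simp
      then have "mat_trace (right_mat y * (M * E w)) = (\<Sum>y'\<in>K. mat_trace (left_mat y' * (right_mat y * E w)))"
        using trM[OF c(2)] by simp
      also have "\<dots> = (\<Sum>y'\<in>K. mat_trace (right_mat z * (left_mat z * E w)))"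
      proof (rule sum.cong[OF refl])
        fix y' assume y': "y' \<in> K"
        obtain x' where x': "x' \<in> carrier G" "y' = x' \<otimes> z \<otimes> inv x'" using KE[OF y'] by auto
        have "left_mat (inv x') * (right_mat y * E w) = right_mat y * E w * left_mat (inv x')"
          using LR[OF inv_closed[OF x'(1)] yG E] LE[OF inv_closed[OF x'(1)], of w]
            assoc_mult_mat[OF right_mat_carrier E left_mat_carrier, of y w "inv x'"] by simp
        then have "mat_trace (left_mat y' * (right_mat y * E w)) = mat_trace (left_mat z * (right_mat y * E w))"
          unfolding x'(2) by (rule left_mat_conj_trace[OF x'(1) z c(2)])
        also have "left_mat z * (right_mat y * E w) = right_mat y * (left_mat z * E w)"
          by (rule LR[OF z yG E])
        also have "right_mat x * (left_mat z * E w) = left_mat z * E w * right_mat x"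
          using LR[OF z x(1) E, of w, symmetric] RE[OF x(1), of w]
            assoc_mult_mat[OF left_mat_carrier E right_mat_carrier, of z w x] by simp
        then have "mat_trace (right_mat y * (left_mat z * E w)) = mat_trace (right_mat z * (left_mat z * E w))"
          unfolding x(2) by (rule right_mat_conj_trace[OF x(1) z c(1)])
        finally show "mat_trace (left_mat y' * (right_mat y * E w)) = mat_trace (right_mat z * (left_mat z * E w))" .
      qed
      finally show "mat_trace (right_mat y * (M * E w)) = (\<Sum>y'\<in>K. mat_trace (right_mat z * (left_mat z * E w)))" .
    qed
    finally show ?thesis by (simp add: cardK)
  qed
  have LLz: "left_mat z * left_mat z = 1\<^sub>m n" and RRz: "right_mat z * right_mat z = 1\<^sub>m n"
    using z zz by (simp_all add: left_mat_mult left_mat_one right_mat_mult right_mat_one)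
  have int1: "mat_trace (left_mat z * E w) \<in> \<int>" if w: "w \<in> S" for w
    by (rule mat_trace_involution_mult[OF E left_mat_carrier EE[OF w] LLz LE[OF z]])
  have int2: "mat_trace (right_mat z * (left_mat z * E w)) \<in> \<int>" if w: "w \<in> S" for w
  proof -
    define U where "U = right_mat z * left_mat z"
    have U: "U \<in> carrier_mat n n" using mult_carrier_mat[OF right_mat_carrier left_mat_carrier] by (simp add: U_def)
    have "U * U = right_mat z * (left_mat z * (right_mat z * left_mat z))"
      using assoc_mult_mat[OF right_mat_carrier left_mat_carrier U, of z z] by (simp add: U_def)
    also have "left_mat z * (right_mat z * left_mat z) = right_mat z * (left_mat z * left_mat z)"
      by (rule LR[OF z z left_mat_carrier])
    also have "right_mat z * (right_mat z * (left_mat z * left_mat z))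
        = right_mat z * right_mat z * (left_mat z * left_mat z)"
      by (rule assoc_mult_mat[symmetric, OF right_mat_carrier right_mat_carrier
            mult_carrier_mat[OF left_mat_carrier left_mat_carrier]])
    finally have UU: "U * U = 1\<^sub>m n" using LLz RRz by simp
    have UE: "U * E w = E w * U"
    proof -
      have "U * E w = right_mat z * (left_mat z * E w)"
        unfolding U_def by (rule assoc_mult_mat[OF right_mat_carrier left_mat_carrier E])
      also have "\<dots> = right_mat z * E w * left_mat z"
        unfolding LE[OF z] by (rule assoc_mult_mat[OF right_mat_carrier E left_mat_carrier, symmetric])
      also have "\<dots> = E w * U"
        unfolding RE[OF z] U_def by (rule assoc_mult_mat[OF E right_mat_carrier left_mat_carrier])
      finally show ?thesis .
    qed
    have "mat_trace (U * E w) \<in> \<int>" by (rule mat_trace_involution_mult[OF E U EE[OF w] UU UE])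
    then show ?thesis unfolding U_def assoc_mult_mat[OF right_mat_carrier left_mat_carrier E] .
  qed
  have Eh: "\<exists>N>0. mat_trace (mat_conj_transpose (E w) * E w) = complex_of_real N" if w: "w \<in> S" for w
  proof -
    obtain N where N: "mat_trace (mat_conj_transpose (E w) * E w) = complex_of_real N" "N \<ge> 0"
      using mat_trace_conj_transpose_mult[OF E] by (metis (no_types, lifting) sum_nonneg zero_le_power2)
    have "N \<noteq> 0"
    proof
      assume "N = 0"
      then have "E w = 0\<^sub>m n n" using N(1) by (intro mat_trace_conj_transpose_eq_0[OF E]) simp
      then show False using trE[OF w] by (simp add: mat_trace_def)
    qed
    then show ?thesis using N by (intro exI[of _ N]) auto
  qed
  \<comment> \<open>The eigenvalues are integers of absolute value at most \<open>q\<close>, and at the two extreme values the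
    whole class acts on the eigenspace as a scalar.\<close>
  have eigen: "\<exists>a::int. w = of_int a \<and> \<bar>a\<bar> \<le> int q
      \<and> (\<forall>c\<in>{1,-1}. int q + c * a = 0 \<longrightarrow> (\<forall>y\<in>K. left_mat y * E w + of_int c \<cdot>\<^sub>m E w = 0\<^sub>m n n))"
    if w: "w \<in> S" for w
  proof -
    obtain m :: nat where m: "mat_trace (E w) = of_nat m" using mat_trace_idempotent[OF E EE[OF w]] by auto
    have "w = of_nat q * mat_trace (left_mat z * E w) / of_nat m"
      using one[OF w] trE[OF w] m by (simp add: field_simps)
    moreover have "of_nat q * mat_trace (left_mat z * E w) / of_nat m \<in> \<rat>"
      using int1[OF w] by (auto elim!: Ints_cases)
    ultimately have "w \<in> \<rat>" by simp
    moreover have "algebraic_int w"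
      by (rule integer_mat_eigenvalue_algebraic_int[OF M _ S(2)[OF w]]) (auto simp: M_def class_mat_def)
    ultimately obtain a where a: "w = of_int a"
      using rational_algebraic_int_is_int by (auto elim: Ints_cases)
    obtain N where N: "N > 0" "mat_trace (mat_conj_transpose (E w) * E w) = complex_of_real N"
      using Eh[OF w] by auto
    have sum: "0 \<le> int q + c * a \<and> (int q + c * a = 0 \<longrightarrow>
        (\<forall>y\<in>K. left_mat y * E w + of_int c \<cdot>\<^sub>m E w = 0\<^sub>m n n))" if c: "c = 1 \<or> c = -1" for c
    proof -
      define D where "D = (\<lambda>y. left_mat y * E w + of_real (of_int c) \<cdot>\<^sub>m E w)"
      have D: "D y \<in> carrier_mat n n" for y
        using mult_carrier_mat[OF left_mat_carrier E] E by (simp add: D_def)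
      define f where "f = (\<lambda>y. \<Sum>i<n. \<Sum>j<n. (cmod (D y $$ (j,i)))\<^sup>2)"
      have f0: "f y \<ge> 0" for y by (auto simp: f_def intro!: sum_nonneg)
      have tr: "mat_trace (mat_conj_transpose (D y) * D y) = of_real (f y)" for y
        unfolding f_def by (rule mat_trace_conj_transpose_mult[OF D])
      have "complex_of_real (\<Sum>y\<in>K. f y) = (\<Sum>y\<in>K. mat_trace (mat_conj_transpose (D y) * D y))"
        by (simp add: tr)
      also have "\<dots> = 2 * (of_nat q + of_real (of_int c) * w) * of_real N"
        unfolding D_def by (subst sum_norm_class[OF KG sq E ME[OF w, unfolded M_def]])
          (use c in \<open>auto simp: cardK N\<close>)
      also have "\<dots> = of_real (2 * of_int (int q + c * a) * N)" by (simp add: a)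
      finally have s: "(\<Sum>y\<in>K. f y) = 2 * of_int (int q + c * a) * N" using of_real_eq_iff by blast
      have "0 \<le> (\<Sum>y\<in>K. f y)" using f0 by (simp add: sum_nonneg)
      then have "0 \<le> real_of_int (int q + c * a)" using N unfolding s by (simp add: zero_le_mult_iff)
      then have ge: "0 \<le> int q + c * a" by (simp only: of_int_0_le_iff)
      have "D y = 0\<^sub>m n n" if "int q + c * a = 0" "y \<in> K" for y
      proof -
        have "(\<Sum>y\<in>K. f y) = 0" using s that by simp
        then have "f y = 0" using that f0 KG(2) by (subst (asm) sum_nonneg_eq_0_iff) auto
        then show ?thesis using tr[of y] mat_trace_conj_transpose_eq_0[OF D] by simp
      qed
      then show ?thesis using ge by (simp add: D_def)
    qed
    have "\<bar>a\<bar> \<le> int q" using sum[of 1] sum[of "-1"] by linarith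
    then show ?thesis using a sum by (intro exI[of _ a]) auto
  qed
  \<comment> \<open>The eigenvalue \<open>q\<close>. The all-ones matrix \<open>J\<close> is annihilated by the projections to the other
    eigenspaces, and it is \<open>n\<close> times the projection to this one.\<close>
  define J where "J = class_mat (carrier G)"
  have J: "J \<in> carrier_mat n n" by (simp add: J_def)
  have trJ: "mat_trace J = of_nat n" using e_closed by (simp add: J_def mat_trace_def class_mat_def)
  have n0: "n > 0" using e_surj[OF one_closed] by auto
  have cardG: "card (carrier G) = n" using bij_betw_same_card[OF e] by simp
  have trJE: "mat_trace (J * E w) = 0" if w: "w \<in> S" "w \<noteq> of_nat q" for w
  proof -
    have EJ: "E w * J \<in> carrier_mat n n" by (rule mult_carrier_mat[OF E J])
    have "w * mat_trace (J * E w) = mat_trace (J * (M * E w))"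
      using mult_smult_distrib[OF J E, of w w] J E[of w] by (simp add: ME[OF w(1)] mat_trace_smult[of _ n])
    also have "\<dots> = mat_trace (M * E w * J)" by (rule mat_trace_comm[OF J mult_carrier_mat[OF M E]])
    also have "M * E w * J = M * (E w * J)" by (rule assoc_mult_mat[OF M E J])
    also have "mat_trace \<dots> = (\<Sum>y\<in>K. mat_trace (left_mat y * (E w * J)))" by (rule trM[OF EJ])
    also have "\<dots> = (\<Sum>y\<in>K. mat_trace (J * E w))"
    proof (rule sum.cong[OF refl])
      fix y assume "y \<in> K"
      then have y: "y \<in> carrier G" using KG by auto
      have "mat_trace (left_mat y * (E w * J)) = mat_trace (E w * J * left_mat y)"
        by (rule mat_trace_comm[OF left_mat_carrier EJ])
      also have "E w * J * left_mat y = E w * J"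
        using assoc_mult_mat[OF E J left_mat_carrier, of w y] class_mat_carrier_left_mat[OF y]
        by (simp add: J_def)
      also have "mat_trace (E w * J) = mat_trace (J * E w)" by (rule mat_trace_comm[OF E J])
      finally show "mat_trace (left_mat y * (E w * J)) = mat_trace (J * E w)" .
    qed
    finally have "w * mat_trace (J * E w) = of_nat q * mat_trace (J * E w)" by (simp add: cardK)
    then show ?thesis using w by simp
  qed
  have resJ: "of_nat n = (\<Sum>w\<in>S. mat_trace (J * E w))" using res[OF J] trJ by simp
  have qS: "of_nat q \<in> S"
  proof (rule ccontr)
    assume "of_nat q \<notin> S"
    then have "(\<Sum>w\<in>S. mat_trace (J * E w)) = 0" using trJE by (intro sum.neutral) auto
    then show False using resJ n0 by simp
  qed
  have normal: "left_stabilizer (E w) \<lhd> G" for w by (rule left_stabilizer_normal[OF E LE])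
  have Lq: "left_mat g * E (of_nat q) = E (of_nat q)" if g: "g \<in> carrier G" for g
  proof -
    have "left_mat y * E (of_nat q) + of_int (-1) \<cdot>\<^sub>m E (of_nat q) = 0\<^sub>m n n" if y: "y \<in> K" for y
    proof -
      obtain a :: int where a: "of_nat q = complex_of_int a"
        "\<forall>c\<in>{1,-1}. int q + c * a = 0 \<longrightarrow>
          (\<forall>y\<in>K. left_mat y * E (of_nat q) + of_int c \<cdot>\<^sub>m E (of_nat q) = 0\<^sub>m n n)"
        using eigen[OF qS] by blast
      have "complex_of_int a = of_int (int q)" using a(1) by simp
      then have "a = int q" using of_int_eq_iff by blast
      then show ?thesis using bspec[OF a(2), of "-1"] y by simp
    qed
    from this[OF zK] have "left_mat z * E (of_nat q) = E (of_nat q)"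
      using E[of "of_nat q"] mult_carrier_mat[OF left_mat_carrier E, of z "of_nat q"]
      by (auto simp: mat_eq_iff simp del: index_mult_mat(1))
    then have "z \<in> left_stabilizer (E (of_nat q))" using z by (simp add: left_stabilizer_def)
    then have "left_stabilizer (E (of_nat q)) = carrier G" using simple[OF normal _ z1] by blast
    then show ?thesis using g by (auto simp: left_stabilizer_def)
  qed
  have trq: "mat_trace (E (of_nat q)) = 1"
  proof -
    have "of_nat n = (\<Sum>w\<in>{of_nat q}. mat_trace (J * E w))"
      unfolding resJ by (rule sum.mono_neutral_right) (use S qS trJE in auto)
    also have "\<dots> = mat_trace (J * E (of_nat q))" by simp
    also have "\<dots> = (\<Sum>g\<in>carrier G. mat_trace (left_mat g * E (of_nat q)))"
      by (rule mat_trace_mult_sum[OF J E]) (use class_mat_eq_sum_left[OF subset_refl finG] in \<open>auto simp: J_def\<close>)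
    also have "\<dots> = of_nat n * mat_trace (E (of_nat q))" by (simp add: Lq cardG)
    finally show ?thesis using n0 by simp
  qed
  \<comment> \<open>If the class acted as \<open>-1\<close>, the kernel of the action would be a proper normal subgroup that
    contains all products \<open>y \<otimes> z\<close> of two elements of the class. In a simple group it is trivial,
    and the class has only one element.\<close>
  have mq: "w \<noteq> - of_nat q" if w: "w \<in> S" for w
  proof
    assume wq: "w = - of_nat q"
    have c: "left_mat y * E w \<in> carrier_mat n n" for y by (rule mult_carrier_mat[OF left_mat_carrier E])
    have neg: "left_mat y * E w = - E w" if y: "y \<in> K" for y
    proof -
      obtain a :: int where a: "w = of_int a"
        "\<forall>c\<in>{1,-1}. int q + c * a = 0 \<longrightarrow> (\<forall>y\<in>K. left_mat y * E w + of_int c \<cdot>\<^sub>m E w = 0\<^sub>m n n)"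
        using eigen[OF w] by blast
      have "complex_of_int a = of_int (- int q)" using a wq by simp
      then have "a = - int q" using of_int_eq_iff by blast
      then have "left_mat y * E w + of_int 1 \<cdot>\<^sub>m E w = 0\<^sub>m n n" using a(2) y by auto
      then show ?thesis
        using E[of w] c[of y] by (auto simp: mat_eq_iff eq_neg_iff_add_eq_0 simp del: index_mult_mat(1))
    qed
    have zs: "z \<notin> left_stabilizer (E w)"
    proof
      assume "z \<in> left_stabilizer (E w)"
      then have eq: "E w = - E w" using neg[OF zK] by (simp add: left_stabilizer_def)
      have "E w $$ (i,i) = 0" if "i < n" for i
      proof -
        have "E w $$ (i,i) = - (E w $$ (i,i))"
          using arg_cong[OF eq, of "\<lambda>A. A $$ (i,i)"] carrier_matD[OF E, of w] that by (simp only: index_uminus_mat)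
        then show ?thesis by (simp add: eq_neg_iff_add_eq_0)
      qed
      then show False using trE[OF w] E[of w] by (simp add: mat_trace_def)
    qed
    have "y = z" if y: "y \<in> K" for y
    proof -
      have yG: "y \<in> carrier G" using y KG by auto
      have "left_mat (y \<otimes> z) * E w = left_mat y * (left_mat z * E w)"
        using assoc_mult_mat[OF left_mat_carrier left_mat_carrier E, of y z w] left_mat_mult[OF yG z] by simp
      also have "\<dots> = - (left_mat y * E w)" 
        using carrier_matD[OF left_mat_carrier, of y] carrier_matD[OF E, of w] by (simp add: neg[OF zK])
      also have "\<dots> = E w" by (simp add: neg[OF y] uminus_uminus_mat)
      finally have "y \<otimes> z \<in> left_stabilizer (E w)" using yG z by (simp add: left_stabilizer_def)
      then have "y \<otimes> z = \<one>" using simple[OF normal, of "y \<otimes> z" w] zs z by auto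
      then have "y \<otimes> z = z \<otimes> z" by (simp only: zz)
      then show ?thesis using yG z by (simp add: right_cancel)
    qed
    then have "K \<subseteq> {z}" by blast
    then have "card K \<le> 1" using card_mono[of "{z}" K] by simp
    then show False using cardK q by simp
  qed
  \<comment> \<open>For the other eigenvalues, \<open>q\<close> divides \<open>a * t\<close> but not \<open>a\<close>, unless \<open>a = 0\<close> and then \<open>t = 0\<close>.\<close>
  have other: "\<exists>b::int. mat_trace (left_mat z * E w) = of_int (int p * b)"
    if w: "w \<in> S - {of_nat q}" for w
  proof -
    obtain a :: int where a: "w = of_int a" "\<bar>a\<bar> \<le> int q" using eigen w by blast
    have "a \<noteq> int q" using a w by auto
    moreover have "a \<noteq> - int q" using a mq[of w] w by auto
    ultimately have lt: "\<bar>a\<bar> < int q" using a(2) by linarith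
    obtain t where t: "mat_trace (left_mat z * E w) = of_int t" using int1 w by (auto elim: Ints_cases)
    obtain u where u: "mat_trace (right_mat z * (left_mat z * E w)) = of_int u"
      using int2 w by (auto elim: Ints_cases)
    have "of_nat q * (w * mat_trace (left_mat z * E w))
        = of_nat q * (of_nat q * mat_trace (right_mat z * (left_mat z * E w)))"
      using one[of w] two[of w] w by (simp add: mult.left_commute)
    then have "w * of_int t = of_nat q * of_int u" using q t u by simp
    then have "complex_of_int (a * t) = of_int (int q * u)" using a by simp
    then have au: "a * t = int q * u" using of_int_eq_iff by blast
    have "int p dvd t"
    proof (rule ccontr)
      assume np: "\<not> int p dvd t"
      then have "coprime (int p) t" using p by (simp add: prime_imp_coprime)
      then have "coprime (int q) t" by (simp add: q_def)
      moreover have "int q dvd a * t" using au by simp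
      ultimately have "int q dvd a" by (simp add: coprime_dvd_mult_left_iff)
      then have "a = 0" using lt zdvd_not_zless[of "\<bar>a\<bar>" "int q"] by fastforce
      then have "of_nat q * mat_trace (left_mat z * E w) = 0" using one[of w] w a by simp
      then have "t = 0" using t q by simp
      then show False using np by simp
    qed
    then show ?thesis using t by auto
  qed
  then obtain b :: "complex \<Rightarrow> int" where
    b: "\<And>w. w \<in> S - {of_nat q} \<Longrightarrow> mat_trace (left_mat z * E w) = of_int (int p * b w)" by metis
  have "0 = (\<Sum>w\<in>S. mat_trace (left_mat z * E w))"
    using res[OF left_mat_carrier, of z] mat_trace_left_mat[OF z z1] by simp
  also have "\<dots> = mat_trace (left_mat z * E (of_nat q)) + (\<Sum>w\<in>S - {of_nat q}. mat_trace (left_mat z * E w))"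
    by (rule sum.remove[OF S(1) qS])
  also have "\<dots> = 1 + (\<Sum>w\<in>S - {of_nat q}. of_int (int p * b w))"
    using b by (simp add: Lq[OF z] trq)
  also have "\<dots> = of_int (1 + int p * (\<Sum>w\<in>S - {of_nat q}. b w))"
    by (simp add: sum_distrib_left)
  finally have "1 + int p * (\<Sum>w\<in>S - {of_nat q}. b w) = 0"
    by (metis of_int_eq_0_iff)
  then have "int p dvd 1" by (metis add.commute add_eq_0_iff dvd_minus_iff dvd_triv_left)
  then show False using p by (simp add: prime_gt_1_nat)
qed

end


section \<open>Groups whose order has no prime divisors except 2 and one other prime\<close>

lemma prime_power_if_only_prime_divisor:
  fixes n :: nat
  assumes "n > 0" "prime p" "\<And>q. prime q \<Longrightarrow> q dvd n \<Longrightarrow> q = p"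
  shows "\<exists>k. n = p ^ k"
  using assms(1,3)
proof (induction n rule: less_induct)
  case (less n)
  show ?case
  proof (cases "n = 1")
    case True
    then show ?thesis by (intro exI[of _ 0]) simp
  next
    case False
    then obtain q where "prime q" "q dvd n" using prime_factor_nat by blast
    then have "p dvd n" using less.prems(2) by auto
    then obtain m where m: "n = p * m" by (auto elim: dvdE)
    have "m < n" using m less.prems(1) prime_gt_1_nat[OF assms(2)] by simp
    moreover have "m > 0" using m less.prems(1) by simp
    ultimately obtain k where "m = p ^ k" using less.IH[of m] less.prems(2) m by auto
    then show ?thesis using m by (intro exI[of _ "Suc k"]) simp
  qed
qed

text \<open>
  All orbits outside the set of fixed points have size divisible by \<open>p\<close>, so the number of fixed points
  is divisible by \<open>p\<close> and cannot be 1.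
\<close>

lemma (in group_action) prime_power_group_another_fixed_point:
  assumes p: "prime (p::nat)" and ord: "order G = p ^ a"
    and X: "X \<subseteq> E" "finite X" "\<And>g x. g \<in> carrier G \<Longrightarrow> x \<in> X \<Longrightarrow> \<phi> g x \<in> X"
    and dvd: "p dvd card X" and x: "x \<in> X" "\<And>g. g \<in> carrier G \<Longrightarrow> \<phi> g x = x"
  shows "\<exists>y\<in>X. y \<noteq> x \<and> (\<forall>g\<in>carrier G. \<phi> g y = y)"
proof (rule ccontr)
  assume no: "\<not> ?thesis"
  have orbX: "orbit G \<phi> y \<subseteq> X" if "y \<in> X" for y using X(3) that by (auto simp: orbit_def)
  have part: "orbit G \<phi> y \<inter> orbit G \<phi> y' = {}" if "y \<in> X" "y' \<in> X" "orbit G \<phi> y \<noteq> orbit G \<phi> y'" for y y'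
  proof (rule ccontr)
    assume "\<not> ?thesis"
    then obtain u where u: "u \<in> orbit G \<phi> y" "u \<in> orbit G \<phi> y'" by auto
    have "u \<in> E" using u that X(1) orbX by (meson subsetD)
    then have "\<exists>!b. b \<in> orbits G E \<phi> \<and> u \<in> b"
      by (rule partition.unique_class[OF orbit_partition])
    moreover have "orbit G \<phi> y \<in> orbits G E \<phi>" "orbit G \<phi> y' \<in> orbits G E \<phi>"
      using that X(1) by (auto simp: orbits_def)
    ultimately show False using u that(3) by auto
  qed
  have "p dvd card (\<Union>(orbit G \<phi> ` (X - {x})))"
  proof (rule dvd_partition)
    show "finite (\<Union>(orbit G \<phi> ` (X - {x})))" using X(2) orbX by (meson DiffD1 UN_least finite_subset)
    show "\<forall>c\<in>orbit G \<phi> ` (X - {x}). p dvd card c"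
    proof
      fix c assume "c \<in> orbit G \<phi> ` (X - {x})"
      then obtain y where y: "y \<in> X" "y \<noteq> x" "c = orbit G \<phi> y" by auto
      have "card c dvd p ^ a" using orbit_stabilizer_theorem[of y] y X(1) ord by (metis dvd_triv_left subsetD)
      then obtain i where i: "card c = p ^ i" using divides_primepow_nat[OF p] by auto
      show "p dvd card c"
      proof (cases "i = 0")
        case True
        then have "card c = 1" using i by simp
        moreover have "y \<in> c" using orbit_refl y X(1) by auto
        ultimately have "c = {y}" by (metis card_1_singletonE singletonD)
        then have "\<forall>g\<in>carrier G. \<phi> g y = y" using y(3) by (auto simp: orbit_def)
        then show ?thesis using no y by blast
      next
        case False
        then show ?thesis using i by simp
      qed
    qed
    show "\<forall>c1\<in>orbit G \<phi> ` (X - {x}). \<forall>c2\<in>orbit G \<phi> ` (X - {x}). c1 \<noteq> c2 \<longrightarrow> c1 \<inter> c2 = {}"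
      using part by blast
  qed
  also have "\<Union>(orbit G \<phi> ` (X - {x})) = X - {x}"
  proof
    show "X - {x} \<subseteq> \<Union>(orbit G \<phi> ` (X - {x}))" using orbit_refl X(1) by blast
    show "\<Union>(orbit G \<phi> ` (X - {x})) \<subseteq> X - {x}"
    proof
      fix u assume "u \<in> \<Union>(orbit G \<phi> ` (X - {x}))"
      then obtain y where y: "y \<in> X" "y \<noteq> x" "u \<in> orbit G \<phi> y" by auto
      have "u \<noteq> x"
      proof
        assume "u = x"
        then have "y \<in> orbit G \<phi> x" using orbit_sym[of y x] y x X(1) by blast
        then show False using x(2) y(2) by (auto simp: orbit_def)
      qed
      then show "u \<in> X - {x}" using orbX y by blast
    qed
  qed
  finally have "p dvd card X - 1" using x(1) X(2) by simp
  moreover have "card X > 0" using x(1) X(2) card_gt_0_iff by blast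
  ultimately have "p dvd card X - (card X - 1)" using dvd by (metis dvd_diff_nat)
  then have "p dvd 1" using \<open>card X > 0\<close> by (simp only: diff_diff_cancel Suc_leI One_nat_def diff_Suc_1)
  then show False using p by simp
qed

lemma (in group) prime_power_center_nontrivial:
  assumes p: "prime (p::nat)" and ord: "order G = p ^ a" and nt: "order G \<noteq> 1"
  shows "\<exists>z\<in>carrier G. z \<noteq> \<one> \<and> (\<forall>g\<in>carrier G. g \<otimes> z = z \<otimes> g)"
proof -
  interpret conj: group_action G "carrier G" "\<lambda>g. (\<lambda>h \<in> carrier G. g \<otimes> h \<otimes> inv g)"
    by (rule action_by_conjugation)
  have "order G > 0" using ord p by (simp add: prime_gt_0_nat)
  then have fin: "finite (carrier G)" by (simp add: order_gt_0_iff_finite)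
  have "p dvd card (carrier G)" using ord nt by (cases a) (auto simp: order_def)
  then obtain z where z: "z \<in> carrier G" "z \<noteq> \<one>"
    "\<forall>g\<in>carrier G. (\<lambda>h \<in> carrier G. g \<otimes> h \<otimes> inv g) z = z"
    using conj.prime_power_group_another_fixed_point[OF p ord subset_refl fin, of \<one>] by auto
  have "g \<otimes> z = z \<otimes> g" if g: "g \<in> carrier G" for g
  proof -
    have "g \<otimes> z \<otimes> inv g = z" using z g by auto
    then show ?thesis using g z(1) by (metis inv_solve_right' m_closed)
  qed
  then show ?thesis using z by blast
qed

text \<open>The elements with \<open>x \<otimes> x \<noteq> \<one>\<close> come in pairs of an element and its inverse.\<close>

lemma (in group) even_card_involutions:
  assumes fin: "finite (carrier G)" and ev: "even (order G)"
  shows "even (card {x \<in> carrier G. x \<otimes> x = \<one>})"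
proof -
  let ?I = "{x \<in> carrier G. x \<otimes> x = \<one>}"
  have ne: "inv x \<noteq> x" if x: "x \<in> carrier G - ?I" for x
  proof
    assume "inv x = x"
    then show False using x r_inv[of x] by simp
  qed
  have "2 dvd card (\<Union>((\<lambda>x. {x, inv x}) ` (carrier G - ?I)))"
  proof (rule dvd_partition)
    show "finite (\<Union>((\<lambda>x. {x, inv x}) ` (carrier G - ?I)))" using fin by auto
    show "\<forall>c\<in>(\<lambda>x. {x, inv x}) ` (carrier G - ?I). 2 dvd card c"
    proof
      fix c assume "c \<in> (\<lambda>x. {x, inv x}) ` (carrier G - ?I)"
      then obtain x where x: "x \<in> carrier G - ?I" and c: "c = {x, inv x}" by blast
      show "2 dvd card c" unfolding c using ne[OF x] by (simp add: card_insert_if eq_commute)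
    qed
    show "\<forall>c1\<in>(\<lambda>x. {x, inv x}) ` (carrier G - ?I). \<forall>c2\<in>(\<lambda>x. {x, inv x}) ` (carrier G - ?I).
        c1 \<noteq> c2 \<longrightarrow> c1 \<inter> c2 = {}"
      by auto
  qed
  also have "\<Union>((\<lambda>x. {x, inv x}) ` (carrier G - ?I)) = carrier G - ?I"
  proof -
    have "inv x \<in> carrier G - ?I" if "x \<in> carrier G - ?I" for x
      using that by (auto simp flip: inv_mult_group)
    then show ?thesis by blast
  qed
  finally have "even (order G - card ?I)" using fin by (simp add: card_Diff_subset order_def)
  moreover have "card ?I \<le> order G" unfolding order_def by (rule card_mono) (use fin in auto)
  ultimately show ?thesis using ev by (simp add: even_diff_nat)
qed

text \<open>
  The subgroup permutes the evenly many solutions of \<open>x \<otimes> x = \<one>\<close> by conjugation and fixes the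
  solution \<open>\<one>\<close>, so it fixes another one.
\<close>

lemma (in group) involution_centralized_by_2_subgroup:
  assumes fin: "finite (carrier G)" and ev: "even (order G)"
    and S: "subgroup S G" and cS: "card S = 2 ^ a"
  shows "\<exists>z\<in>carrier G. z \<noteq> \<one> \<and> z \<otimes> z = \<one> \<and> (\<forall>s\<in>S. s \<otimes> z \<otimes> inv s = z)"
proof -
  let ?I = "{x \<in> carrier G. x \<otimes> x = \<one>}"
  have SG: "S \<subseteq> carrier G" using S by (rule subgroup.subset)
  interpret conj: group_action G "carrier G" "\<lambda>g. (\<lambda>h \<in> carrier G. g \<otimes> h \<otimes> inv g)"
    by (rule action_by_conjugation)
  interpret S: group_action "G\<lparr>carrier := S\<rparr>" "carrier G" "\<lambda>g. (\<lambda>h \<in> carrier G. g \<otimes> h \<otimes> inv g)"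
    by (rule conj.induced_action[OF S])
  have sq: "(s \<otimes> x \<otimes> inv s) \<otimes> (s \<otimes> x \<otimes> inv s) = \<one>" if "s \<in> carrier G" "x \<in> ?I" for s x
  proof -
    have x: "x \<in> carrier G" "x \<otimes> x = \<one>" using that by auto
    have "(s \<otimes> x \<otimes> inv s) \<otimes> (s \<otimes> x \<otimes> inv s) = s \<otimes> (x \<otimes> (inv s \<otimes> s) \<otimes> x) \<otimes> inv s"
      using that(1) x(1) by (simp only: m_assoc m_closed inv_closed)
    then show ?thesis using that(1) x by simp
  qed
  obtain z where "z \<in> ?I" "z \<noteq> \<one>" "\<forall>g\<in>S. (\<lambda>h \<in> carrier G. g \<otimes> h \<otimes> inv g) z = z"
    using S.prime_power_group_another_fixed_point[of 2 a ?I \<one>] even_card_involutions[OF fin ev] fin cS SG sq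
    by (auto simp: order_def subset_iff)
  then show ?thesis by auto
qed

text \<open>The centralizer contains a Sylow 2-subgroup, so its index is odd.\<close>

lemma (in group) conjugacy_class_card_odd:
  assumes fin: "finite (carrier G)" and S: "subgroup S G" and cS: "card S = 2 ^ a"
    and ord: "order G = 2 ^ a * m" and m: "odd m"
    and z: "z \<in> carrier G" and cent: "\<forall>s\<in>S. s \<otimes> z \<otimes> inv s = z"
  shows "odd (card ((\<lambda>x. x \<otimes> z \<otimes> inv x) ` carrier G))"
    and "card ((\<lambda>x. x \<otimes> z \<otimes> inv x) ` carrier G) dvd order G"
proof -
  let ?\<phi> = "\<lambda>g. (\<lambda>h \<in> carrier G. g \<otimes> h \<otimes> inv g)"
  interpret conj: group_action G "carrier G" ?\<phi> by (rule action_by_conjugation)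
  have orb: "orbit G ?\<phi> z = (\<lambda>x. x \<otimes> z \<otimes> inv x) ` carrier G"
    using z by (simp add: orbit_def Setcompr_eq_image)
  note os = conj.orbit_stabilizer_theorem[OF z, unfolded orb]
  show "card ((\<lambda>x. x \<otimes> z \<otimes> inv x) ` carrier G) dvd order G" by (rule dvdI[OF os[symmetric]])
  have C: "subgroup (stabilizer G ?\<phi> z) G" by (rule conj.stabilizer_subgroup[OF z])
  have "S \<subseteq> stabilizer G ?\<phi> z" using cent z subgroup.subset[OF S] by (auto simp: stabilizer_def)
  then have "subgroup S (G\<lparr>carrier := stabilizer G ?\<phi> z\<rparr>)" by (rule subgroup_incl[OF S C])
  then have "card S dvd card (stabilizer G ?\<phi> z)"
    using group.lagrange[OF subgroup_imp_group[OF C], of S]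
    by (intro dvdI[of _ _ "card (rcosets\<^bsub>G\<lparr>carrier := stabilizer G ?\<phi> z\<rparr>\<^esub> S)"])
       (simp add: order_def mult.commute)
  then obtain t where t: "card (stabilizer G ?\<phi> z) = 2 ^ a * t" using cS by (auto elim: dvdE)
  have "card ((\<lambda>x. x \<otimes> z \<otimes> inv x) ` carrier G) * t = m" using os t ord by auto
  then show "odd (card ((\<lambda>x. x \<otimes> z \<otimes> inv x) ` carrier G))" using m by auto
qed

definition (in group) center :: "'a set" where
  "center = {z \<in> carrier G. \<forall>g\<in>carrier G. g \<otimes> z = z \<otimes> g}"

lemma (in group) center_normal: "center \<lhd> G"
proof -
  have "subgroup center G"
  proof (rule subgroupI)
    show "center \<subseteq> carrier G" by (auto simp: center_def)
    show "center \<noteq> {}" by (auto simp: center_def intro!: exI[of _ \<one>])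
  next
    fix x assume "x \<in> center"
    then have x: "x \<in> carrier G" "\<And>g. g \<in> carrier G \<Longrightarrow> g \<otimes> x = x \<otimes> g" by (auto simp: center_def)
    have "g \<otimes> inv x = inv x \<otimes> g" if g: "g \<in> carrier G" for g
      using x(1) x(2)[of "inv g"] g by (metis inv_closed inv_inv inv_mult_group)
    then show "inv x \<in> center" using x by (auto simp: center_def)
  next
    fix x y assume "x \<in> center" "y \<in> center"
    then have xy: "x \<in> carrier G" "y \<in> carrier G"
      "\<And>g. g \<in> carrier G \<Longrightarrow> g \<otimes> x = x \<otimes> g" "\<And>g. g \<in> carrier G \<Longrightarrow> g \<otimes> y = y \<otimes> g"
      by (auto simp: center_def)
    have "g \<otimes> (x \<otimes> y) = x \<otimes> y \<otimes> g" if g: "g \<in> carrier G" for g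
    proof -
      have "g \<otimes> (x \<otimes> y) = x \<otimes> g \<otimes> y" using xy(1,2) xy(3)[OF g] g by (simp flip: m_assoc)
      also have "\<dots> = x \<otimes> (y \<otimes> g)" using xy(1,2) xy(4)[OF g] g by (simp add: m_assoc)
      finally show ?thesis using xy(1,2) g by (simp add: m_assoc)
    qed
    then show "x \<otimes> y \<in> center" using xy(1,2) by (simp add: center_def)
  qed
  moreover have "x \<otimes> h \<otimes> inv x \<in> center" if "x \<in> carrier G" "h \<in> center" for x h
  proof -
    have h: "h \<in> carrier G" "x \<otimes> h = h \<otimes> x" using that by (auto simp: center_def)
    have "x \<otimes> h \<otimes> inv x = h" unfolding h(2) using h(1) that(1) by (simp add: m_assoc)
    then show ?thesis using that by simp
  qed
  ultimately show ?thesis by (auto simp: normal_inv_iff)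
qed

text \<open>
  A nonabelian simple group of this kind has trivial center, so it is not of prime power order. An
  involution in it that is centralized by a Sylow 2-subgroup has a class of size \<open>r\<^sup>k\<close>, and
  \<open>k > 0\<close> because the center is trivial.
\<close>

lemma (in group) simple_two_prime_abelian:
  assumes fin: "finite (carrier G)" and r: "prime (r::nat)"
    and primes: "\<And>p. prime p \<Longrightarrow> p dvd order G \<Longrightarrow> p = 2 \<or> p = r"
    and simple: "\<And>N. N \<lhd> G \<Longrightarrow> N = {\<one>} \<or> N = carrier G"
  shows "comm_group G"
proof (rule ccontr)
  assume "\<not> comm_group G"
  then obtain x y where xy: "x \<in> carrier G" "y \<in> carrier G" "x \<otimes> y \<noteq> y \<otimes> x" using group_comm_groupI by blast
  then have "center \<noteq> carrier G" by (auto simp: center_def)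
  then have "center = {\<one>}" using simple[OF center_normal] by auto
  then have cen: "z = \<one>" if "z \<in> carrier G" "\<And>g. g \<in> carrier G \<Longrightarrow> g \<otimes> z = z \<otimes> g" for z
    using that by (auto simp: center_def)
  have o0: "order G > 0" using fin by (simp add: order_gt_0_iff_finite)
  have o1: "order G \<noteq> 1"
  proof
    assume "order G = 1"
    then obtain u where "carrier G = {u}" by (auto simp: order_def card_1_singleton_iff)
    then show False using xy by auto
  qed
  show False
  proof (cases "even (order G)")
    case False
    then have "\<And>q. prime q \<Longrightarrow> q dvd order G \<Longrightarrow> q = r" using primes by auto
    then obtain k where "order G = r ^ k" using prime_power_if_only_prime_divisor[OF o0 r] by blast
    then show False using prime_power_center_nontrivial[OF r _ o1] cen by blast
  next
    case True
    define a where "a = multiplicity 2 (order G)"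
    obtain m where am: "order G = 2 ^ a * m" "odd m"
      unfolding a_def by (rule multiplicity_decompose'[of "order G" 2]) (use o0 in auto)
    obtain S where S: "subgroup S G" "card S = 2 ^ a"
      using sylow_thm[OF two_is_prime_nat group_axioms am(1) fin] by auto
    obtain z where z: "z \<in> carrier G" "z \<noteq> \<one>" "z \<otimes> z = \<one>" "\<forall>s\<in>S. s \<otimes> z \<otimes> inv s = z"
      using involution_centralized_by_2_subgroup[OF fin True S] by auto
    let ?K = "(\<lambda>x. x \<otimes> z \<otimes> inv x) ` carrier G"
    note odd = conjugacy_class_card_odd[OF fin S am z(1,4)]
    have "card ?K > 0" using fin by (simp add: card_gt_0_iff) auto
    moreover have "q = r" if "prime q" "q dvd card ?K" for q
      using primes[OF that(1) dvd_trans[OF that(2) odd(2)]] odd(1) that(2) by auto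
    ultimately obtain k where k: "card ?K = r ^ k" using prime_power_if_only_prime_divisor[OF _ r] by blast
    show False
    proof (cases "k = 0")
      case True
      then obtain u where u: "?K = {u}" using k by (auto simp: card_1_singleton_iff)
      have "z = u" using u z(1) by (metis (no_types, lifting) image_eqI inv_one l_one one_closed r_one singletonD)
      then have c: "g \<otimes> z \<otimes> inv g = z" if "g \<in> carrier G" for g using u that by blast
      have "z = \<one>"
      proof (rule cen[OF z(1)])
        fix g assume g: "g \<in> carrier G"
        show "g \<otimes> z = z \<otimes> g" using c[OF g] g z(1) by (metis inv_solve_right' m_closed)
      qed
      then show False using z(2) by simp
    next
      case False
      obtain e where "bij_betw e {0..<card (carrier G)} (carrier G)" using ex_bij_betw_nat_finite[OF fin] by auto
      then interpret enumerated_group G "card (carrier G)" e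
        by unfold_locales (simp add: atLeast0LessThan)
      show False
        using involution_class_prime_power_ex_normal[OF z(1-3) r _ k] False simple by blast
    qed
  qed
qed

text \<open>
  The induction on the order passes to a factor group, whose elements are cosets. To stay within one
  type of group elements, the factor group is replaced by a copy on natural numbers.
\<close>

lemma solvable_two_prime_nat:
  fixes G :: "nat monoid"
  assumes "group G" "finite (carrier G)" "prime (r::nat)"
    "\<And>p. prime p \<Longrightarrow> p dvd order G \<Longrightarrow> p = 2 \<or> p = r"
  shows "solvable G"
  using assms
proof (induction "order G" arbitrary: G rule: less_induct)
  case less
  interpret group G by (rule less.prems(1))
  note fin = less.prems(2)
  show ?case
  proof (cases "\<exists>N. N \<lhd> G \<and> N \<noteq> {\<one>\<^bsub>G\<^esub>} \<and> N \<noteq> carrier G")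
    case False
    then interpret comm_group G
      using simple_two_prime_abelian[OF fin less.prems(3,4)] by blast
    have "(derived G ^^ 1) (carrier G) = {\<one>\<^bsub>G\<^esub>}" using derived_eq_singleton[of "carrier G"] by simp
    then show ?thesis unfolding solvable_iff_trivial_derived_seq by blast
  next
    case True
    then obtain N where N: "N \<lhd> G" "N \<noteq> {\<one>\<^bsub>G\<^esub>}" "N \<noteq> carrier G" by auto
    interpret N: normal N G by (rule N(1))
    have subN: "subgroup N G" by (rule N.subgroup_axioms)
    have finN: "finite N" using finite_subset[OF N.subset fin] .
    have "card N < order G" unfolding order_def using N.subset N(3) fin by (intro psubset_card_mono) auto
    have lag: "card (rcosets\<^bsub>G\<^esub> N) * card N = order G" by (rule lagrange[OF subN])
    have "card N > 1"
    proof -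
      have "\<one>\<^bsub>G\<^esub> \<in> N" by (rule N.one_closed)
      then have "{\<one>\<^bsub>G\<^esub>} \<subset> N" using N(2) by auto
      then have "card {\<one>\<^bsub>G\<^esub>} < card N" by (rule psubset_card_mono[OF finN])
      then show ?thesis by simp
    qed
    have o0: "order G > 0" using fin by (simp add: order_gt_0_iff_finite)
    have ordQ: "order (G Mod N) = card (rcosets\<^bsub>G\<^esub> N)" by (simp add: order_def FactGroup_def)
    have "card (rcosets\<^bsub>G\<^esub> N) < order G"
      using lag \<open>card N > 1\<close> o0 by (metis mult.right_neutral nat_0_less_mult_iff nat_mult_less_cancel_disj)
    have solN: "solvable (G\<lparr>carrier := N\<rparr>)"
    proof (rule less.hyps)
      show "order (G\<lparr>carrier := N\<rparr>) < order G" using \<open>card N < order G\<close> by (simp add: order_def)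
      show "group (G\<lparr>carrier := N\<rparr>)" by (rule subgroup_imp_group[OF subN])
      show "finite (carrier (G\<lparr>carrier := N\<rparr>))" using finN by simp
      show "p = 2 \<or> p = r" if "prime p" "p dvd order (G\<lparr>carrier := N\<rparr>)" for p
      proof -
        have "p dvd card N" using that(2) by (simp add: order_def)
        then have "p dvd order G" unfolding lag[symmetric] by simp
        then show ?thesis by (rule less.prems(4)[OF that(1)])
      qed
    qed (rule less.prems(3))
    interpret Q: group "G Mod N" by (rule N.factorgroup_is_group)
    have finQ: "finite (carrier (G Mod N))"
      using ordQ lag o0 by (metis Q.order_gt_0_iff_finite gr0I mult_0)
    obtain f :: "nat set \<Rightarrow> nat" where f: "inj_on f (carrier (G Mod N))"
      using finite_imp_inj_to_nat_seg[OF finQ] by blast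
    define H where "H = image_group f (G Mod N)"
    have H: "group H" unfolding H_def by (rule Q.inj_imp_image_group_is_group[OF f])
    have iso: "f \<in> iso (G Mod N) H" unfolding H_def by (rule inj_imp_image_group_iso[OF f])
    have ordH: "order H = card (rcosets\<^bsub>G\<^esub> N)"
      using card_image[OF f] ordQ by (simp add: H_def order_def image_group_carrier)
    have "solvable H"
    proof (rule less.hyps)
      show "order H < order G" using ordH \<open>card (rcosets\<^bsub>G\<^esub> N) < order G\<close> by simp
      show "finite (carrier H)" using finQ by (simp add: H_def image_group_carrier)
      show "p = 2 \<or> p = r" if "prime p" "p dvd order H" for p
      proof -
        have "p dvd order G" using that(2) unfolding ordH lag[symmetric] by simp
        then show ?thesis by (rule less.prems(4)[OF that(1)])
      qed
    qed (rule H less.prems(3))+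
    then have solQ: "solvable (G Mod N)"
      using iso by (intro group_hom.inj_hom_imp_solvable[of _ H f])
        (auto simp: group_hom_def group_hom_axioms_def iso_def bij_betw_def Q.group_axioms H)
    show ?thesis
    proof (rule solvable_condition[OF _ _ _ _ solN solQ])
      show "group_hom (G\<lparr>carrier := N\<rparr>) G id"
        unfolding group_hom_def group_hom_axioms_def
        using subgroup_imp_group[OF subN] N.subset by (auto simp: hom_def group_axioms)
      show "group_hom G (G Mod N) ((#>\<^bsub>G\<^esub>) N)"
        unfolding group_hom_def group_hom_axioms_def using N.r_coset_hom_Mod
        by (auto simp: group_axioms Q.group_axioms)
      show "(#>\<^bsub>G\<^esub>) N ` carrier G = carrier (G Mod N)" by (auto simp: FactGroup_def RCOSETS_def)
      show "kernel G (G Mod N) ((#>\<^bsub>G\<^esub>) N) \<subseteq> id ` carrier (G\<lparr>carrier := N\<rparr>)"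
        using coset_join1[OF _ _ subN] N.subset by (auto simp: kernel_def FactGroup_def)
    qed
  qed
qed

theorem (in group) solvable_if_order_two_prime:
  assumes fin: "finite (carrier G)" and r: "prime (r::nat)"
    and primes: "\<And>p. prime p \<Longrightarrow> p dvd order G \<Longrightarrow> p = 2 \<or> p = r"
  shows "solvable G"
proof -
  obtain f :: "'a \<Rightarrow> nat" where f: "inj_on f (carrier G)"
    using finite_imp_inj_to_nat_seg[OF fin] by blast
  define H where "H = image_group f G"
  have H: "group H" unfolding H_def by (rule inj_imp_image_group_is_group[OF f])
  have iso: "f \<in> iso G H" unfolding H_def by (rule inj_imp_image_group_iso[OF f])
  have "order H = order G" using card_image[OF f] by (simp add: H_def order_def image_group_carrier)
  then have "solvable H"
    using solvable_two_prime_nat[OF H _ r] fin primes by (auto simp: H_def image_group_carrier)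
  then show ?thesis
    using iso by (intro group_hom.inj_hom_imp_solvable[of _ H f])
      (auto simp: group_hom_def group_hom_axioms_def iso_def bij_betw_def group_axioms H)
qed

text \<open>The last nontrivial term of the derived series.\<close>

theorem (in group) solvable_ex_abelian_normal:
  assumes sol: "solvable G" and nt: "carrier G \<noteq> {\<one>}"
  shows "\<exists>D. D \<lhd> G \<and> D \<noteq> {\<one>} \<and> (\<forall>x\<in>D. \<forall>y\<in>D. x \<otimes> y = y \<otimes> x)"
proof -
  have ex: "\<exists>n. (derived G ^^ n) (carrier G) = {\<one>}" using sol solvable_iff_trivial_derived_seq by simp
  define n where "n = (LEAST n. (derived G ^^ n) (carrier G) = {\<one>})"
  have n: "(derived G ^^ n) (carrier G) = {\<one>}" unfolding n_def by (rule LeastI_ex[OF ex])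
  have "n \<noteq> 0" using n nt by (cases n) auto
  then obtain m where m: "n = Suc m" by (cases n) auto
  define D where "D = (derived G ^^ m) (carrier G)"
  have D1: "D \<noteq> {\<one>}" using not_less_Least[of m "\<lambda>n. (derived G ^^ n) (carrier G) = {\<one>}"] m
    by (auto simp: D_def n_def)
  have "(derived G ^^ k) (carrier G) \<lhd> G" for k
  proof (induction k)
    case 0
    then show ?case by (simp add: normal_inv_iff subgroup_self)
  next
    case (Suc k)
    then show ?case using derived_is_normal by simp
  qed
  then have DG: "D \<lhd> G" by (simp add: D_def)
  have "x \<otimes> y = y \<otimes> x" if xy: "x \<in> D" "y \<in> D" for x y
  proof -
    have c: "x \<in> carrier G" "y \<in> carrier G"
      using subgroup.subset[OF normal_imp_subgroup[OF DG]] xy by auto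
    have "derived G D = {\<one>}" using n m by (simp add: D_def)
    moreover have "x \<otimes> y \<otimes> inv x \<otimes> inv y \<in> derived G D"
      unfolding derived_def by (rule generate.incl) (use xy in blast)
    ultimately have "x \<otimes> y \<otimes> inv x \<otimes> inv y = \<one>" by auto
    then have "x \<otimes> y \<otimes> inv x = y" using c inv_equality[of "x \<otimes> y \<otimes> inv x" "inv y"] by simp
    then have "x \<otimes> y \<otimes> inv x \<otimes> x = y \<otimes> x" by simp
    then show ?thesis using c by (simp add: m_assoc)
  qed
  then show ?thesis using DG D1 by (intro exI[of _ D]) simp
qed


section \<open>Semiregular permutations and vertex-transitive digraphs\<close>

text \<open>
  Semiregularity, expressed by the powers of the permutation instead of the sizes of its cycles: a
  power with a fixed point is trivial. In this form it passes to lifts of a permutation, since a power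
  of the lift with a fixed point lies over a power with a fixed point.
\<close>

definition free_on :: "'a set \<Rightarrow> ('a \<Rightarrow> 'a) \<Rightarrow> bool" where
  "free_on V g \<longleftrightarrow> g permutes V \<and> (\<forall>k. \<forall>x\<in>V. (g ^^ k) x = x \<longrightarrow> g ^^ k = id)"

text \<open>The cycle of \<open>g\<close> through any \<open>x\<close> is in bijection with the set of powers of \<open>g\<close>.\<close>

lemma semiregular_on_if_free_on:
  assumes fin: "finite V" and g: "free_on V g"
  shows "semiregular_on V g"
proof -
  have perm: "g permutes V" and free: "\<And>k x. x \<in> V \<Longrightarrow> (g ^^ k) x = x \<Longrightarrow> g ^^ k = id"
    using g by (auto simp: free_on_def)
  have eq: "g ^^ i = g ^^ j" if x: "x \<in> V" and ij: "(g ^^ i) x = (g ^^ j) x" "i \<le> j" for x i j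
  proof -
    have "(g ^^ i) ((g ^^ (j - i)) x) = (g ^^ i) x"
      using ij by (metis comp_apply funpow_add le_add_diff_inverse)
    moreover have "inj (g ^^ i)" using permutes_inj[OF perm] inj_fn by blast
    ultimately have "(g ^^ (j - i)) x = x" by (rule injD[rotated])
    then have "g ^^ (j - i) = id" by (rule free[OF x])
    then show ?thesis using funpow_add[of i "j - i" g] ij(2) by simp
  qed
  have "card (Orbits.orbit g x) = card {g ^^ n | n. n > 0}" if x: "x \<in> V" for x
  proof -
    have "bij_betw (\<lambda>h. h x) {g ^^ n | n. n > 0} (Orbits.orbit g x)"
      unfolding bij_betw_def
    proof
      show "inj_on (\<lambda>h. h x) {g ^^ n | n. n > 0}"
      proof (rule inj_onI)
        fix h h' assume "h \<in> {g ^^ n | n. n > 0}" "h' \<in> {g ^^ n | n. n > 0}" "h x = h' x"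
        then obtain i j where "h = g ^^ i" "h' = g ^^ j" by auto
        then show "h = h'" using eq[OF x, of i j] eq[OF x, of j i] \<open>h x = h' x\<close> by (metis linear)
      qed
      show "(\<lambda>h. h x) ` {g ^^ n | n. n > 0} = Orbits.orbit g x"
        unfolding orbit_altdef by auto
    qed
    then show ?thesis by (simp add: bij_betw_same_card)
  qed
  then show ?thesis using perm by (simp add: semiregular_on_def)
qed

lemma permutes_if_inj_on:
  assumes "finite V" "f \<in> V \<rightarrow> V" "inj_on f V" "\<And>x. x \<notin> V \<Longrightarrow> f x = x"
  shows "f permutes V"
  by (rule bij_imp_permutes)
     (use assms endo_inj_surj[of V f] in \<open>auto simp: bij_betw_def image_subset_iff Pi_iff\<close>)

lemma funpow_permutes: "f permutes V \<Longrightarrow> (f ^^ k) permutes V"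
  by (induction k) (auto simp: permutes_id intro: permutes_compose)

text \<open>
  A permutation of \<open>X\<close> that acts freely can be copied to every member of a partition of \<open>V\<close> into sets of
  the size of \<open>X\<close>. This serves for the components of a digraph, with bijections that are
  isomorphisms, and for bundles of vertices that can be permuted arbitrarily.
\<close>

lemma free_on_fibrewise:
  fixes c :: "'a \<Rightarrow> 'c" and b :: "'c \<Rightarrow> 'b \<Rightarrow> 'a"
  assumes fin: "finite V" and ne: "V \<noteq> {}"
    and bij: "\<And>r. r \<in> c ` V \<Longrightarrow> bij_betw (b r) X {x \<in> V. c x = r}"
    and g: "free_on X g" "g \<noteq> id"
  shows "\<exists>f. free_on V f \<and> f \<noteq> id \<and> (\<forall>x\<in>V. c (f x) = c x)
    \<and> (\<forall>r\<in>c ` V. \<forall>y\<in>X. f (b r y) = b r (g y))"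
proof -
  have gX: "g permutes X" and gfree: "\<And>k x. x \<in> X \<Longrightarrow> (g ^^ k) x = x \<Longrightarrow> g ^^ k = id"
    using g by (auto simp: free_on_def)
  define f where "f = (\<lambda>x. if x \<in> V then b (c x) (g (inv_into X (b (c x)) x)) else x)"
  have b: "b r y \<in> V" "c (b r y) = r" if "r \<in> c ` V" "y \<in> X" for r y
    using bij_betwE[OF bij[OF that(1)]] that(2) by auto
  have ginX: "g y \<in> X" if "y \<in> X" for y using permutes_in_image[OF gX] that by simp
  have f: "f (b r y) = b r (g y)" if "r \<in> c ` V" "y \<in> X" for r y
    using b[OF that] bij_betw_inv_into_left[OF bij[OF that(1)] that(2)] by (simp add: f_def)
  have rep: "\<exists>r y. r \<in> c ` V \<and> y \<in> X \<and> x = b r y" if "x \<in> V" for x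
  proof -
    have "x \<in> b (c x) ` X" using bij[of "c x"] that by (auto simp: bij_betw_def)
    then show ?thesis using that by blast
  qed
  have pow: "(f ^^ k) (b r y) = b r ((g ^^ k) y)" if "r \<in> c ` V" "y \<in> X" for k r y
  proof (induction k)
    case (Suc k)
    have "(g ^^ k) y \<in> X" using permutes_in_image[OF funpow_permutes[OF gX]] that by simp
    then show ?case using Suc f[OF that(1)] by simp
  qed simp
  have binj: "y = y'" if "b r y = b r y'" "r \<in> c ` V" "y \<in> X" "y' \<in> X" for r y y'
    using bij[OF that(2)] that by (auto simp: bij_betw_def inj_on_def)
  have perm: "f permutes V"
  proof (rule permutes_if_inj_on[OF fin])
    show "f \<in> V \<rightarrow> V"
    proof
      fix x assume "x \<in> V"
      then obtain r y where "r \<in> c ` V" "y \<in> X" "x = b r y" using rep by blast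
      then show "f x \<in> V" using f b(1) ginX by simp
    qed
    show "inj_on f V"
    proof (rule inj_onI)
      fix x x' assume xx: "x \<in> V" "x' \<in> V" "f x = f x'"
      obtain r y where r: "r \<in> c ` V" "y \<in> X" "x = b r y" using rep[OF xx(1)] by blast
      obtain r' y' where r': "r' \<in> c ` V" "y' \<in> X" "x' = b r' y'" using rep[OF xx(2)] by blast
      have e: "b r (g y) = b r' (g y')" using xx(3) f r r' by simp
      then have "r = r'" using b(2) r r' ginX by metis
      moreover from this have "g y = g y'" using binj e r r' ginX by metis
      then have "y = y'" using permutes_inj[OF gX] by (auto dest: injD)
      ultimately show "x = x'" using r r' by simp
    qed
  qed (simp add: f_def)
  have "free_on V f"
    unfolding free_on_def
  proof (intro conjI allI ballI impI)
    fix k x assume x: "x \<in> V" and fx: "(f ^^ k) x = x"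
    obtain r y where r: "r \<in> c ` V" "y \<in> X" "x = b r y" using rep[OF x] by blast
    have gy: "(g ^^ k) y \<in> X" using permutes_in_image[OF funpow_permutes[OF gX]] r by simp
    have "(g ^^ k) y = y" using fx pow r binj[of r, OF _ r(1) gy r(2)] by simp
    then have "g ^^ k = id" using gfree r by simp
    show "f ^^ k = id"
    proof
      fix u
      show "(f ^^ k) u = id u"
      proof (cases "u \<in> V")
        case True
        then obtain r y where "r \<in> c ` V" "y \<in> X" "u = b r y" using rep by blast
        then show ?thesis using pow \<open>g ^^ k = id\<close> by simp
      next
        case False
        then show ?thesis using permutes_not_in[OF funpow_permutes[OF perm]] by simp
      qed
    qed
  qed (rule perm)
  moreover have "f \<noteq> id"
  proof
    assume "f = id"
    obtain y where y: "g y \<noteq> y" using g(2) by (auto simp: fun_eq_iff)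
    then have yX: "y \<in> X" using permutes_not_in[OF gX] by metis
    obtain v where "v \<in> V" using ne by auto
    then have "c v \<in> c ` V" by simp
    then have "b (c v) (g y) = b (c v) y" using f[of "c v" y] yX \<open>f = id\<close> by simp
    then show False using binj[of "c v"] y yX ginX \<open>c v \<in> c ` V\<close> by blast
  qed
  moreover have "c (f x) = c x" if x: "x \<in> V" for x
  proof -
    obtain r y where r: "r \<in> c ` V" "y \<in> X" "x = b r y" using rep[OF x] by blast
    then show ?thesis using f[OF r(1,2)] b(2) ginX by simp
  qed
  ultimately show ?thesis using f by blast
qed

lemma free_on_cyclic_shift:
  assumes n: "n \<ge> 2"
  defines "s \<equiv> \<lambda>i::nat. if i < n then Suc i mod n else i"
  shows "free_on {..<n} s" "s \<noteq> id"
proof -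
  have n0: "n > 0" using n by simp
  have pow: "(s ^^ k) i = (i + k) mod n" if "i < n" for k i
    using that n0 by (induction k) (auto simp: s_def mod_Suc_eq)
  have perm: "s permutes {..<n}"
  proof (rule permutes_if_inj_on)
    show "inj_on s {..<n}"
    proof (rule inj_onI)
      fix i j assume ij: "i \<in> {..<n}" "j \<in> {..<n}" "s i = s j"
      then show "i = j" by (auto simp: s_def mod_Suc split: if_splits)
    qed
  qed (use n0 in \<open>auto simp: s_def\<close>)
  show "free_on {..<n} s"
    unfolding free_on_def
  proof (intro conjI allI ballI impI)
    fix k i assume i: "i \<in> {..<n}" "(s ^^ k) i = i"
    then have "(i + k) mod n = i mod n" using pow[of i k] by simp
    then have nk: "n dvd k" by (simp add: mod_eq_dvd_iff_nat)
    show "s ^^ k = id"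
    proof
      fix j
      show "(s ^^ k) j = id j"
      proof (cases "j < n")
        case True
        then show ?thesis using pow[OF True, of k] nk by (auto elim: dvdE)
      next
        case False
        then show ?thesis using permutes_not_in[OF funpow_permutes[OF perm], of j k] by simp
      qed
    qed
  qed (rule perm)
  have "s 0 \<noteq> id 0" using n by (simp add: s_def)
  then show "s \<noteq> id" by metis
qed

lemma free_on_equal_fibres:
  fixes c :: "'a \<Rightarrow> 'c"
  assumes fin: "finite V" and ne: "V \<noteq> {}" and n: "n \<ge> 2"
    and card: "\<And>v. v \<in> V \<Longrightarrow> card {x \<in> V. c x = c v} = n"
  shows "\<exists>f. free_on V f \<and> f \<noteq> id \<and> (\<forall>x\<in>V. c (f x) = c x)"
proof -
  have "\<exists>b. bij_betw b {..<n} {x \<in> V. c x = r}" if "r \<in> c ` V" for r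
  proof -
    have "card {x \<in> V. c x = r} = n" using that card by auto
    then show ?thesis using ex_bij_betw_nat_finite[of "{x \<in> V. c x = r}"] fin by (auto simp: atLeast0LessThan)
  qed
  then obtain b where b: "\<And>r. r \<in> c ` V \<Longrightarrow> bij_betw (b r) {..<n} {x \<in> V. c x = r}" by metis
  from free_on_fibrewise[OF fin ne b free_on_cyclic_shift[OF n]] show ?thesis by auto
qed

text \<open>Used for blocks in a transitive action on a set of prime size: they are singletons or everything.\<close>

lemma prime_equal_fibres:
  assumes "prime (card X)" and card: "\<And>x. x \<in> X \<Longrightarrow> card {y \<in> X. f y = f x} = m"
  shows "m = 1 \<or> m = card X"
proof -
  have fin: "finite X" using assms(1) by (metis card.infinite not_prime_0)
  have "card X = (\<Sum>r\<in>f ` X. \<Sum>x\<in>{x \<in> X. f x = r}. 1)"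
    using sum.image_gen[OF fin, of "\<lambda>_. 1::nat" f] by simp
  also have "\<dots> = (\<Sum>r\<in>f ` X. m)" by (rule sum.cong) (use card in auto)
  finally have "m dvd card X" by simp
  then show ?thesis using assms(1) by (simp add: prime_nat_iff)
qed


definition auts :: "'a set \<Rightarrow> 'a rel \<Rightarrow> ('a \<Rightarrow> 'a) set" where
  "auts V R = {g. g permutes V \<and> (\<forall>u\<in>V. \<forall>v\<in>V. (u,v) \<in> R \<longleftrightarrow> (g u, g v) \<in> R)}"

definition aut_group :: "'a set \<Rightarrow> 'a rel \<Rightarrow> ('a \<Rightarrow> 'a) monoid" where
  "aut_group V R = \<lparr>carrier = auts V R, monoid.mult = (\<circ>), one = id\<rparr>"

lemma autsI:
  assumes fin: "finite V" and R: "R \<subseteq> V \<times> V" and g: "g permutes V"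
    and edge: "\<And>u v. (u,v) \<in> R \<Longrightarrow> (g u, g v) \<in> R"
  shows "g \<in> auts V R"
proof -
  have inj: "inj (map_prod g g)" using permutes_inj[OF g] by (simp add: prod.inj_map)
  have finR: "finite R" using fin R by (meson finite_SigmaI finite_subset)
  have "map_prod g g ` R = R"
    by (rule endo_inj_surj[OF finR]) (use edge inj_on_subset[OF inj] in auto)
  then have "(u,v) \<in> R" if "(g u, g v) \<in> R" for u v
    using that inj_image_mem_iff[OF inj, of "(u,v)" R] by (simp only: map_prod_simp)
  then show ?thesis unfolding auts_def using g edge by blast
qed

text \<open>The vertices and arcs are kept as plain sets, because the induction replaces both of them.\<close>

locale transitive_digraph =
  fixes V :: "'a set" and R :: "'a rel" and d :: nat
  assumes fin: "finite V" and RV: "R \<subseteq> V \<times> V" and irrefl: "(v,v) \<notin> R"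
    and vtrans: "u \<in> V \<Longrightarrow> v \<in> V \<Longrightarrow> \<exists>g\<in>auts V R. g u = v"
    and out_card: "v \<in> V \<Longrightarrow> card {w. (v,w) \<in> R} = d"
begin

abbreviation "A \<equiv> auts V R"

lemma edgeD: "(u,v) \<in> R \<Longrightarrow> u \<in> V" "(u,v) \<in> R \<Longrightarrow> v \<in> V"
  using RV by auto

lemma finR: "finite R"
  using fin RV by (meson finite_SigmaI finite_subset)

lemma A_permutes: "g \<in> A \<Longrightarrow> g permutes V"
  by (simp add: auts_def)

lemma A_inj: "g \<in> A \<Longrightarrow> g x = g y \<longleftrightarrow> x = y"
  using permutes_inj[OF A_permutes] by (auto dest: injD)

lemma A_V: "g \<in> A \<Longrightarrow> g x \<in> V \<longleftrightarrow> x \<in> V"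
  by (simp add: permutes_in_image[OF A_permutes])

lemma A_edge:
  assumes g: "g \<in> A"
  shows "(g u, g v) \<in> R \<longleftrightarrow> (u,v) \<in> R"
proof (cases "u \<in> V \<and> v \<in> V")
  case True
  then show ?thesis using g by (simp add: auts_def)
next
  case False
  then show ?thesis using edgeD[of u v] edgeD[of "g u" "g v"] A_V[OF g] by blast
qed

lemma A_id: "id \<in> A"
  by (simp add: auts_def permutes_id)

lemma A_comp: "g \<in> A \<Longrightarrow> h \<in> A \<Longrightarrow> g \<circ> h \<in> A"
  by (intro autsI[OF fin RV]) (simp_all add: A_edge permutes_compose[OF A_permutes A_permutes])

lemma A_inv: "g \<in> A \<Longrightarrow> Hilbert_Choice.inv g \<in> A"
proof (rule autsI[OF fin RV])
  assume g: "g \<in> A"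
  show "Hilbert_Choice.inv g permutes V" using A_permutes[OF g] by (rule permutes_inv)
  show "(Hilbert_Choice.inv g u, Hilbert_Choice.inv g v) \<in> R" if "(u,v) \<in> R" for u v
    using that A_edge[OF g, of "Hilbert_Choice.inv g u" "Hilbert_Choice.inv g v"]
    by (simp add: permutes_inverses(1)[OF A_permutes[OF g]])
qed

lemma A_inv_apply: "g \<in> A \<Longrightarrow> g (Hilbert_Choice.inv g x) = x" "g \<in> A \<Longrightarrow> Hilbert_Choice.inv g (g x) = x"
  using permutes_inverses[OF A_permutes] by auto

lemma A_funpow: "g \<in> A \<Longrightarrow> g ^^ k \<in> A"
  by (induction k) (auto simp: A_id A_comp simp del: id_apply)

lemma A_eq_id: "g \<in> A \<Longrightarrow> (\<And>v. v \<in> V \<Longrightarrow> g v = v) \<Longrightarrow> g = id"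
  using permutes_not_in[OF A_permutes] by (metis eq_id_iff)

lemma fin_A: "finite A"
  by (rule finite_subset[OF _ finite_permutations[OF fin]]) (auto simp: auts_def)

lemma group_aut_group: "group (aut_group V R)"
proof (rule groupI)
  fix g assume "g \<in> carrier (aut_group V R)"
  then show "\<exists>h\<in>carrier (aut_group V R). h \<otimes>\<^bsub>aut_group V R\<^esub> g = \<one>\<^bsub>aut_group V R\<^esub>"
    by (intro bexI[of _ "Hilbert_Choice.inv g"]) (auto simp: aut_group_def A_inv A_inv_apply fun_eq_iff)
qed (auto simp: aut_group_def A_id A_comp comp_assoc simp del: id_apply)

lemma aut_group_pow: "g [^]\<^bsub>aut_group V R\<^esub> (k::nat) = g ^^ k"
proof (induction k)
  case 0
  then show ?case by (simp add: group.is_monoid[OF group_aut_group] monoid.nat_pow_0) (simp add: aut_group_def)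
next
  case (Suc k)
  then show ?case
    by (simp add: group.is_monoid[OF group_aut_group] monoid.nat_pow_Suc funpow_Suc_right del: funpow.simps)
       (simp add: aut_group_def)
qed

lemma order_aut_group: "Coset.order (aut_group V R) = card A"
  by (simp add: Coset.order_def aut_group_def)

lemma ex_aut_prime_order:
  assumes p: "prime p" and dvd: "p dvd card A"
  shows "\<exists>g\<in>A. g \<noteq> id \<and> g ^^ p = id"
proof -
  interpret group "aut_group V R" by (rule group_aut_group)
  obtain m where m: "card A = p * m" using dvd by (auto elim: dvdE)
  have "finite (carrier (aut_group V R))" using fin_A by (simp add: aut_group_def)
  then obtain H where H: "subgroup H (aut_group V R)" "card H = p"
    using sylow_thm[OF p group_aut_group, of 1 m] m order_aut_group by auto
  have "\<not> H \<subseteq> {id}" using H(2) prime_gt_1_nat[OF p] card_mono[of "{id}" H] by auto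
  then obtain g where g: "g \<in> H" "g \<noteq> id" by auto
  have gA: "g \<in> A" using g subgroup.subset[OF H(1)] by (auto simp: aut_group_def)
  have "g [^]\<^bsub>(aut_group V R)\<lparr>carrier := H\<rparr>\<^esub> Coset.order ((aut_group V R)\<lparr>carrier := H\<rparr>) = \<one>\<^bsub>aut_group V R\<^esub>"
    using group.pow_order_eq_1[OF subgroup_imp_group[OF H(1)], of g] g by simp
  then have "g [^]\<^bsub>aut_group V R\<^esub> p = \<one>\<^bsub>aut_group V R\<^esub>"
    using H(2) nat_pow_consistent by (simp add: Coset.order_def)
  then have "g ^^ p = id" by (simp add: aut_group_pow) (simp add: aut_group_def)
  then show ?thesis using gA g by blast
qed

lemma A_rtrancl:
  assumes g: "g \<in> A" and uv: "(u,v) \<in> R\<^sup>*"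
  shows "(g u, g v) \<in> R\<^sup>*"
  using uv
proof (induction rule: rtrancl_induct)
  case (step v w)
  then show ?case using A_edge[OF g, of v w] by (meson rtrancl_into_rtrancl)
qed simp

lemma rtrancl_V: "(u,v) \<in> R\<^sup>* \<Longrightarrow> u \<in> V \<Longrightarrow> v \<in> V"
  by (induction rule: rtrancl_induct) (auto dest: edgeD)

lemma A_component: "g \<in> A \<Longrightarrow> g ` (R\<^sup>* `` {v}) = R\<^sup>* `` {g v}"
proof (intro equalityI subsetI)
  fix x assume g: "g \<in> A" and "x \<in> R\<^sup>* `` {g v}"
  then have "(Hilbert_Choice.inv g (g v), Hilbert_Choice.inv g x) \<in> R\<^sup>*"
    using A_rtrancl[OF A_inv[OF g]] by blast
  then show "x \<in> g ` (R\<^sup>* `` {v})" using A_inv_apply[OF g] by (metis ImageI image_eqI singletonI)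
qed (auto intro: A_rtrancl)

text \<open>
  All forward reachable sets have the same size, since automorphisms map them onto each other. So the
  inclusion of that of \<open>v\<close> in that of \<open>u\<close> is an equality.
\<close>

lemma rtrancl_sym:
  assumes u: "u \<in> V" and uv: "(u,v) \<in> R\<^sup>*"
  shows "(v,u) \<in> R\<^sup>*"
proof -
  have v: "v \<in> V" using rtrancl_V[OF uv u] .
  obtain g where g: "g \<in> A" "g u = v" using vtrans[OF u v] by blast
  have "card (R\<^sup>* `` {v}) = card (R\<^sup>* `` {u})"
    using A_component[OF g(1), of u] g A_inj by (metis card_image inj_onI)
  moreover have "R\<^sup>* `` {v} \<subseteq> R\<^sup>* `` {u}" using uv by (auto intro: rtrancl_trans)
  moreover have "finite (R\<^sup>* `` {u})"
    by (rule finite_subset[OF _ fin]) (use rtrancl_V u in auto)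
  ultimately have "R\<^sup>* `` {v} = R\<^sup>* `` {u}" by (simp add: card_subset_eq)
  then show ?thesis by auto
qed

lemma component_eq_iff:
  assumes "u \<in> V" "v \<in> V"
  shows "R\<^sup>* `` {u} = R\<^sup>* `` {v} \<longleftrightarrow> (u,v) \<in> R\<^sup>*"
  using assms rtrancl_sym by (auto intro: rtrancl_trans)

lemma component_transitive_digraph:
  assumes v0: "v0 \<in> V"
  defines "C \<equiv> R\<^sup>* `` {v0}"
  shows "transitive_digraph C (R \<inter> C \<times> C) d"
proof
  have CV: "C \<subseteq> V" using rtrancl_V v0 by (auto simp: C_def)
  show finC: "finite C" using CV fin by (rule finite_subset)
  show RC: "R \<inter> C \<times> C \<subseteq> C \<times> C" by blast
  show "(v,v) \<notin> R \<inter> C \<times> C" for v using irrefl by blast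
  have out: "{w. (v,w) \<in> R \<inter> C \<times> C} = {w. (v,w) \<in> R}" if "v \<in> C" for v
    using that by (auto simp: C_def intro: rtrancl_into_rtrancl)
  show "card {w. (v,w) \<in> R \<inter> C \<times> C} = d" if "v \<in> C" for v
    using out[OF that] out_card CV that by auto
  show "\<exists>g\<in>auts C (R \<inter> C \<times> C). g u = v" if u: "u \<in> C" and v: "v \<in> C" for u v
  proof -
    obtain g where g: "g \<in> A" "g u = v" using vtrans u v CV by blast
    have gC: "g ` C = C"
    proof -
      have "C = R\<^sup>* `` {u}" "C = R\<^sup>* `` {v}"
        using component_eq_iff[OF v0, of u] component_eq_iff[OF v0, of v] u v CV by (auto simp: C_def)
      then show ?thesis using A_component[OF g(1), of u] g(2) by simp
    qed
    define h where "h = (\<lambda>x. if x \<in> C then g x else x)"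
    have "h permutes C"
      by (rule permutes_if_inj_on[OF finC]) (use gC A_inj[OF g(1)] in \<open>auto simp: h_def inj_on_def\<close>)
    then have "h \<in> auts C (R \<inter> C \<times> C)"
      by (rule autsI[OF finC RC]) (use gC A_edge[OF g(1)] in \<open>auto simp: h_def\<close>)
    then show ?thesis using g u by (intro bexI[of _ h]) (auto simp: h_def)
  qed
qed

lemma free_aut_from_component:
  assumes v0: "v0 \<in> V"
  defines "C \<equiv> R\<^sup>* `` {v0}"
  assumes g: "g \<in> auts C (R \<inter> C \<times> C)" "g \<noteq> id" "free_on C g"
  shows "\<exists>f\<in>A. f \<noteq> id \<and> free_on V f"
proof -
  define c where "c = (\<lambda>v. R\<^sup>* `` {v})"
  have CV: "C \<subseteq> V" using rtrancl_V v0 by (auto simp: C_def)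
  have "\<exists>b. b \<in> A \<and> bij_betw b C {x \<in> V. c x = r}" if r: "r \<in> c ` V" for r
  proof -
    obtain v where v: "v \<in> V" "r = c v" using r by auto
    obtain b where b: "b \<in> A" "b v0 = v" using vtrans[OF v0 v(1)] by blast
    have "b ` C = r" using A_component[OF b(1), of v0] b(2) v(2) by (simp add: C_def c_def)
    also have "r = {x \<in> V. c x = r}"
    proof (rule Set.set_eqI)
      fix x
      show "x \<in> r \<longleftrightarrow> x \<in> {x \<in> V. c x = r}"
        using component_eq_iff[OF v(1), of x] rtrancl_V[of v x] v by (simp add: c_def eq_commute) blast
    qed
    finally show ?thesis using b(1) A_inj[OF b(1)]
      by (intro exI[of _ b]) (simp add: bij_betw_def inj_on_def)
  qed
  then obtain b where bA: "\<And>r. r \<in> c ` V \<Longrightarrow> b r \<in> A"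
    and bij: "\<And>r. r \<in> c ` V \<Longrightarrow> bij_betw (b r) C {x \<in> V. c x = r}" by metis
  have ne: "V \<noteq> {}" using v0 by auto
  obtain f where f: "free_on V f" "f \<noteq> id"
    and f3: "\<forall>r\<in>c ` V. \<forall>y\<in>C. f (b r y) = b r (g y)"
    using free_on_fibrewise[OF fin ne bij g(3,2)] by blast
  have "f \<in> A"
  proof (rule autsI[OF fin RV])
    show "f permutes V" using f(1) by (simp add: free_on_def)
    fix u v assume uv: "(u,v) \<in> R"
    then have uvV: "u \<in> V" "v \<in> V" by (auto dest: edgeD)
    define r where "r = c u"
    have r: "r \<in> c ` V" using uvV by (simp add: r_def)
    have "c v = r" using component_eq_iff[OF uvV] uv by (auto simp: c_def r_def)
    then have "u \<in> b r ` C" "v \<in> b r ` C" using bij[OF r] uvV by (auto simp: bij_betw_def r_def)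
    then obtain y y' where y: "y \<in> C" "u = b r y" "y' \<in> C" "v = b r y'" by auto
    then have "(y,y') \<in> R \<inter> C \<times> C" using A_edge[OF bA[OF r]] uv by simp
    then have "(g y, g y') \<in> R" using g(1) y by (auto simp: auts_def)
    then show "(f u, f v) \<in> R" 
      using f3[rule_format, OF r y(1)] f3[rule_format, OF r y(3)] y(2,4) A_edge[OF bA[OF r]] by simp
  qed
  then show ?thesis using f by blast
qed

text \<open>The relation \<open>T\<close> is the arc relation or its converse.\<close>

lemma fixed_points_propagate:
  assumes h: "h \<in> A" and u: "h u = u" "\<And>v. v \<in> V \<Longrightarrow> (u,v) \<in> T\<^sup>*"
    and step: "\<And>v w. h v = v \<Longrightarrow> (v,w) \<in> T \<Longrightarrow> h w = w"
  shows "h = id"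
proof (rule A_eq_id[OF h])
  fix v assume "v \<in> V"
  then have "(u,v) \<in> T\<^sup>*" by (rule u)
  then show "h v = v" by (induction rule: rtrancl_induct) (use u step in auto)
qed

end


section \<open>Connected digraphs of out-valency at most three\<close>

text \<open>
  The exponents of the powers of \<open>h\<close> that fix \<open>w\<close> are closed under greatest common
  divisors; if one of them were strictly
  between 0 and \<open>p\<close>, then \<open>h\<close> itself would fix \<open>w\<close>.
\<close>

lemma prime_period_inj_on:
  assumes p: "prime p" and inj: "inj h" and hp: "h ^^ p = id" and w: "h w \<noteq> w"
  shows "inj_on (\<lambda>i. (h ^^ i) w) {..<p}"
proof -
  have no: "(h ^^ k) w \<noteq> w" if k: "0 < k" "k < p" for k
  proof
    assume fix': "(h ^^ k) w = w"
    obtain e x y where e: "e dvd k" "e dvd p" "k * x = p * y + e"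
      using bezout_add_strong_nat[of k p] k by auto
    have "e \<noteq> p" using e(1) k by (auto dest: dvd_imp_le)
    then have "e = 1" using e(2) p by (auto simp: prime_nat_iff)
    have "(h ^^ (k * x)) w = w"
      by (induction x) (use fix' in \<open>auto simp: funpow_add\<close>)
    moreover have "h ^^ (p * y) = id"
      by (induction y) (use hp in \<open>auto simp: funpow_add\<close>)
    then have "(h ^^ (k * x)) w = h w" unfolding e(3) \<open>e = 1\<close> by (simp add: funpow_add)
    ultimately show False using w by simp
  qed
  have "False" if ij: "i < j" "j < p" "(h ^^ i) w = (h ^^ j) w" for i j
  proof -
    have "(h ^^ i) ((h ^^ (j - i)) w) = (h ^^ i) w"
      using ij by (metis comp_apply funpow_add le_add_diff_inverse less_imp_le)
    then have "(h ^^ (j - i)) w = w" by (rule injD[OF inj_fn[OF inj]])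
    then show False using no[of "j - i"] ij by simp
  qed
  then show ?thesis by (intro inj_onI) (metis lessThan_iff nat_neq_iff)
qed

locale connected_transitive_digraph = transitive_digraph +
  assumes connected: "u \<in> V \<Longrightarrow> v \<in> V \<Longrightarrow> (u,v) \<in> R\<^sup>*"
    and card_V: "card V \<ge> 2"
begin

text \<open>Together with vertex-transitivity this is transitivity on arcs.\<close>

definition arc_transitive :: bool where
  "arc_transitive \<longleftrightarrow> (\<forall>v x y. (v,x) \<in> R \<longrightarrow> (v,y) \<in> R \<longrightarrow> (\<exists>g\<in>A. g v = v \<and> g x = y))"

lemma fin_out: "finite {w. (v,w) \<in> R}"
  by (rule finite_subset[OF _ fin]) (auto dest: edgeD)

lemma free_onI:
  assumes "g \<in> A" "\<And>k v. v \<in> V \<Longrightarrow> (g ^^ k) v = v \<Longrightarrow> g ^^ k = id"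
  shows "free_on V g"
  using assms A_permutes unfolding free_on_def by blast

lemma arc_transitiveI:
  assumes v: "v \<in> V"
    and local: "\<And>x y. (v,x) \<in> R \<Longrightarrow> (v,y) \<in> R \<Longrightarrow> \<exists>g\<in>A. g v = v \<and> g x = y"
  shows arc_transitive
  unfolding arc_transitive_def
proof (intro allI impI)
  fix u x y assume ux: "(u,x) \<in> R" and uy: "(u,y) \<in> R"
  obtain a where a: "a \<in> A" "a u = v" using vtrans[OF edgeD(1)[OF ux] v] by blast
  have "(v, a x) \<in> R" "(v, a y) \<in> R" using A_edge[OF a(1), of u] ux uy a(2) by auto
  then obtain g where g: "g \<in> A" "g v = v" "g (a x) = a y" using local by blast
  have "Hilbert_Choice.inv a \<circ> g \<circ> a \<in> A" using A_comp A_inv a(1) g(1) by blast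
  moreover have "(Hilbert_Choice.inv a \<circ> g \<circ> a) u = u"
    using a g A_inv_apply(2)[OF a(1), of u] by simp
  moreover have "(Hilbert_Choice.inv a \<circ> g \<circ> a) x = y" using g A_inv_apply(2)[OF a(1)] by simp
  ultimately show "\<exists>g\<in>A. g u = u \<and> g x = y" by blast
qed

text \<open>
  If \<open>h\<close> fixes \<open>v\<close> and moves an out-neighbour of \<open>v\<close>, it moves \<open>p\<close> of them in a cycle. As there are at most
  three, they are then all the out-neighbours, and the powers of \<open>h\<close> are transitive on them.
\<close>

lemma odd_prime_period_fixed_point:
  assumes d: "d \<le> 3" and p: "prime p" "p \<noteq> 2" and exc: "\<not> (p = 3 \<and> d = 3 \<and> arc_transitive)"
    and h: "h \<in> A" "h ^^ p = id" and u: "u \<in> V" "h u = u"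
  shows "h = id"
proof (rule fixed_points_propagate[OF h(1) u(2) connected[OF u(1)]])
  fix v w assume v: "h v = v" and vw: "(v,w) \<in> R"
  show "h w = w"
  proof (rule ccontr)
    assume w: "h w \<noteq> w"
    have vV: "v \<in> V" using edgeD(1)[OF vw] .
    let ?O = "{x. (v,x) \<in> R}" and ?I = "(\<lambda>i. (h ^^ i) w) ` {..<p}"
    have inj: "inj h" using permutes_inj[OF A_permutes[OF h(1)]] .
    have hv: "(h ^^ i) v = v" for i by (induction i) (use v in auto)
    have sub: "?I \<subseteq> ?O"
    proof
      fix x assume "x \<in> ?I"
      then obtain i where "x = (h ^^ i) w" by auto
      then show "x \<in> ?O" using A_edge[OF A_funpow[OF h(1)], of i v w] vw hv by simp
    qed
    have card_I: "card ?I = p"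
      using card_image[OF prime_period_inj_on[OF p(1) inj h(2) w]] by simp
    have card_O: "card ?O = d" by (rule out_card[OF vV])
    have "p \<le> d" using card_mono[OF fin_out sub] card_I card_O by simp
    moreover have "p \<ge> 3" using p prime_ge_2_nat[OF p(1)] by linarith
    ultimately have pd: "p = 3" "d = 3" using d by auto
    then have IO: "?I = ?O" by (intro card_subset_eq[OF fin_out sub]) (use card_I card_O in auto)
    have arc_transitive
    proof (rule arc_transitiveI[OF vV])
      fix x y assume "(v,x) \<in> R" "(v,y) \<in> R"
      then have "x \<in> ?I" "y \<in> ?I" using IO by auto
      then obtain i j where i: "i < p" "x = (h ^^ i) w" and j: "y = (h ^^ j) w" by auto
      have "(h ^^ (j + (p - i))) x = (h ^^ (j + p)) w"
        using i by (simp flip: comp_apply[of "h ^^ _" "h ^^ _"] funpow_add)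
      also have "\<dots> = y" using h(2) j by (simp add: funpow_add)
      finally show "\<exists>g\<in>A. g v = v \<and> g x = y" using A_funpow[OF h(1)] hv by blast
    qed
    then show False using exc pd by simp
  qed
qed

lemma free_aut_if_prime_dvd:
  assumes d: "d \<le> 3" and p: "prime p" "p \<noteq> 2" and exc: "\<not> (p = 3 \<and> d = 3 \<and> arc_transitive)"
    and dvd: "p dvd card A"
  shows "\<exists>g\<in>A. g \<noteq> id \<and> free_on V g"
proof -
  obtain g where g: "g \<in> A" "g \<noteq> id" "g ^^ p = id" using ex_aut_prime_order[OF p(1) dvd] by blast
  have "free_on V g"
  proof (rule free_onI[OF g(1)])
    fix k v assume v: "v \<in> V" "(g ^^ k) v = v"
    have "(g ^^ k) ^^ p = id" using g(3) by (metis funpow_mult mult.commute id_funpow)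
    then show "g ^^ k = id" by (rule odd_prime_period_fixed_point[OF d p exc A_funpow[OF g(1)] _ v])
  qed
  then show ?thesis using g by blast
qed

lemma card_A_nontrivial: "card A \<noteq> 1"
proof
  assume "card A = 1"
  then obtain a where a: "A = {a}" by (auto simp: card_1_singleton_iff)
  obtain u v where "u \<in> V" "v \<in> V" "u \<noteq> v"
    using card_V by (metis card_le_Suc0_iff_eq fin not_less_eq_eq numeral_2_eq_2)
  then obtain g where "g \<in> A" "g u = v" using vtrans by blast
  then show False using a A_id \<open>u \<noteq> v\<close> by auto
qed

text \<open>
  If only the prime 2 divides the order of the automorphism group, it has a nontrivial center, and a
  central automorphism that fixes one vertex fixes them all by transitivity.
\<close>

lemma free_aut_if_not_arc_transitive:
  assumes d: "d \<le> 3" and exc: "\<not> (d = 3 \<and> arc_transitive)"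
  shows "\<exists>g\<in>A. g \<noteq> id \<and> free_on V g"
proof (cases "\<exists>p. prime p \<and> p \<noteq> 2 \<and> p dvd card A")
  case True
  then show ?thesis using free_aut_if_prime_dvd[OF d] exc by blast
next
  case False
  interpret group "aut_group V R" by (rule group_aut_group)
  have "card A > 0" using fin_A A_id by (auto simp: card_gt_0_iff)
  then obtain k where k: "card A = 2 ^ k"
    using prime_power_if_only_prime_divisor[OF _ two_is_prime_nat] False by blast
  obtain z where z: "z \<in> A" "z \<noteq> id" "\<And>g. g \<in> A \<Longrightarrow> g \<circ> z = z \<circ> g"
    using prime_power_center_nontrivial[OF two_is_prime_nat, of k] k card_A_nontrivial
    unfolding order_aut_group by (auto simp: aut_group_def)
  have "free_on V z"
  proof (rule free_onI[OF z(1)])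
    fix k v assume v: "v \<in> V" "(z ^^ k) v = v"
    have comm: "g \<circ> z ^^ k = z ^^ k \<circ> g" if "g \<in> A" for g
    proof (induction k)
      case (Suc k)
      have "g \<circ> z ^^ Suc k = (g \<circ> z) \<circ> z ^^ k" by (simp add: comp_assoc)
      also have "\<dots> = z \<circ> (g \<circ> z ^^ k)" by (simp add: z(3)[OF that] comp_assoc)
      also have "\<dots> = z ^^ Suc k \<circ> g" by (simp only: Suc.IH funpow.simps comp_assoc)
      finally show ?case .
    qed simp
    show "z ^^ k = id"
    proof (rule A_eq_id[OF A_funpow[OF z(1)]])
      fix u assume "u \<in> V"
      then obtain g where g: "g \<in> A" "g v = u" using vtrans[OF v(1)] by blast
      have "(z ^^ k) (g v) = g ((z ^^ k) v)" using fun_cong[OF comm[OF g(1)], of v] by simp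
      then show "(z ^^ k) u = u" using v(2) g(2) by simp
    qed
  qed
  then show ?thesis using z by blast
qed

text \<open>Counting the arcs by their heads and by their tails.\<close>

lemma in_card: "v \<in> V \<Longrightarrow> card {u. (u,v) \<in> R} = d"
proof -
  assume v: "v \<in> V"
  have const: "card {u. (u,w) \<in> R} = card {u. (u,v) \<in> R}" if w: "w \<in> V" for w
  proof -
    obtain g where g: "g \<in> A" "g v = w" using vtrans[OF v w] by blast
    have "bij_betw g {u. (u,v) \<in> R} {u. (u,w) \<in> R}"
      unfolding bij_betw_def
    proof
      show "inj_on g {u. (u,v) \<in> R}" using A_inj[OF g(1)] by (simp add: inj_on_def)
      show "g ` {u. (u,v) \<in> R} = {u. (u,w) \<in> R}"
      proof
        show "g ` {u. (u,v) \<in> R} \<subseteq> {u. (u,w) \<in> R}" using A_edge[OF g(1), of _ v] g(2) by auto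
        show "{u. (u,w) \<in> R} \<subseteq> g ` {u. (u,v) \<in> R}"
        proof
          fix u assume "u \<in> {u. (u,w) \<in> R}"
          then have "(Hilbert_Choice.inv g u, v) \<in> R"
            using A_edge[OF g(1), of "Hilbert_Choice.inv g u" v] A_inv_apply(1)[OF g(1)] g(2) by simp
          then show "u \<in> g ` {u. (u,v) \<in> R}" using A_inv_apply(1)[OF g(1), of u] by (metis imageI mem_Collect_eq)
        qed
      qed
    qed
    then show ?thesis by (simp add: bij_betw_same_card)
  qed
  have "R = Sigma V (\<lambda>v. {w. (v,w) \<in> R})" using edgeD by auto
  then have "card R = (\<Sum>u\<in>V. card {w. (u,w) \<in> R})"
    using card_SigmaI[OF fin, of "\<lambda>v. {w. (v,w) \<in> R}"] fin_out by metis
  then have 1: "card R = card V * d" using out_card by simp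
  have fin_in: "finite {u. (u,w) \<in> R}" for w by (rule finite_subset[OF _ fin]) (auto dest: edgeD)
  have "R\<inverse> = Sigma V (\<lambda>v. {w. (w,v) \<in> R})" using edgeD by auto
  then have "card (R\<inverse>) = (\<Sum>u\<in>V. card {w. (w,u) \<in> R})"
    using card_SigmaI[OF fin, of "\<lambda>v. {w. (w,v) \<in> R}"] fin_in by metis
  also have "\<dots> = card V * card {u. (u,v) \<in> R}" using const by simp
  finally have "card V * d = card V * card {u. (u,v) \<in> R}" using 1 by (simp add: card_inverse)
  then show ?thesis using card_V by simp
qed

lemma in_arc_transitive:
  assumes arc_transitive "(x,v) \<in> R" "(y,v) \<in> R"
  shows "\<exists>g\<in>A. g v = v \<and> g x = y"
proof -
  obtain a where a: "a \<in> A" "a x = y" using vtrans edgeD assms by blast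
  have "(y, a v) \<in> R" using A_edge[OF a(1), of x v] a(2) assms(2) by simp
  then obtain b where b: "b \<in> A" "b y = y" "b (a v) = v" using assms(1,3) unfolding arc_transitive_def by blast
  have "b \<circ> a \<in> A" by (rule A_comp[OF b(1) a(1)])
  then show ?thesis using a b by (intro bexI[of _ "b \<circ> a"]) auto
qed

text \<open>As in \<open>arc_transitive\<close>, but for a subset \<open>D\<close> of the automorphisms and for the arcs or the reversed arcs \<open>T\<close>.\<close>

definition neighbourhood_transitive :: "('a \<Rightarrow> 'a) set \<Rightarrow> 'a rel \<Rightarrow> bool" where
  "neighbourhood_transitive D T \<longleftrightarrow> (\<forall>v x y. (v,x) \<in> T \<longrightarrow> (v,y) \<in> T \<longrightarrow> (\<exists>h\<in>D. h v = v \<and> h x = y))"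

text \<open>
  The stabilizer in the normal subgroup \<open>D\<close> of a vertex \<open>v\<close> is normal in the full stabilizer of \<open>v\<close>. As
  the latter is transitive on the neighbours of \<open>v\<close>, whose number is prime, the orbits of the former are
  singletons or everything. If they are always singletons, fixed points propagate.
\<close>

lemma normal_subgroup_free_or_transitive:
  assumes D: "D \<subseteq> A" "id \<in> D" "\<And>g h. g \<in> D \<Longrightarrow> h \<in> D \<Longrightarrow> g \<circ> h \<in> D"
    "\<And>g. g \<in> D \<Longrightarrow> Hilbert_Choice.inv g \<in> D"
    "\<And>g h. g \<in> A \<Longrightarrow> h \<in> D \<Longrightarrow> g \<circ> h \<circ> Hilbert_Choice.inv g \<in> D"
    and T: "\<And>g u v. g \<in> A \<Longrightarrow> (g u, g v) \<in> T \<longleftrightarrow> (u,v) \<in> T" "T \<subseteq> V \<times> V"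
    and conn: "\<And>u v. u \<in> V \<Longrightarrow> v \<in> V \<Longrightarrow> (u,v) \<in> T\<^sup>*"
    and card: "\<And>v. v \<in> V \<Longrightarrow> prime (card {w. (v,w) \<in> T})"
    and trans: "\<And>v x y. (v,x) \<in> T \<Longrightarrow> (v,y) \<in> T \<Longrightarrow> \<exists>g\<in>A. g v = v \<and> g x = y"
  shows "neighbourhood_transitive D T \<or> (\<forall>h\<in>D. \<forall>v\<in>V. h v = v \<longrightarrow> h = id)"
proof (rule disjCI)
  assume "\<not> (\<forall>h\<in>D. \<forall>v\<in>V. h v = v \<longrightarrow> h = id)"
  then obtain h0 v0 where h0: "h0 \<in> D" "v0 \<in> V" "h0 v0 = v0" "h0 \<noteq> id" by blast
  have "\<exists>v w. h0 v = v \<and> (v,w) \<in> T \<and> h0 w \<noteq> w"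
  proof (rule ccontr)
    assume no: "\<not> ?thesis"
    have "h0 = id"
    proof (rule fixed_points_propagate[where T = T and u = v0])
      show "h0 \<in> A" using h0(1) D(1) by blast
      show "h0 w = w" if "h0 v = v" "(v,w) \<in> T" for v w using no that by blast
    qed (use h0(3) conn[OF h0(2)] in auto)
    then show False using h0(4) by simp
  qed
  then obtain v1 w1 where w1: "h0 v1 = v1" "(v1,w1) \<in> T" "h0 w1 \<noteq> w1" by blast
  have v1: "v1 \<in> V" using w1(2) T(2) by blast
  let ?X = "{w. (v1,w) \<in> T}"
  define P where "P = (\<lambda>x y. \<exists>h\<in>D. h v1 = v1 \<and> h x = y)"
  have Prefl: "P x x" for x using D(2) unfolding P_def by (intro bexI[of _ id]) auto
  have Psym: "P y x" if Pxy: "P x y" for x y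
  proof -
    obtain h where h: "h \<in> D" "h v1 = v1" "h x = y" using Pxy unfolding P_def by blast
    have hA: "h \<in> A" using h D(1) by blast
    show ?thesis unfolding P_def
      using D(4)[OF h(1)] A_inv_apply(2)[OF hA, of v1] A_inv_apply(2)[OF hA, of x] h
      by (intro bexI[of _ "Hilbert_Choice.inv h"]) auto
  qed
  have Ptrans: "P x z" if xy: "P x y" and yz: "P y z" for x y z
  proof -
    obtain h where h: "h \<in> D" "h v1 = v1" "h x = y" using xy unfolding P_def by blast
    obtain h' where h': "h' \<in> D" "h' v1 = v1" "h' y = z" using yz unfolding P_def by blast
    show ?thesis unfolding P_def using D(3)[OF h'(1) h(1)] h h' by (intro bexI[of _ "h' \<circ> h"]) auto
  qed
  \<comment> \<open>The orbits of the stabilizer of \<open>v1\<close> in \<open>D\<close> on the neighbours of \<open>v1\<close>.\<close>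
  define cls where "cls = (\<lambda>x. {y \<in> ?X. P x y})"
  have cls_eq: "cls y = cls x \<longleftrightarrow> P x y" if "y \<in> ?X" for x y
  proof
    assume "cls y = cls x"
    moreover have "y \<in> cls y" using that Prefl by (simp add: cls_def)
    ultimately show "P x y" by (simp add: cls_def)
  next
    assume "P x y"
    then show "cls y = cls x" unfolding cls_def using Psym Ptrans by blast
  qed
  have fib: "{y \<in> ?X. cls y = cls x} = cls x" for x
    using cls_eq by (auto simp: cls_def)
  have card_cls: "card (cls x) = card (cls w1)" if x: "x \<in> ?X" for x
  proof -
    obtain a where a: "a \<in> A" "a v1 = v1" "a w1 = x" using trans[OF w1(2)] x by blast
    have aT: "a y \<in> ?X \<longleftrightarrow> y \<in> ?X" for y using T(1)[OF a(1), of v1 y] a(2) by simp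
    have aP: "P (a y) (a y')" if Pyy: "P y y'" for y y'
    proof -
      obtain h where h: "h \<in> D" "h v1 = v1" "h y = y'" using Pyy unfolding P_def by blast
      show ?thesis unfolding P_def
        using D(5)[OF a(1) h(1)] h a(2) A_inv_apply(2)[OF a(1), of v1] A_inv_apply(2)[OF a(1), of y]
        by (intro bexI[of _ "a \<circ> h \<circ> Hilbert_Choice.inv a"]) auto
    qed
    have aP': "P y y'" if Pa: "P (a y) (a y')" for y y'
    proof -
      obtain h where h: "h \<in> D" "h v1 = v1" "h (a y) = a y'" using Pa unfolding P_def by blast
      have ii: "Hilbert_Choice.inv (Hilbert_Choice.inv a) = a"
        using permutes_inv_inv[OF A_permutes[OF a(1)]] .
      have "Hilbert_Choice.inv a \<circ> h \<circ> a \<in> D" using D(5)[OF A_inv[OF a(1)] h(1)] ii by simp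
      then show ?thesis unfolding P_def
        using h a(2) A_inv_apply(2)[OF a(1), of v1] A_inv_apply(2)[OF a(1), of y']
        by (intro bexI[of _ "Hilbert_Choice.inv a \<circ> h \<circ> a"]) auto
    qed
    have "bij_betw a (cls w1) (cls x)"
      unfolding bij_betw_def
    proof
      show "inj_on a (cls w1)" using A_inj[OF a(1)] by (simp add: inj_on_def)
      show "a ` cls w1 = cls x"
      proof
        show "a ` cls w1 \<subseteq> cls x" using aT aP[of w1] a(3) by (auto simp: cls_def)
        show "cls x \<subseteq> a ` cls w1"
        proof
          fix y assume y: "y \<in> cls x"
          have ay: "a (Hilbert_Choice.inv a y) = y" by (rule A_inv_apply(1)[OF a(1)])
          have "Hilbert_Choice.inv a y \<in> cls w1"
            using y aT[of "Hilbert_Choice.inv a y"] aP'[of w1 "Hilbert_Choice.inv a y"] a(3) ay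
            by (simp add: cls_def)
          then show "y \<in> a ` cls w1" using ay by (metis imageI)
        qed
      qed
    qed
    then show ?thesis by (simp add: bij_betw_same_card)
  qed
  have "card (cls w1) = 1 \<or> card (cls w1) = card ?X"
    by (rule prime_equal_fibres[OF card[OF v1], of cls]) (use fib card_cls in simp)
  moreover have "card (cls w1) \<noteq> 1"
  proof
    assume "card (cls w1) = 1"
    then obtain y where y: "cls w1 = {y}" by (auto simp: card_1_singleton_iff)
    have "w1 \<in> cls w1" using w1(2) Prefl by (simp add: cls_def)
    moreover have "h0 w1 \<in> cls w1"
      using T(1)[of h0 v1 w1] w1 h0(1) D(1) by (auto simp: cls_def P_def)
    ultimately show False using y w1(3) by simp
  qed
  moreover have "finite ?X" using card[OF v1] by (metis card.infinite not_prime_0)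
  ultimately have "cls w1 = ?X" by (intro card_subset_eq) (auto simp: cls_def)
  then have all: "P w1 x" if "(v1,x) \<in> T" for x using that by (auto simp: cls_def)
  show "neighbourhood_transitive D T"
    unfolding neighbourhood_transitive_def
  proof (intro allI impI)
    fix v x y assume vx: "(v,x) \<in> T" and vy: "(v,y) \<in> T"
    have "v \<in> V" using vx T(2) by blast
    then obtain a where a: "a \<in> A" "a v1 = v" using vtrans[OF v1] by blast
    let ?i = "Hilbert_Choice.inv a"
    have ai: "a (?i z) = z" for z by (rule A_inv_apply(1)[OF a(1)])
    have iv: "?i v = v1" using A_inv_apply(2)[OF a(1), of v1] a(2) by simp
    have "(v1, ?i x) \<in> T" "(v1, ?i y) \<in> T" using T(1)[OF A_inv[OF a(1)], of v] vx vy iv by auto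
    then have "P (?i x) (?i y)" using all Psym Ptrans by blast
    then obtain h where h: "h \<in> D" "h v1 = v1" "h (?i x) = ?i y" unfolding P_def by blast
    show "\<exists>h\<in>D. h v = v \<and> h x = y"
      using D(5)[OF a(1) h(1)] h iv ai a(2) by (intro bexI[of _ "a \<circ> h \<circ> ?i"]) auto
  qed
qed

text \<open>
  Let \<open>D\<close> be a nontrivial abelian normal subgroup that is transitive on both kinds of neighbourhoods. If
  \<open>w\<close> is an out-neighbour of \<open>u\<close> and of \<open>v\<close>, some \<open>g\<close> in \<open>D\<close> fixes \<open>w\<close> and takes \<open>u\<close> to \<open>v\<close>. It commutes with
  the stabilizer of \<open>u\<close> in \<open>D\<close>, so it fixes all images of \<open>w\<close> under that stabilizer, which are the
  out-neighbours of \<open>u\<close>. Hence these are also out-neighbours of \<open>v\<close>.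
\<close>

lemma free_aut_or_equal_out_neighbourhoods:
  assumes d: "d = 3" and arc: arc_transitive
  shows "(\<exists>g\<in>A. g \<noteq> id \<and> free_on V g) \<or>
    (\<forall>u v w. (u,w) \<in> R \<longrightarrow> (v,w) \<in> R \<longrightarrow> {x. (u,x) \<in> R} = {x. (v,x) \<in> R})"
proof (cases "\<exists>p. prime p \<and> p \<noteq> 2 \<and> p \<noteq> 3 \<and> p dvd card A")
  case True
  then show ?thesis using free_aut_if_prime_dvd d by (metis order_refl)
next
  case False
  interpret group "aut_group V R" by (rule group_aut_group)
  have "carrier (aut_group V R) \<noteq> {\<one>\<^bsub>aut_group V R\<^esub>}"
    using card_A_nontrivial by (auto simp: aut_group_def)
  moreover have "solvable (aut_group V R)"
  proof (rule solvable_if_order_two_prime[of 3])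
    show "finite (carrier (aut_group V R))" using fin_A by (simp add: aut_group_def)
    show "p = 2 \<or> p = 3" if "prime p" "p dvd Coset.order (aut_group V R)" for p
      using False that by (auto simp: order_aut_group)
  qed simp
  ultimately obtain D where D: "D \<lhd> aut_group V R" "D \<noteq> {\<one>\<^bsub>aut_group V R\<^esub>}"
    "\<forall>x\<in>D. \<forall>y\<in>D. x \<otimes>\<^bsub>aut_group V R\<^esub> y = y \<otimes>\<^bsub>aut_group V R\<^esub> x"
    using solvable_ex_abelian_normal by blast
  have inv_eq: "inv\<^bsub>aut_group V R\<^esub> g = Hilbert_Choice.inv g" if "g \<in> A" for g
    by (rule inv_equality) (use that A_inv A_inv_apply in \<open>auto simp: aut_group_def fun_eq_iff\<close>)
  have subD: "subgroup D (aut_group V R)" using D(1) by (rule normal_imp_subgroup)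
  have DA: "D \<subseteq> A" using subgroup.subset[OF subD] by (simp add: aut_group_def)
  have D_id: "id \<in> D" using subgroup.one_closed[OF subD] by (simp add: aut_group_def)
  have D_comp: "g \<circ> h \<in> D" if "g \<in> D" "h \<in> D" for g h
    using subgroup.m_closed[OF subD that] by (simp add: aut_group_def)
  have D_inv: "Hilbert_Choice.inv g \<in> D" if "g \<in> D" for g
    using subgroup.m_inv_closed[OF subD that] inv_eq that DA by auto
  have D_conj: "g \<circ> h \<circ> Hilbert_Choice.inv g \<in> D" if "g \<in> A" "h \<in> D" for g h
  proof -
    have "g \<otimes>\<^bsub>aut_group V R\<^esub> h \<otimes>\<^bsub>aut_group V R\<^esub> inv\<^bsub>aut_group V R\<^esub> g \<in> D"
      using D(1) that unfolding normal_inv_iff by (simp add: aut_group_def)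
    then show ?thesis unfolding inv_eq[OF that(1)] by (simp add: aut_group_def)
  qed
  have D_comm: "g (h x) = h (g x)" if "g \<in> D" "h \<in> D" for g h x
  proof -
    have "g \<circ> h = h \<circ> g" using D(3) that by (auto simp: aut_group_def)
    then show ?thesis by (metis comp_apply)
  qed
  obtain g0 where g0: "g0 \<in> D" "g0 \<noteq> id" using D(2) D_id by (auto simp: aut_group_def)
  have free: ?thesis if fixfree: "\<forall>h\<in>D. \<forall>v\<in>V. h v = v \<longrightarrow> h = id"
  proof -
    have "g0 ^^ k \<in> D" for k by (induction k) (simp_all only: funpow.simps D_id D_comp g0(1))
    then have "free_on V g0" using fixfree g0 DA by (intro free_onI) blast+
    then show ?thesis using g0 DA by blast
  qed
  have p3: "prime (3::nat)" by simp
  have "neighbourhood_transitive D R \<or> (\<forall>h\<in>D. \<forall>v\<in>V. h v = v \<longrightarrow> h = id)"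
    by (rule normal_subgroup_free_or_transitive[OF DA D_id D_comp D_inv D_conj A_edge RV connected])
       (use out_card d arc in \<open>auto simp: arc_transitive_def\<close>)
  moreover have "neighbourhood_transitive D (R\<inverse>) \<or> (\<forall>h\<in>D. \<forall>v\<in>V. h v = v \<longrightarrow> h = id)"
  proof (rule normal_subgroup_free_or_transitive[OF DA D_id D_comp D_inv D_conj])
    show "(u,v) \<in> (R\<inverse>)\<^sup>*" if "u \<in> V" "v \<in> V" for u v
      using connected[OF that(2,1)] by (simp add: rtrancl_converse)
    show "prime (card {w. (v,w) \<in> R\<inverse>})" if "v \<in> V" for v using in_card[OF that] d by simp
    show "\<exists>g\<in>A. g v = v \<and> g x = y" if "(v,x) \<in> R\<inverse>" "(v,y) \<in> R\<inverse>" for v x y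
      using in_arc_transitive[OF arc] that by simp
  qed (use RV A_edge in auto)
  ultimately consider "\<forall>h\<in>D. \<forall>v\<in>V. h v = v \<longrightarrow> h = id"
    | "neighbourhood_transitive D R" "neighbourhood_transitive D (R\<inverse>)" by blast
  then show ?thesis
  proof cases
    case 1
    then show ?thesis by (rule free)
  next
    case 2
    have sub: "{x. (u,x) \<in> R} \<subseteq> {x. (v,x) \<in> R}" if uw: "(u,w) \<in> R" and vw: "(v,w) \<in> R" for u v w
    proof
      fix x assume "x \<in> {x. (u,x) \<in> R}"
      then obtain h where h: "h \<in> D" "h u = u" "h w = x"
        using 2(1) uw unfolding neighbourhood_transitive_def by blast
      obtain g where g: "g \<in> D" "g w = w" "g u = v"
        using 2(2) uw vw unfolding neighbourhood_transitive_def by blast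
      have "g x = x" using D_comm[OF g(1) h(1), of w] g h by simp
      moreover have "(g u, g x) \<in> R" using A_edge[of g u x] g(1) DA \<open>x \<in> {x. (u,x) \<in> R}\<close> by blast
      ultimately show "x \<in> {x. (v,x) \<in> R}" using g(3) by simp
    qed
    then show ?thesis by blast
  qed
qed

end


section \<open>Line digraphs and the induction\<close>

text \<open>
  Digraphs in which any two out-neighbourhoods are equal or disjoint are line digraphs of
  multidigraphs.
\<close>

locale line_transitive_digraph = connected_transitive_digraph +
  assumes prime_d: "prime d"
    and common_in_neighbour:
      "\<And>u v w. (u,w) \<in> R \<Longrightarrow> (v,w) \<in> R \<Longrightarrow> {x. (u,x) \<in> R} = {x. (v,x) \<in> R}"
begin

text \<open>
  The base multidigraph has one vertex for each class of vertices with equal out-neighbourhoods. The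
  class is represented by one of its members, so that the base lives on the same type and the
  induction applies to it. A vertex \<open>v\<close> is the arc of the base with head \<open>rep v\<close> and tail \<open>src v\<close>.
\<close>

definition rep :: "'a \<Rightarrow> 'a" where
  "rep u = (SOME u'. u' \<in> V \<and> {x. (u',x) \<in> R} = {x. (u,x) \<in> R})"

definition src :: "'a \<Rightarrow> 'a" where
  "src v = rep (SOME u. (u,v) \<in> R)"

lemma d_pos: "d > 0"
  using prime_d by (rule prime_gt_0_nat)

lemma ex_out: "v \<in> V \<Longrightarrow> \<exists>w. (v,w) \<in> R"
  using out_card[of v] d_pos card_gt_0_iff[of "{w. (v,w) \<in> R}"] by auto

lemma ex_in: "v \<in> V \<Longrightarrow> \<exists>u. (u,v) \<in> R"
  using in_card[of v] d_pos card_gt_0_iff[of "{u. (u,v) \<in> R}"] by auto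

lemma rep_props:
  assumes "u \<in> V"
  shows rep_V: "rep u \<in> V" and rep_out: "{x. (rep u,x) \<in> R} = {x. (u,x) \<in> R}"
  using someI[of "\<lambda>u'. u' \<in> V \<and> {x. (u',x) \<in> R} = {x. (u,x) \<in> R}" u] assms unfolding rep_def by blast+

lemma rep_eq_iff:
  assumes "u \<in> V" "u' \<in> V"
  shows "rep u = rep u' \<longleftrightarrow> {x. (u,x) \<in> R} = {x. (u',x) \<in> R}"
proof
  assume "rep u = rep u'"
  then show "{x. (u,x) \<in> R} = {x. (u',x) \<in> R}" using rep_out[OF assms(1)] rep_out[OF assms(2)] by simp
next
  assume "{x. (u,x) \<in> R} = {x. (u',x) \<in> R}"
  then show "rep u = rep u'" unfolding rep_def by simp
qed

lemma rep_rep: "u \<in> V \<Longrightarrow> rep (rep u) = rep u"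
  using rep_eq_iff[OF rep_V, of u u] rep_out by simp

lemma src_eq_rep: "(u,v) \<in> R \<Longrightarrow> src v = rep u"
proof -
  assume uv: "(u,v) \<in> R"
  define u' where "u' = (SOME u. (u,v) \<in> R)"
  have u': "(u',v) \<in> R" unfolding u'_def using uv by (rule someI)
  have "rep u' = rep u" using rep_eq_iff edgeD(1)[OF uv] edgeD(1)[OF u'] common_in_neighbour[OF u' uv] by simp
  then show ?thesis by (simp add: src_def u'_def)
qed

text \<open>The line digraph structure: arcs of the digraph are pairs of consecutive arcs of the base.\<close>

lemma edge_iff:
  assumes u: "u \<in> V" and v: "v \<in> V"
  shows "(u,v) \<in> R \<longleftrightarrow> rep u = src v"
proof
  assume "rep u = src v"
  moreover obtain u' where u': "(u',v) \<in> R" using ex_in[OF v] by blast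
  ultimately have "{x. (u,x) \<in> R} = {x. (u',x) \<in> R}"
    using src_eq_rep[OF u'] rep_eq_iff[OF u edgeD(1)[OF u']] by simp
  then show "(u,v) \<in> R" using u' by blast
qed (simp add: src_eq_rep)

lemma src_rep:
  assumes "v \<in> V"
  shows "\<exists>u\<in>V. src v = rep u \<and> (u,v) \<in> R"
proof -
  obtain u where u: "(u,v) \<in> R" using ex_in[OF assms] by blast
  show ?thesis using u edgeD(1)[OF u] src_eq_rep[OF u] by (intro bexI[of _ u] conjI)
qed

lemma card_rep_fibre:
  assumes v: "v \<in> V"
  shows "card {u \<in> V. rep u = rep v} = d"
proof -
  obtain w where w: "(v,w) \<in> R" using ex_out[OF v] by blast
  have "{u \<in> V. rep u = rep v} = {u. (u,w) \<in> R}"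
    using edge_iff[OF _ edgeD(2)[OF w]] edgeD(1) src_eq_rep[OF w] by auto
  then show ?thesis using in_card[OF edgeD(2)[OF w]] by simp
qed

lemma src_fibre:
  assumes uv: "(u,v) \<in> R"
  shows "{w \<in> V. src w = src v} = {w. (u,w) \<in> R}"
proof (rule Set.set_eqI)
  fix w
  show "w \<in> {w \<in> V. src w = src v} \<longleftrightarrow> w \<in> {w. (u,w) \<in> R}"
    using edge_iff[OF edgeD(1)[OF uv], of w] edgeD(2)[of u w] src_eq_rep[OF uv] by auto
qed

lemma card_src_fibre:
  assumes v: "v \<in> V"
  shows "card {w \<in> V. src w = src v} = d"
proof -
  obtain u where u: "(u,v) \<in> R" using ex_in[OF v] by blast
  show ?thesis unfolding src_fibre[OF u] by (rule out_card[OF edgeD(1)[OF u]])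
qed

lemma A_rep:
  assumes a: "a \<in> A" and u: "u \<in> V" "u' \<in> V"
  shows "rep (a u) = rep (a u') \<longleftrightarrow> rep u = rep u'"
proof -
  have aV: "a u \<in> V" "a u' \<in> V" using u A_V[OF a] by auto
  have "(\<forall>x. (a u,x) \<in> R \<longleftrightarrow> (a u',x) \<in> R) \<longleftrightarrow> (\<forall>x. (a u, a x) \<in> R \<longleftrightarrow> (a u', a x) \<in> R)"
  proof
    assume *: "\<forall>x. (a u, a x) \<in> R \<longleftrightarrow> (a u', a x) \<in> R"
    show "\<forall>x. (a u,x) \<in> R \<longleftrightarrow> (a u',x) \<in> R"
    proof
      fix x
      show "(a u,x) \<in> R \<longleftrightarrow> (a u',x) \<in> R"
        using *[rule_format, of "Hilbert_Choice.inv a x"] by (simp add: A_inv_apply(1)[OF a])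
    qed
  qed simp
  also have "\<dots> \<longleftrightarrow> (\<forall>x. (u,x) \<in> R \<longleftrightarrow> (u',x) \<in> R)" by (simp add: A_edge[OF a])
  finally show ?thesis unfolding rep_eq_iff[OF u] rep_eq_iff[OF aV] by (simp only: Set.set_eq_iff mem_Collect_eq)
qed

lemma A_src_rep:
  assumes a: "a \<in> A" and u: "u \<in> V" and v: "v \<in> V"
  shows "src (a v) = rep (a u) \<longleftrightarrow> src v = rep u"
proof -
  have "src (a v) = rep (a u) \<longleftrightarrow> (a u, a v) \<in> R"
    using edge_iff[of "a u" "a v"] A_V[OF a] u v by (simp add: eq_commute)
  also have "\<dots> \<longleftrightarrow> src v = rep u" unfolding A_edge[OF a] edge_iff[OF u v] by (rule eq_commute)
  finally show ?thesis .
qed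

lemma A_src:
  assumes a: "a \<in> A" and v: "v \<in> V" "v' \<in> V"
  shows "src (a v) = src (a v') \<longleftrightarrow> src v = src v'"
proof -
  obtain u where u: "u \<in> V" "src v' = rep u" using src_rep[OF v(2)] by blast
  have "src (a v') = rep (a u)" using A_src_rep[OF a u(1) v(2)] u(2) by simp
  then show ?thesis using A_src_rep[OF a u(1) v(1)] u(2) by simp
qed

text \<open>
  The arcs of the base with a given tail are \<open>d\<close> in number, and bundles of parallel arcs among them
  have the same size by vertex-transitivity. As \<open>d\<close> is prime, this size is 1 or \<open>d\<close>.
\<close>

lemma parallel_class_card:
  "(\<forall>v\<in>V. card {w \<in> V. src w = src v \<and> rep w = rep v} = 1) \<or>
   (\<forall>v\<in>V. card {w \<in> V. src w = src v \<and> rep w = rep v} = d)"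
proof -
  let ?C = "\<lambda>v. {w \<in> V. src w = src v \<and> rep w = rep v}"
  have const: "card (?C v) = card (?C u)" if u: "u \<in> V" and v: "v \<in> V" for u v
  proof -
    obtain a where a: "a \<in> A" "a u = v" using vtrans[OF u v] by blast
    have "bij_betw a (?C u) (?C v)"
      unfolding bij_betw_def
    proof
      show "inj_on a (?C u)" using A_inj[OF a(1)] by (simp add: inj_on_def)
      show "a ` ?C u = ?C v"
      proof
        show "a ` ?C u \<subseteq> ?C v"
        proof
          fix x assume "x \<in> a ` ?C u"
          then obtain w where w: "x = a w" "w \<in> V" "src w = src u" "rep w = rep u" by auto
          have "src x = src v" using A_src[OF a(1) w(2) u] w(1,3) a(2) by simp
          moreover have "rep x = rep v" using A_rep[OF a(1) w(2) u] w(1,4) a(2) by simp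
          moreover have "x \<in> V" using A_V[OF a(1)] w(1,2) by simp
          ultimately show "x \<in> ?C v" by simp
        qed
        show "?C v \<subseteq> a ` ?C u"
        proof
          fix w assume w: "w \<in> ?C v"
          let ?w = "Hilbert_Choice.inv a w"
          have aw: "a ?w = w" by (rule A_inv_apply(1)[OF a(1)])
          have wV: "?w \<in> V" using A_V[OF a(1), of ?w] aw w by simp
          have "src ?w = src u" using A_src[OF a(1) wV u] unfolding aw a(2) using w by simp
          moreover have "rep ?w = rep u" using A_rep[OF a(1) wV u] unfolding aw a(2) using w by simp
          ultimately have "?w \<in> ?C u" using wV by simp
          then show "w \<in> a ` ?C u" by (rule image_eqI[where f = a and x = "?w", OF aw[symmetric]])
        qed
      qed
    qed
    then show ?thesis by (simp add: bij_betw_same_card)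
  qed
  obtain v0 where v0: "v0 \<in> V" using card_V by fastforce
  let ?X = "{w \<in> V. src w = src v0}"
  have "card (?C v0) = 1 \<or> card (?C v0) = card ?X"
  proof (rule prime_equal_fibres)
    show "prime (card ?X)" using card_src_fibre[OF v0] prime_d by simp
    fix x assume x: "x \<in> ?X"
    have "{y \<in> ?X. rep y = rep x} = ?C x" using x by auto
    then show "card {y \<in> ?X. rep y = rep x} = card (?C v0)" using const[OF v0, of x] x by simp
  qed
  then show ?thesis using const[OF v0] card_src_fibre[OF v0] by simp
qed

text \<open>
  If the arcs with a given head also have a common tail, any permutation that preserves heads
  preserves tails as well, so it is an automorphism of the line digraph.
\<close>

lemma free_aut_if_parallel:
  assumes all: "\<forall>v\<in>V. card {w \<in> V. src w = src v \<and> rep w = rep v} = d"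
  shows "\<exists>g\<in>A. g \<noteq> id \<and> free_on V g"
proof -
  have V0: "V \<noteq> {}" using card_V by auto
  have eq: "src w = src v" if "v \<in> V" "w \<in> V" "rep w = rep v" for v w
  proof -
    have fin': "finite {w \<in> V. rep w = rep v}" using fin by simp
    have "{w \<in> V. src w = src v \<and> rep w = rep v} = {w \<in> V. rep w = rep v}"
      by (rule card_subset_eq[OF fin']) (use all card_rep_fibre that(1) in auto)
    then show ?thesis using that by blast
  qed
  obtain f where f: "free_on V f" "f \<noteq> id" "\<forall>x\<in>V. rep (f x) = rep x"
    using free_on_equal_fibres[OF fin V0 prime_ge_2_nat[OF prime_d] card_rep_fibre] by blast
  have perm: "f permutes V" using f(1) by (simp add: free_on_def)
  have "f \<in> A"
  proof (rule autsI[OF fin RV perm])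
    fix u v assume uv: "(u,v) \<in> R"
    have V: "u \<in> V" "v \<in> V" "f u \<in> V" "f v \<in> V"
      using edgeD[OF uv] permutes_in_image[OF perm] by auto
    have "src (f v) = src v" by (rule eq) (use V f(3) in auto)
    then show "(f u, f v) \<in> R" using edge_iff[OF V(3,4)] src_eq_rep[OF uv] f(3) V(1) by simp
  qed
  then show ?thesis using f by blast
qed

text \<open>
  Without parallel arcs the base is a digraph on which the automorphisms of the line digraph still act,
  transitively on vertices. Automorphisms of the base act on its arcs. If a power of such an action fixes
  an arc, the power of the automorphism of the base fixes its head, so it is trivial.
\<close>

lemma free_aut_if_not_parallel:
  assumes one: "\<forall>v\<in>V. card {w \<in> V. src w = src v \<and> rep w = rep v} = 1"
    and smaller: "\<And>(W :: 'a set) S. card W < card V \<Longrightarrow> card W \<ge> 2 \<Longrightarrow> transitive_digraph W S d \<Longrightarrow>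
        \<exists>h\<in>auts W S. h \<noteq> id \<and> free_on W h"
  shows "\<exists>g\<in>A. g \<noteq> id \<and> free_on V g"
proof -
  define W where "W = rep ` V"
  define S where "S = (\<lambda>v. (src v, rep v)) ` V"
  have finW: "finite W" using fin by (simp add: W_def)
  have repW: "rep v \<in> W" and srcW: "src v \<in> W" if "v \<in> V" for v
    using that src_rep[OF that] by (auto simp: W_def)
  have SW: "S \<subseteq> W \<times> W" using repW srcW by (auto simp: S_def)
  have joint: "v = w" if vw: "v \<in> V" "w \<in> V" "src w = src v" "rep w = rep v" for v w
  proof -
    obtain y where y: "{w \<in> V. src w = src v \<and> rep w = rep v} = {y}"
      using one vw(1) by (auto simp: card_1_singleton_iff)
    have "v \<in> {y}" "w \<in> {y}" unfolding y[symmetric] using vw by auto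
    then show ?thesis by simp
  qed
  have out_S: "card {s. (r,s) \<in> S} = d" if r: "r \<in> W" for r
  proof -
    obtain u where u: "u \<in> V" "r = rep u" using r by (auto simp: W_def)
    have "{s. (r,s) \<in> S} = rep ` {v. (u,v) \<in> R}"
    proof (intro equalityI subsetI)
      fix s assume "s \<in> {s. (r,s) \<in> S}"
      then obtain v where v: "v \<in> V" "r = src v" "s = rep v" by (auto simp: S_def)
      then show "s \<in> rep ` {v. (u,v) \<in> R}" using edge_iff[OF u(1) v(1)] u(2) by auto
    next
      fix s assume "s \<in> rep ` {v. (u,v) \<in> R}"
      then obtain v where v: "(u,v) \<in> R" "s = rep v" by auto
      then show "s \<in> {s. (r,s) \<in> S}" using src_eq_rep[OF v(1)] edgeD(2)[OF v(1)] u(2) v(2)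
        unfolding S_def by (intro CollectI image_eqI[where x = v]) simp_all
    qed
    moreover have "inj_on rep {v. (u,v) \<in> R}"
      using joint edgeD(2) src_eq_rep by (auto simp: inj_on_def)
    ultimately show ?thesis using out_card[OF u(1)] by (simp add: card_image)
  qed
  have irr: "(r,r) \<notin> S" for r
  proof
    assume "(r,r) \<in> S"
    then obtain v where "v \<in> V" "src v = rep v" by (auto simp: S_def)
    then have "(v,v) \<in> R" using edge_iff by simp
    then show False using irrefl by simp
  qed
  have trans_S: "\<exists>h\<in>auts W S. h r = s" if r: "r \<in> W" and s: "s \<in> W" for r s
  proof -
    have V: "r \<in> V" "s \<in> V" "rep r = r" "rep s = s" using r s rep_V rep_rep by (auto simp: W_def)
    obtain a where a: "a \<in> A" "a r = s" using vtrans[OF V(1,2)] by blast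
    \<comment> \<open>The automorphism that \<open>a\<close> induces on the base.\<close>
    define h where "h = (\<lambda>x. if x \<in> W then rep (a x) else x)"
    have h: "h (rep v) = rep (a v)" if v: "v \<in> V" for v
      using repW[OF v] A_rep[OF a(1) rep_V[OF v] v] rep_rep[OF v] by (simp add: h_def)
    have hW: "h permutes W"
    proof (rule permutes_if_inj_on[OF finW])
      show "h \<in> W \<rightarrow> W" using h A_V[OF a(1)] by (auto simp: W_def)
      show "inj_on h W" using h A_rep[OF a(1)] by (auto simp: W_def inj_on_def)
    qed (simp add: h_def)
    have "h \<in> auts W S"
    proof (rule autsI[OF finW SW hW])
      fix x y assume "(x,y) \<in> S"
      then obtain v where v: "v \<in> V" "x = src v" "y = rep v" by (auto simp: S_def)
      obtain u where u: "u \<in> V" "src v = rep u" using src_rep[OF v(1)] by blast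
      have "h x = src (a v)" using A_src_rep[OF a(1) u(1) v(1)] h[OF u(1)] u v by simp
      moreover have "h y = rep (a v)" using h v by simp
      moreover have "a v \<in> V" using v A_V[OF a(1)] by simp
      ultimately show "(h x, h y) \<in> S" unfolding S_def by (intro image_eqI[where x = "a v"]) simp_all
    qed
    moreover have "h r = s" using h[OF V(1)] V a(2) by simp
    ultimately show ?thesis by blast
  qed
  have vt: "transitive_digraph W S d"
    by unfold_locales (use finW SW irr trans_S out_S in auto)
  obtain v0 where v0: "v0 \<in> V" using card_V by fastforce
  have "card W \<ge> 2"
  proof -
    have "src v0 \<noteq> rep v0" using irr v0 by (auto simp: S_def)
    then have "card {src v0, rep v0} = 2" by simp
    then show ?thesis using card_mono[OF finW, of "{src v0, rep v0}"] repW[OF v0] srcW[OF v0] by simp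
  qed
  moreover have "card W < card V"
  proof -
    have "\<not> inj_on rep V"
    proof
      assume "inj_on rep V"
      then have "{u \<in> V. rep u = rep v0} = {v0}" using v0 by (auto simp: inj_on_def)
      then show False using card_rep_fibre[OF v0] prime_ge_2_nat[OF prime_d] by simp
    qed
    then show ?thesis unfolding W_def
      using card_image_le[OF fin, of rep] eq_card_imp_inj_on[OF fin, of rep] by linarith
  qed
  ultimately obtain h where h: "h \<in> auts W S" "h \<noteq> id" "free_on W h" using smaller[OF _ _ vt] by blast
  have hW: "h permutes W" using h(1) by (simp add: auts_def)
  have hfree: "h ^^ k = id" if "x \<in> W" "(h ^^ k) x = x" for k x
    using h(3) that unfolding free_on_def by blast
  have lift_ex: "\<exists>v'. v' \<in> V \<and> src v' = h (src v) \<and> rep v' = h (rep v)" if v: "v \<in> V" for v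
  proof -
    have "(src v, rep v) \<in> S" using v by (auto simp: S_def)
    then have "(h (src v), h (rep v)) \<in> S" using h(1) repW[OF v] srcW[OF v] by (simp add: auts_def)
    then show ?thesis by (auto simp: S_def)
  qed
  \<comment> \<open>The action of \<open>h\<close> on the arcs of the base.\<close>
  define f where "f = (\<lambda>v. if v \<in> V then SOME v'. v' \<in> V \<and> src v' = h (src v) \<and> rep v' = h (rep v) else v)"
  have f: "f v \<in> V" "src (f v) = h (src v)" "rep (f v) = h (rep v)" if "v \<in> V" for v
    using someI_ex[OF lift_ex[OF that]] that by (simp_all add: f_def)
  have hinj: "x = y" if "h x = h y" for x y using permutes_inj[OF hW] that by (rule injD)
  have perm: "f permutes V"
  proof (rule permutes_if_inj_on[OF fin])
    show "inj_on f V"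
    proof (rule inj_onI)
      fix v w assume vw: "v \<in> V" "w \<in> V" "f v = f w"
      then have "h (src w) = h (src v)" "h (rep w) = h (rep v)" using f by metis+
      then show "v = w" using joint[OF vw(1,2)] hinj by blast
    qed
  qed (use f(1) in \<open>auto simp: f_def\<close>)
  have fA: "f \<in> A"
  proof (rule autsI[OF fin RV perm])
    fix u v assume uv: "(u,v) \<in> R"
    have V: "u \<in> V" "v \<in> V" using edgeD[OF uv] by auto
    show "(f u, f v) \<in> R"
      using edge_iff[OF f(1)[OF V(1)] f(1)[OF V(2)]] f(3)[OF V(1)] f(2)[OF V(2)] src_eq_rep[OF uv] by simp
  qed
  have pow: "(f ^^ k) v \<in> V \<and> src ((f ^^ k) v) = (h ^^ k) (src v) \<and> rep ((f ^^ k) v) = (h ^^ k) (rep v)"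
    if "v \<in> V" for k v
    by (induction k) (use that f in auto)
  have "free_on V f"
  proof (rule free_onI[OF fA])
    fix k v assume v: "v \<in> V" "(f ^^ k) v = v"
    have "(h ^^ k) (rep v) = rep v" using pow[OF v(1), of k] v(2) by simp
    then have hk: "h ^^ k = id" by (rule hfree[OF repW[OF v(1)]])
    show "f ^^ k = id"
    proof (rule A_eq_id[OF A_funpow[OF fA]])
      fix u assume u: "u \<in> V"
      show "(f ^^ k) u = u" using joint[OF u] pow[OF u, of k] hk by (metis id_apply)
    qed
  qed
  moreover have "f \<noteq> id"
  proof
    assume "f = id"
    then have "h x = x" if "x \<in> W" for x using f(3) that by (auto simp: W_def)
    then have "h = id" using permutes_not_in[OF hW] by (metis eq_id_iff)
    then show False using h(2) by simp
  qed
  ultimately show ?thesis using fA by blast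
qed

end

text \<open>Induction on the number of vertices; it is used for a component and for the base of a line digraph.\<close>

theorem ex_free_aut:
  assumes "transitive_digraph V R d" "card V \<ge> 2" "d \<le> 3"
  shows "\<exists>g\<in>auts V R. g \<noteq> id \<and> free_on V g"
  using assms
proof (induction "card V" arbitrary: V R rule: less_induct)
  case less
  interpret transitive_digraph V R d by (rule less.prems(1))
  note d = less.prems(3)
  have V0: "V \<noteq> {}" using less.prems(2) by auto
  show ?case
  proof (cases "d = 0")
    case True
    have "\<exists>f. free_on V f \<and> f \<noteq> id \<and> (\<forall>x\<in>V. () = ())"
      by (rule free_on_equal_fibres[where c = "\<lambda>_. ()", OF fin V0 less.prems(2)]) simp
    then obtain f where f: "free_on V f" "f \<noteq> id" by blast
    have "R = {}"
    proof (rule ccontr)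
      assume "R \<noteq> {}"
      then obtain v w where vw: "(v,w) \<in> R" by auto
      have "finite {w. (v,w) \<in> R}" by (rule finite_subset[OF _ fin]) (auto dest: edgeD)
      then have "{w. (v,w) \<in> R} = {}" using out_card[OF edgeD(1)[OF vw]] True by simp
      then show False using vw by blast
    qed
    then have "f \<in> A" using f(1) by (simp add: auts_def free_on_def)
    then show ?thesis using f by blast
  next
    case False
    show ?thesis
    proof (cases "\<forall>u\<in>V. \<forall>v\<in>V. (u,v) \<in> R\<^sup>*")
      case nconn: False
      then obtain v0 v1 where v: "v0 \<in> V" "v1 \<in> V" "(v0,v1) \<notin> R\<^sup>*" by blast
      let ?C = "R\<^sup>* `` {v0}"
      have CV: "?C \<subseteq> V" using rtrancl_V v(1) by auto
      have "card ?C < card V" by (rule psubset_card_mono[OF fin]) (use CV v in auto)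
      moreover have "card ?C \<ge> 2"
      proof -
        have "card {w. (v0,w) \<in> R} \<noteq> 0" using out_card[OF v(1)] False by simp
        then obtain w where w: "(v0,w) \<in> R" by fastforce
        then have "v0 \<noteq> w" using irrefl by blast
        then have "card {v0,w} = 2" by simp
        moreover have "{v0,w} \<subseteq> ?C" using w by auto
        ultimately show ?thesis using card_mono[OF finite_subset[OF CV fin], of "{v0,w}"] by simp
      qed
      ultimately obtain g where "g \<in> auts ?C (R \<inter> ?C \<times> ?C)" "g \<noteq> id" "free_on ?C g"
        using less.hyps[OF _ component_transitive_digraph[OF v(1)] _ d] by blast
      then show ?thesis by (rule free_aut_from_component[OF v(1)])
    next
      case conn: True
      interpret connected_transitive_digraph V R d
        by unfold_locales (use conn less.prems(2) in auto)
      show ?thesis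
      proof (cases "d = 3 \<and> arc_transitive")
        case False
        then show ?thesis by (rule free_aut_if_not_arc_transitive[OF d])
      next
        case True
        show ?thesis
        proof (cases "\<forall>u v w. (u,w) \<in> R \<longrightarrow> (v,w) \<in> R \<longrightarrow> {x. (u,x) \<in> R} = {x. (v,x) \<in> R}")
          case False
          then show ?thesis using free_aut_or_equal_out_neighbourhoods True by blast
        next
          case eq: True
          interpret line_transitive_digraph V R d
          proof
            show "prime d" using True by simp
            show "{x. (u,x) \<in> R} = {x. (v,x) \<in> R}" if "(u,w) \<in> R" "(v,w) \<in> R" for u v w
              using eq that by blast
          qed
          show ?thesis
            using parallel_class_card
          proof
            assume "\<forall>v\<in>V. card {w \<in> V. src w = src v \<and> rep w = rep v} = d"
            then show ?thesis by (rule free_aut_if_parallel)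
          next
            assume "\<forall>v\<in>V. card {w \<in> V. src w = src v \<and> rep w = rep v} = 1"
            then show ?thesis
              by (rule free_aut_if_not_parallel) (use less.hyps d in blast)
          qed
        qed
      qed
    qed
  qed
qed

theorem corollary1p3:
  fixes G :: "'a pair_pre_digraph" and d :: nat
  assumes "pair_digraph G"
    and "card (pverts G) \<ge> 2"
    and "vertex_transitive G"
    and "has_out_valency G d"
    and "d \<le> 3"
  shows "\<exists>g\<in>automorphisms G. g \<noteq> id \<and> semiregular_on (pverts G) g"
proof -
  interpret G: pair_digraph G by (rule assms(1))
  have aut: "automorphisms G = auts (pverts G) (parcs G)"
    by (simp add: automorphisms_def auts_def)
  have out: "card {w. (v,w) \<in> parcs G} = d" if v: "v \<in> pverts G" for v
  proof -
    have "out_arcs (with_proj G) v = Pair v ` {w. (v,w) \<in> parcs G}"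
      by (auto simp: out_arcs_def)
    then have "out_degree (with_proj G) v = card {w. (v,w) \<in> parcs G}"
      by (simp add: out_degree_def card_image inj_on_def)
    then show ?thesis using assms(4) v by (simp add: has_out_valency_def)
  qed
  have "transitive_digraph (pverts G) (parcs G) d"
  proof
    show "finite (pverts G)" by (rule G.pair_finite_verts)
    show "parcs G \<subseteq> pverts G \<times> pverts G" using G.in_arcsD1 G.in_arcsD2 by auto
    show "(v,v) \<notin> parcs G" for v using G.pair_no_loops[of "(v,v)"] by auto
    show "\<exists>g\<in>auts (pverts G) (parcs G). g u = v" if "u \<in> pverts G" "v \<in> pverts G" for u v
      using assms(3) that by (simp add: vertex_transitive_def aut)
    show "card {w. (v,w) \<in> parcs G} = d" if "v \<in> pverts G" for v by (rule out[OF that])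
  qed
  from ex_free_aut[OF this assms(2,5)] show ?thesis
    unfolding aut using semiregular_on_if_free_on[OF G.pair_finite_verts] by blast
qed

end
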